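(* Let $\mathcal{P}\subset\mathbb{R}^n$ be a pure $n$-dimensional hereditary polytopal complex and $r\ge 0$ an integer. (1) Suppose $\mathcal{P}$ is central (with the common point of the hyperplanes of $\mathcal{A}(\mathcal{P})$ placed at the origin). Then for $0\le k\le n-1$ the first $k+1$ coefficients (those of $d^{n-1},d^{n-2},\dots,d^{n-1-k}$) of the Hilbert polynomials $HP(C^r(\mathcal{P}),d)$ and $HP(LS^{r,k}(\mathcal{P}),d)$ agree. In particular, $LS^{r,n-1}(\mathcal{P})_d=C^r(\mathcal{P})_d$ for $d\gg 0$. (2) $LS^{r,n}_d(\mathcal{P})=C^r_d(\mathcal{P})$ for $d\gg 0$. Equivalently, for $d\gg 0$ the vector space $C^r_d(\mathcal{P})$ has a basis consisting of lattice-supported splines, i.e. splines each of which lies in $C^r_{W,d}(\mathcal{P})$ for some $W\in L_{\widehat{\mathcal{P}}}$ with $\mathrm{rk}(W)\le n$.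
   Context: A polytopal complex $\mathcal{P}\subset\mathbb{R}^n$ is a finite set of convex polytopes (faces) such that every face of a member is a member and the intersection of any two members is a (possibly empty) face of both. It is pure $n$-dimensional if all its maximal faces (called facets) have dimension $n$. $\mathcal{P}_i$ is the set of $i$-faces and $\mathcal{P}_i^0$ the set of interior $i$-faces (an $(n-1)$-face is interior iff it lies in two facets). $G(\mathcal{P})$ is the graph on the facets in which $\sigma,\sigma'$ are adjacent iff $\sigma\cap\sigma'\in\mathcal{P}_{n-1}$. The star $\mathrm{st}(\gamma)$ of a face $\gamma$ is the subcomplex of all faces of facets containing $\gamma$. $\mathcal{P}$ is hereditary if $G(\mathrm{st}(\gamma))$ is connected for every nonempty $\gamma\in\mathcal{P}$. $R=\mathbb{R}[x_1,\dots,x_n]$. For $\tau\in\mathcal{P}_{n-1}$, $\mathrm{aff}(\tau)$ is its affine span and $l_\tau\in R$ a degree-one polynomial generating the ideal of $\mathrm{aff}(\tau)$. $C^r(\mathcal{P})$ is the $R$-module of piecewise polynomial functions on $\mathcal{P}$ (splines) continuously differentiable of order $r$, identified with the tuples $F=(F_\sigma)\in\bigoplus_{\sigma\in\mathcal{P}_n}R$ such that $l_\tau^{r+1}$ divides $F_\sigma-F_{\sigma'}$ whenever $\sigma\cap\sigma'=\tau\in\mathcal{P}_{n-1}$. $C^r_d(\mathcal{P})$ is the subspace of $F$ with all $F_\sigma$ of degree $\le d$. For a subcomplex $\mathcal{Q}\subset\mathcal{P}$ generated by facets of $\mathcal{P}$, $C^r_{\mathcal{Q}}(\mathcal{P})=\{F\in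 C^r(\mathcal{P}): F_\sigma=0 \text{ for all facets }\sigma\notin\mathcal{Q}\}$. $\mathcal{A}(\mathcal{P})$ is the hyperplane arrangement $\{\mathrm{aff}(\tau):\tau\in\mathcal{P}_{n-1}^0\}$. $\mathcal{P}$ is central if all these hyperplanes share a common point. In that case, after placing that point at the origin, $C^r(\mathcal{P})$ is graded, $C^r(\mathcal{P})_d$ being the $F$ with all $F_\sigma$ homogeneous of degree $d$ (or zero). Homogenization: $\widehat{\mathcal{P}}\subset\mathbb{R}^{n+1}$ is the complex obtained by coning $\{1\}\times\mathcal{P}$ with the origin (join with the origin); coordinates on $\mathbb{R}^{n+1}$ are $x_0,\dots,x_n$. For an interior $(n-1)$-face $\tau$ of $\mathcal{P}$, let $H_\tau\subset\mathbb{R}^{n+1}$ be the linear span of $\{1\}\times\tau$. $L_{\widehat{\mathcal{P}}}$ is the set of all intersections of the hyperplanes $H_\tau$, $\tau\in\mathcal{P}_{n-1}^0$ (including the empty intersection $\mathbb{R}^{n+1}$), with $\mathrm{rk}(W)=\mathrm{codim}(W)$. For $W\in L_{\widehat{\mathcal{P}}}$, $W\ne\mathbb{R}^{n+1}$, let $G_W$ be the graph whose vertices are the facets of $\mathcal{P}$ having an interior $(n-1)$-face $\tau$ with $W\subset H_\tau$, with $\sigma_1,\sigma_2$ adjacent iff $\sigma_1\cap\sigma_2=\tau\in\mathcal{P}_{n-1}$ with $W\subset H_\tau$. The components $\mathcal{P}_W^1,\dots,\mathcal{P}_W^m$ of $\mathcal{P}_W$ are the subcomplexes generated by the facets in the respective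 connected components of $G_W$. For $W=\mathbb{R}^{n+1}$ the components of $\mathcal{P}_W$ are the individual facets of $\mathcal{P}$. $C^r_W(\mathcal{P})=\bigoplus_{i=1}^m C^r_{\mathcal{P}_W^i}(\mathcal{P})$ (internal direct sum in $C^r(\mathcal P)$) and $LS^{r,k}(\mathcal{P})=\sum_{W\in L_{\widehat{\mathcal{P}}},\,0\le\mathrm{rk}(W)\le k}C^r_W(\mathcal{P})$. Further $C^r_{W,d}(\mathcal{P})=C^r_W(\mathcal{P})\cap C^r_d(\mathcal{P})$ and $LS^{r,k}_d(\mathcal{P})=\sum_{W\in L_{\widehat{\mathcal{P}}},\,0\le \mathrm{rk}(W)\le k}C^r_{W,d}(\mathcal{P})$. If $\mathcal{P}$ is central (at the origin), $LS^{r,k}(\mathcal{P})$ is graded with $LS^{r,k}(\mathcal{P})_d=\{F\in LS^{r,k}(\mathcal{P}): F_\sigma \text{ homogeneous of degree } d \text{ or zero for all facets }\sigma\}$. For a finitely generated graded module $M$, $HP(M,d)$ denotes the polynomial agreeing with $\dim_{\mathbb{R}}M_d$ for $d\gg0$. *)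

theory Defs
  imports
    "HOL-Analysis.Analysis"
    "HOL-Computational_Algebra.Polynomial"
    "HOL-Library.Poly_Mapping"
    "HOL-Library.Set_Algebras"
    "HOL-Library.Function_Algebras"
begin

section \<open>The polynomial ring in the coordinates of a Euclidean space\<close>

text \<open>
  Polynomials in finitely many variables indexed by \<open>'n\<close>: finitely supported maps from
  exponent vectors to real coefficients, with the convolution product of
  \<^theory>\<open>HOL-Library.Poly_Mapping\<close>.
\<close>

type_synonym 'n rpoly = "('n \<Rightarrow>\<^sub>0 nat) \<Rightarrow>\<^sub>0 real"

definition mon_degree :: "('n::finite \<Rightarrow>\<^sub>0 nat) \<Rightarrow> nat" where
  "mon_degree m = (\<Sum>i\<in>UNIV. Poly_Mapping.lookup m i)"

text \<open>Convention: the zero polynomial gets total degree 0 (so it has degree at most \<open>d\<close> for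
  every \<open>d\<close>).\<close>

definition total_degree :: "('n::finite) rpoly \<Rightarrow> nat" where
  "total_degree p = Max (insert 0 (mon_degree ` Poly_Mapping.keys p))"

text \<open>Homogeneous of degree \<open>d\<close>, or zero.\<close>

definition homogeneous :: "nat \<Rightarrow> ('n::finite) rpoly \<Rightarrow> bool" where
  "homogeneous d p \<longleftrightarrow> (\<forall>m\<in>Poly_Mapping.keys p. mon_degree m = d)"

definition poly_eval :: "('n::finite) rpoly \<Rightarrow> real ^ 'n \<Rightarrow> real" where
  "poly_eval p x =
     (\<Sum>m\<in>Poly_Mapping.keys p. Poly_Mapping.lookup p m * (\<Prod>i\<in>UNIV. x $ i ^ Poly_Mapping.lookup m i))"

definition vanishing_ideal :: "(real ^ 'n) set \<Rightarrow> ('n::finite) rpoly set" where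
  "vanishing_ideal S = {p. \<forall>x\<in>S. poly_eval p x = 0}"


section \<open>Polytopal complexes\<close>

text \<open>In \<^const>\<open>face_of\<close> the empty set and the polytope itself count as faces.\<close>

definition polytopal_complex :: "(real ^ 'n) set set \<Rightarrow> bool" where
  "polytopal_complex P \<longleftrightarrow>
     finite P \<and> (\<forall>\<sigma>\<in>P. polytope \<sigma>) \<and>
     (\<forall>\<sigma>\<in>P. \<forall>\<gamma>. \<gamma> face_of \<sigma> \<longrightarrow> \<gamma> \<in> P) \<and>
     (\<forall>\<sigma>\<in>P. \<forall>\<tau>\<in>P. (\<sigma> \<inter> \<tau>) face_of \<sigma> \<and> (\<sigma> \<inter> \<tau>) face_of \<tau>)"

definition faces_of_dim :: "(real ^ 'n) set set \<Rightarrow> int \<Rightarrow> (real ^ 'n) set set" where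
  "faces_of_dim P i = {\<gamma>\<in>P. aff_dim \<gamma> = i}"

definition facets :: "(real ^ 'n) set set \<Rightarrow> (real ^ 'n) set set" where
  "facets P = {\<sigma>\<in>P. \<forall>\<tau>\<in>P. \<sigma> \<subseteq> \<tau> \<longrightarrow> \<tau> = \<sigma>}"

definition pure_full_dim :: "(real ^ 'n) set set \<Rightarrow> bool" where
  "pure_full_dim P \<longleftrightarrow> (\<forall>\<sigma>\<in>facets P. aff_dim \<sigma> = int CARD('n))"

text \<open>Hence in a pure complex the facets are the same as the \<open>n\<close>-dimensional faces.\<close>

lemma facets_pure_full_dim:
  fixes P :: "(real ^ 'n) set set"
  assumes P: "polytopal_complex P" and pure: "pure_full_dim P"
  shows "facets P = faces_of_dim P (int CARD('n))"
proof
  show "facets P \<subseteq> faces_of_dim P (int CARD('n))"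
    using pure by (auto simp: facets_def pure_full_dim_def faces_of_dim_def)
  show "faces_of_dim P (int CARD('n)) \<subseteq> facets P"
  proof
    fix \<sigma> assume "\<sigma> \<in> faces_of_dim P (int CARD('n))"
    then have \<sigma>: "\<sigma> \<in> P" "aff_dim \<sigma> = int CARD('n)" by (auto simp: faces_of_dim_def)
    have "\<tau> = \<sigma>" if \<tau>: "\<tau> \<in> P" "\<sigma> \<subseteq> \<tau>" for \<tau>
    proof (rule ccontr)
      assume ne: "\<tau> \<noteq> \<sigma>"
      have "(\<sigma> \<inter> \<tau>) face_of \<tau>" using P \<sigma>(1) \<tau>(1) by (auto simp: polytopal_complex_def)
      then have "\<sigma> face_of \<tau>" using \<tau>(2) by (simp add: Int_absorb2)
      moreover have "convex \<tau>"
        using P \<tau>(1) by (auto simp: polytopal_complex_def polytope_imp_convex)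
      ultimately have "aff_dim \<sigma> < aff_dim \<tau>" using ne face_of_aff_dim_lt by blast
      moreover have "aff_dim \<tau> \<le> int CARD('n)" using aff_dim_le_DIM[of \<tau>] by simp
      ultimately show False using \<sigma>(2) by simp
    qed
    then show "\<sigma> \<in> facets P" using \<sigma>(1) by (auto simp: facets_def)
  qed
qed

definition interior_codim1_faces :: "(real ^ 'n) set set \<Rightarrow> (real ^ 'n) set set" where
  "interior_codim1_faces P =
     {\<tau>\<in>faces_of_dim P (int CARD('n) - 1).
        \<exists>\<sigma>\<in>facets P. \<exists>\<sigma>'\<in>facets P. \<sigma> \<noteq> \<sigma>' \<and> \<tau> \<subseteq> \<sigma> \<and> \<tau> \<subseteq> \<sigma>'}"

text \<open>The edge relation of the graph \<open>G(P)\<close> on the facets. Since facets of a pure complex have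
  dimension \<open>n\<close>, adjacent facets are distinct.\<close>

definition facet_adj :: "(real ^ 'n) set set \<Rightarrow> ((real ^ 'n) set \<times> (real ^ 'n) set) set" where
  "facet_adj P =
     {(\<sigma>, \<sigma>'). \<sigma> \<in> facets P \<and> \<sigma>' \<in> facets P \<and> \<sigma> \<inter> \<sigma>' \<in> faces_of_dim P (int CARD('n) - 1)}"

definition generated_subcomplex :: "(real ^ 'n) set set \<Rightarrow> (real ^ 'n) set set" where
  "generated_subcomplex K = {\<gamma>. \<exists>\<sigma>\<in>K. \<gamma> face_of \<sigma>}"

definition star :: "(real ^ 'n) set set \<Rightarrow> (real ^ 'n) set \<Rightarrow> (real ^ 'n) set set" where
  "star P \<gamma> = generated_subcomplex {\<sigma>\<in>facets P. \<gamma> \<subseteq> \<sigma>}"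

definition facet_connected :: "(real ^ 'n) set set \<Rightarrow> bool" where
  "facet_connected P \<longleftrightarrow> (\<forall>\<sigma>\<in>facets P. \<forall>\<sigma>'\<in>facets P. (\<sigma>, \<sigma>') \<in> (facet_adj P)\<^sup>*)"

definition hereditary :: "(real ^ 'n) set set \<Rightarrow> bool" where
  "hereditary P \<longleftrightarrow> (\<forall>\<gamma>\<in>P. \<gamma> \<noteq> {} \<longrightarrow> facet_connected (star P \<gamma>))"

definition hyperplane_arrangement :: "(real ^ 'n) set set \<Rightarrow> (real ^ 'n) set set" where
  "hyperplane_arrangement P = (\<lambda>\<tau>. affine hull \<tau>) ` interior_codim1_faces P"

definition central_at :: "real ^ 'n \<Rightarrow> (real ^ 'n) set set \<Rightarrow> bool" where
  "central_at c P \<longleftrightarrow> (\<forall>H\<in>hyperplane_arrangement P. c \<in> H)"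


section \<open>Splines\<close>

text \<open>A generator, unique up to a nonzero scalar, of the ideal of the hyperplane spanned by a
  codimension-one face; divisibility by its powers does not depend on the choice.\<close>

definition hyperplane_form :: "(real ^ 'n::finite) set \<Rightarrow> 'n rpoly" where
  "hyperplane_form \<tau> =
     (SOME l. total_degree l = 1 \<and> {p * l | p. True} = vanishing_ideal (affine hull \<tau>))"

text \<open>A tuple of polynomials indexed by the facets is a function on all sets that is zero off
  the facets.\<close>

type_synonym 'n tuple = "(real ^ 'n) set \<Rightarrow> 'n rpoly"

definition splines :: "(real ^ 'n::finite) set set \<Rightarrow> nat \<Rightarrow> 'n tuple set" where
  "splines P r =
     {F. (\<forall>\<sigma>. \<sigma> \<notin> facets P \<longrightarrow> F \<sigma> = 0) \<and>
         (\<forall>\<sigma>\<in>facets P. \<forall>\<sigma>'\<in>facets P. \<sigma> \<inter> \<sigma>' \<in> faces_of_dim P (int CARD('n) - 1) \<longrightarrow>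
            hyperplane_form (\<sigma> \<inter> \<sigma>') ^ (r + 1) dvd F \<sigma> - F \<sigma>')}"

definition splines_upto :: "(real ^ 'n::finite) set set \<Rightarrow> nat \<Rightarrow> nat \<Rightarrow> 'n tuple set" where
  "splines_upto P r d = {F\<in>splines P r. \<forall>\<sigma>\<in>facets P. total_degree (F \<sigma>) \<le> d}"

definition supported_splines ::
  "(real ^ 'n::finite) set set \<Rightarrow> nat \<Rightarrow> (real ^ 'n) set set \<Rightarrow> 'n tuple set" where
  "supported_splines P r Q = {F\<in>splines P r. \<forall>\<sigma>\<in>facets P. \<sigma> \<notin> Q \<longrightarrow> F \<sigma> = 0}"

definition graded_part ::
  "(real ^ 'n::finite) set set \<Rightarrow> 'n tuple set \<Rightarrow> nat \<Rightarrow> 'n tuple set" where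
  "graded_part P M d = {F\<in>M. \<forall>\<sigma>\<in>facets P. homogeneous d (F \<sigma>)}"

text \<open>The real vector space structure on tuples.\<close>

definition tuple_scale :: "real \<Rightarrow> ('n::finite) tuple \<Rightarrow> 'n tuple" where
  "tuple_scale c F = (\<lambda>\<sigma>. Poly_Mapping.single 0 c * F \<sigma>)"

interpretation tuple_space: vector_space tuple_scale
  by unfold_locales
    (auto simp: tuple_scale_def fun_eq_iff distrib_left distrib_right single_add mult_single single_one
      simp flip: mult.assoc)

definition hilbert_poly :: "(real ^ 'n::finite) set set \<Rightarrow> 'n tuple set \<Rightarrow> real poly" where
  "hilbert_poly P M =
     (THE h. \<forall>\<^sub>F d in sequentially. poly h (real d) = real (tuple_space.dim (graded_part P M d)))"


section \<open>The lattice of the homogenized arrangement\<close>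

text \<open>The coordinates on the homogenization are \<open>(x\<^sub>0, x)\<close> in \<open>real \<times> (real ^ 'n)\<close>.\<close>

definition cone_hyperplane :: "(real ^ 'n) set \<Rightarrow> (real \<times> (real ^ 'n)) set" where
  "cone_hyperplane \<tau> = span ({1} \<times> \<tau>)"

definition cone_lattice :: "(real ^ 'n) set set \<Rightarrow> (real \<times> (real ^ 'n)) set set" where
  "cone_lattice P = {\<Inter>S | S. S \<subseteq> cone_hyperplane ` interior_codim1_faces P}"

definition rk :: "(real \<times> (real ^ 'n)) set \<Rightarrow> nat" where
  "rk W = DIM(real \<times> (real ^ 'n)) - dim W"

definition cone_lattice_upto :: "(real ^ 'n) set set \<Rightarrow> nat \<Rightarrow> (real \<times> (real ^ 'n)) set set" where
  "cone_lattice_upto P k = {W\<in>cone_lattice P. rk W \<le> k}"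


section \<open>Lattice-supported splines\<close>

definition GW_verts ::
  "(real ^ 'n) set set \<Rightarrow> (real \<times> (real ^ 'n)) set \<Rightarrow> (real ^ 'n) set set" where
  "GW_verts P W =
     {\<sigma>\<in>facets P. \<exists>\<tau>\<in>interior_codim1_faces P. \<tau> face_of \<sigma> \<and> W \<subseteq> cone_hyperplane \<tau>}"

definition GW_adj ::
  "(real ^ 'n) set set \<Rightarrow> (real \<times> (real ^ 'n)) set \<Rightarrow> ((real ^ 'n) set \<times> (real ^ 'n) set) set" where
  "GW_adj P W =
     {(\<sigma>, \<sigma>'). \<sigma> \<in> GW_verts P W \<and> \<sigma>' \<in> GW_verts P W \<and>
        \<sigma> \<inter> \<sigma>' \<in> faces_of_dim P (int CARD('n) - 1) \<and> W \<subseteq> cone_hyperplane (\<sigma> \<inter> \<sigma>')}"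

definition components_PW ::
  "(real ^ 'n) set set \<Rightarrow> (real \<times> (real ^ 'n)) set \<Rightarrow> (real ^ 'n) set set set" where
  "components_PW P W =
     (if W = UNIV then (\<lambda>\<sigma>. generated_subcomplex {\<sigma>}) ` facets P
      else generated_subcomplex ` (GW_verts P W // ((GW_adj P W)\<^sup>* \<inter> GW_verts P W \<times> GW_verts P W)))"

text \<open>The sums below are finite sums of sets of tuples in the sense of
  \<^theory>\<open>HOL-Library.Set_Algebras\<close>, i.e. sums of subspaces.\<close>

definition CW :: "(real ^ 'n::finite) set set \<Rightarrow> nat \<Rightarrow> (real \<times> (real ^ 'n)) set \<Rightarrow> 'n tuple set" where
  "CW P r W = (\<Sum>Q\<in>components_PW P W. supported_splines P r Q)"

definition CW_upto ::
  "(real ^ 'n::finite) set set \<Rightarrow> nat \<Rightarrow> (real \<times> (real ^ 'n)) set \<Rightarrow> nat \<Rightarrow> 'n tuple set" where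
  "CW_upto P r W d = CW P r W \<inter> splines_upto P r d"

definition LS :: "(real ^ 'n::finite) set set \<Rightarrow> nat \<Rightarrow> nat \<Rightarrow> 'n tuple set" where
  "LS P r k = (\<Sum>W\<in>cone_lattice_upto P k. CW P r W)"

definition LS_upto :: "(real ^ 'n::finite) set set \<Rightarrow> nat \<Rightarrow> nat \<Rightarrow> nat \<Rightarrow> 'n tuple set" where
  "LS_upto P r k d = (\<Sum>W\<in>cone_lattice_upto P k. CW_upto P r W d)"

end

theory Submission
  imports Defs "HOL-Computational_Algebra.Primes"
begin

text \<open>
  For a set \<open>S\<close> of interior faces of codimension one let \<open>l\<^sub>S\<close> be the product of their forms, and let
  \<open>W\<close> be the intersection of the hyperplanes \<open>H\<^sub>\<tau>\<close> of the other faces. If \<open>F\<close> is a spline, then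
  \<open>l\<^sub>S ^ (r + 1) F\<close> may be cut into pieces along all faces in \<open>S\<close> and remains a spline. The
  pieces on the components of \<open>P\<^sub>W\<close> and on the facets outside \<open>P\<^sub>W\<close> show that it is a sum of elements of
  \<open>C\<^sup>r\<^sub>W\<close> and of splines supported on single facets (\<open>product_in_lattice_sum\<close>). So \<open>l\<^sub>S ^ (r + 1)\<close> carries all
  splines into \<open>LS\<^sup>r\<^sup>,\<^sup>k\<close> as soon as the forms outside \<open>S\<close> have rank at most \<open>k\<close>.

  These products generate an ideal whose zero set has codimension greater than \<open>k\<close>. An induction makes
  this quantitative without any dimension theory (\<open>growth_bounded_of_products\<close>): if the forms outside
  \<open>S\<close> have rank greater than \<open>k\<close>, take \<open>k + 1\<close> independent ones. Modulo their powers
  \<open>l ^ (r + 1)\<close> a finitely generated module grows like a polynomial ring in \<open>k + 1\<close> fewer variables, and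
  multiples of such a power are handled by adding the face to \<open>S\<close>. Hence \<open>C\<^sup>r / LS\<^sup>r\<^sup>,\<^sup>k\<close> grows
  at most like a polynomial ring in \<open>N - k - 1\<close> variables, where \<open>N\<close> is the dimension of the space of
  available forms, and it vanishes in large degrees if \<open>N = k + 1\<close>.

  In the central case the forms are linear, the modules are graded and \<open>N = n\<close>. In general one
  takes the filtration by degree, on which all polynomials of degree at most one act, so that
  \<open>N = n + 1\<close>; this replaces the passage to the homogenization. Both cases are treated together as
  families of spaces with an action of forms.

  Finite generation and the existence of Hilbert polynomials come from leading terms: by Dickson's lemma
  (\<open>dickson\<close>) the leading positions of a submodule are the multiples of finitely many, and by inclusion and
  exclusion their number in degree \<open>d\<close> is eventually a polynomial in \<open>d\<close>. The ideal of a hyperplane is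
  generated by an affine form (\<open>vanishing_ideal_hyperplane\<close>), so every generator of degree one of the ideal
  of a face is an affine form, and its homogenization cuts out \<open>H\<^sub>\<tau>\<close>.
\<close>

section \<open>Polynomials and their evaluation\<close>

lemma rpoly_sum_monomials: "p = (\<Sum>m\<in>Poly_Mapping.keys p. Poly_Mapping.single m (Poly_Mapping.lookup p m))"
  by (rule poly_mapping_eqI)
    (auto simp: lookup_sum lookup_single when_def sum.delta in_keys_iff)

lemma rpoly_induct [case_names monomial add]:
  fixes p :: "'n::finite rpoly"
  assumes "\<And>m c. Q (Poly_Mapping.single m c)" and "\<And>p q. Q p \<Longrightarrow> Q q \<Longrightarrow> Q (p + q)"
  shows "Q p"
proof -
  have "Q 0" using assms(1)[of 0 0] by simp
  have "Q (\<Sum>m\<in>M. Poly_Mapping.single m (f m))" if "finite M" for M f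
    using that \<open>Q 0\<close> by (induction M rule: finite_induct) (auto intro: assms)
  then show ?thesis by (subst rpoly_sum_monomials) auto
qed

lemma lookup_monomial_mult:
  "Poly_Mapping.lookup (Poly_Mapping.single u c * p) (u + m) = c * Poly_Mapping.lookup (p :: 'n::finite rpoly) m"
  by (induction p rule: rpoly_induct)
    (auto simp: mult_single lookup_single when_def distrib_left lookup_add)

lemma keys_monomial_mult:
  "Poly_Mapping.keys (Poly_Mapping.single u c * (p :: 'n::finite rpoly)) \<subseteq> (\<lambda>m. u + m) ` Poly_Mapping.keys p"
proof -
  have "Poly_Mapping.keys (Poly_Mapping.single u c * p) \<subseteq> {a + b |a b. a \<in> Poly_Mapping.keys (Poly_Mapping.single u c) \<and> b \<in> Poly_Mapping.keys p}"
    by (rule keys_mult)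
  then show ?thesis by (auto split: if_splits)
qed

lemma lookup_const_mult:
  "Poly_Mapping.lookup (Poly_Mapping.single 0 c * (p :: 'n::finite rpoly)) m = c * Poly_Mapping.lookup p m"
  using lookup_monomial_mult[of 0 c p m] by simp

lemma mon_degree_add: "mon_degree (m + m') = mon_degree m + mon_degree m'"
  by (simp add: mon_degree_def lookup_add sum.distrib)

lemma mon_degree_0 [simp]: "mon_degree 0 = 0"
  by (simp add: mon_degree_def)

lemma mon_degree_single [simp]: "mon_degree (Poly_Mapping.single i k) = k"
  by (simp add: mon_degree_def lookup_single when_def)

lemma total_degree_le_iff:
  "total_degree p \<le> d \<longleftrightarrow> (\<forall>m\<in>Poly_Mapping.keys p. mon_degree m \<le> d)"
  by (auto simp: total_degree_def)

text \<open>The value of the monomial with exponent vector \<open>m\<close> at the point \<open>x\<close>.\<close>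

definition mon_eval :: "real ^ 'n \<Rightarrow> ('n::finite \<Rightarrow>\<^sub>0 nat) \<Rightarrow> real" where
  "mon_eval x m = (\<Prod>i\<in>UNIV. x $ i ^ Poly_Mapping.lookup m i)"

lemma mon_eval_add: "mon_eval x (m + m') = mon_eval x m * mon_eval x m'"
  by (simp add: mon_eval_def lookup_add power_add prod.distrib)

lemma poly_eval_superset:
  assumes "finite K" "Poly_Mapping.keys p \<subseteq> K"
  shows "poly_eval p x = (\<Sum>m\<in>K. Poly_Mapping.lookup p m * mon_eval x m)"
  unfolding poly_eval_def mon_eval_def
  by (rule sum.mono_neutral_left) (use assms in \<open>auto simp: in_keys_iff\<close>)

lemma poly_eval_single: "poly_eval (Poly_Mapping.single m c) x = c * mon_eval x m"
  by (subst poly_eval_superset[of "{m}"]) auto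

lemma poly_eval_add: "poly_eval (p + q) x = poly_eval p x + poly_eval q x"
proof -
  let ?K = "Poly_Mapping.keys p \<union> Poly_Mapping.keys q"
  have "Poly_Mapping.keys (p + q) \<subseteq> ?K" by (rule keys_add)
  then show ?thesis
    by (subst (1 2 3) poly_eval_superset[of ?K])
       (auto simp: lookup_add distrib_right sum.distrib)
qed

lemma poly_eval_mult: "poly_eval (p * q) x = poly_eval p x * poly_eval q x"
proof (induction p rule: rpoly_induct)
  case (monomial m c)
  show ?case
    by (induction q rule: rpoly_induct)
       (auto simp: mult_single poly_eval_single mon_eval_add distrib_left poly_eval_add)
qed (simp add: distrib_right poly_eval_add)

text \<open>An injective assignment of primes to the variables. By unique factorization it turns exponent
  vectors into natural numbers, injectively and with sums going to products. This code serves twice: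
  to separate monomials by evaluation, and as a monomial order.\<close>

definition prime_tag :: "'n::finite \<Rightarrow> nat" where
  "prime_tag = (SOME f. inj f \<and> (\<forall>i. prime (f i)))"

lemma prime_tag: "inj (prime_tag :: 'n::finite \<Rightarrow> nat)" "prime (prime_tag (i::'n))"
proof -
  obtain f :: "'n \<Rightarrow> nat" where f: "inj f"
    using finite_imp_inj_to_nat_seg[of "UNIV :: 'n set"] by auto
  have "inj (enumerate {p::nat. prime p})"
    by (metis primes_infinite strict_mono_enumerate strict_mono_imp_inj_on)
  moreover have "prime (enumerate {p::nat. prime p} k)" for k
    using enumerate_in_set[OF primes_infinite, of k] by simp
  ultimately have "inj (enumerate {p::nat. prime p} \<circ> f) \<and> (\<forall>i. prime ((enumerate {p::nat. prime p} \<circ> f) i))"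
    using f by (auto intro: inj_compose)
  then have "inj (prime_tag :: 'n \<Rightarrow> nat) \<and> (\<forall>i::'n. prime (prime_tag i))"
    unfolding prime_tag_def
    by (rule someI[where P = "\<lambda>f. inj f \<and> (\<forall>i. prime (f i))"])
  then show "inj (prime_tag :: 'n \<Rightarrow> nat)" "prime (prime_tag (i::'n))" by auto
qed

text \<open>The Goedel number \<open>\<Prod>\<^sub>i p\<^sub>i ^ m\<^sub>i\<close> of the exponent vector \<open>m\<close>.\<close>

definition mon_code :: "('n::finite \<Rightarrow>\<^sub>0 nat) \<Rightarrow> nat" where
  "mon_code m = (\<Prod>i\<in>UNIV. prime_tag i ^ Poly_Mapping.lookup m i)"

lemma mon_code_add: "mon_code (m + m') = mon_code m * mon_code m'"
  by (simp add: mon_code_def lookup_add power_add prod.distrib)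

lemma mon_code_pos: "0 < mon_code m"
  unfolding mon_code_def using prime_tag(2) by (auto intro!: prod_pos prime_gt_0_nat)

lemma inj_mon_code: "inj (mon_code :: ('n::finite \<Rightarrow>\<^sub>0 nat) \<Rightarrow> nat)"
proof (rule injI, rule poly_mapping_eqI)
  fix m m' :: "'n \<Rightarrow>\<^sub>0 nat" and i assume eq: "mon_code m = mon_code m'"
  have "multiplicity (prime_tag i) (mon_code u) = Poly_Mapping.lookup u i" for u :: "'n \<Rightarrow>\<^sub>0 nat"
  proof -
    have "mon_code u = (\<Prod>p\<in>range (prime_tag :: 'n \<Rightarrow> nat). p ^ Poly_Mapping.lookup u (inv prime_tag p))"
      unfolding mon_code_def
      by (subst prod.reindex[OF prime_tag(1)]) (simp add: inv_f_f prime_tag(1))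
    also have "multiplicity (prime_tag i) \<dots> = Poly_Mapping.lookup u i"
      by (subst multiplicity_prod_prime_powers) (auto simp: prime_tag inv_f_f)
    finally show ?thesis .
  qed
  then show "Poly_Mapping.lookup m i = Poly_Mapping.lookup m' i" using eq by metis
qed

text \<open>At the point with coordinates \<open>p\<^sub>i ^ s\<close> the monomial \<open>m\<close> takes the value \<open>mon_code m ^ s\<close>.
  If \<open>p\<close> vanishes at all of these points, then the coefficients are orthogonal to every univariate
  polynomial in the pairwise distinct codes, in particular to one that isolates a single code.\<close>

lemma poly_eval_eq_zero_imp_zero:
  fixes p :: "'n::finite rpoly"
  assumes "\<And>x. poly_eval p x = 0"
  shows "p = 0"
proof (rule ccontr)
  assume "p \<noteq> 0"
  let ?K = "Poly_Mapping.keys p" and ?c = "Poly_Mapping.lookup p"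
  obtain m0 where m0: "m0 \<in> ?K" using \<open>p \<noteq> 0\<close> by (metis ex_in_conv keys_eq_empty)
  have pow: "(\<Sum>m\<in>?K. ?c m * real (mon_code m) ^ s) = 0" for s
  proof -
    have "mon_eval (\<chi> i. real (prime_tag i) ^ s) m = real (mon_code m) ^ s" for m :: "'n \<Rightarrow>\<^sub>0 nat"
      by (simp add: mon_eval_def mon_code_def prod_power_distrib flip: power_mult)
         (simp add: mult.commute)
    then show ?thesis using assms[of "\<chi> i. real (prime_tag i) ^ s"]
      by (simp add: poly_eval_superset[of ?K])
  qed
  have all: "(\<Sum>m\<in>?K. ?c m * poly f (real (mon_code m))) = 0" for f
  proof -
    have "(\<Sum>m\<in>?K. ?c m * poly f (real (mon_code m)))
        = (\<Sum>m\<in>?K. \<Sum>s\<le>degree f. coeff f s * (?c m * real (mon_code m) ^ s))"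
      by (simp add: poly_altdef sum_distrib_left mult_ac)
    also have "\<dots> = (\<Sum>s\<le>degree f. coeff f s * (\<Sum>m\<in>?K. ?c m * real (mon_code m) ^ s))"
      by (subst sum.swap) (simp add: sum_distrib_left)
    finally show ?thesis by (simp add: pow)
  qed
  define f where "f = (\<Prod>m\<in>?K - {m0}. [:- real (mon_code m), 1:])"
  have "poly f (real (mon_code m)) = 0" if "m \<in> ?K - {m0}" for m
    using that by (auto simp: f_def poly_prod)
  then have "(\<Sum>m\<in>?K. ?c m * poly f (real (mon_code m))) = ?c m0 * poly f (real (mon_code m0))"
    using m0 by (subst sum.remove[of _ m0]) auto
  moreover have "poly f (real (mon_code m0)) \<noteq> 0"
    using inj_mon_code by (auto simp: f_def poly_prod inj_def)
  ultimately show False using all[of f] m0 by (auto simp: in_keys_iff)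
qed

section \<open>Affine forms and ideals of hyperplanes\<close>

text \<open>The polynomial \<open>b + a\<^sub>1 x\<^sub>1 + \<dots> + a\<^sub>n x\<^sub>n\<close> of a vector \<open>(b, a)\<close>; its homogenization is the linear
  form on \<open>real \<times> (real ^ 'n)\<close> with normal vector \<open>(b, a)\<close>.\<close>

definition affine_form :: "real \<times> (real ^ 'n::finite) \<Rightarrow> 'n rpoly" where
  "affine_form v = Poly_Mapping.single 0 (fst v) + (\<Sum>i\<in>UNIV. Poly_Mapping.single (Poly_Mapping.single i 1) (snd v $ i))"

lemma affine_form_0 [simp]: "affine_form 0 = 0"
  by (simp add: affine_form_def)

lemma affine_form_add: "affine_form (u + v) = affine_form u + affine_form v"
  by (simp add: affine_form_def single_add sum.distrib)

lemma affine_form_scale: "affine_form (c *\<^sub>R v) = Poly_Mapping.single 0 c * affine_form v"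
  by (simp add: affine_form_def mult_single distrib_left sum_distrib_left)

lemma poly_eval_affine_form: "poly_eval (affine_form v) x = v \<bullet> (1, x)"
proof -
  have 1: "mon_eval x 0 = 1" by (simp add: mon_eval_def)
  have 2: "mon_eval x (Poly_Mapping.single i 1) = x $ i" for i
    by (simp add: mon_eval_def lookup_single when_def if_distrib prod.delta cong: if_cong)
  have 3: "poly_eval (\<Sum>i\<in>I. f i) x = (\<Sum>i\<in>I. poly_eval (f i) x)" if "finite I" for I :: "'a set" and f
    using that by (induction I) (auto simp: poly_eval_add, simp add: poly_eval_def)
  show ?thesis
    using 1 2 by (simp add: affine_form_def poly_eval_add 3 poly_eval_single inner_prod_def inner_vec_def)
qed

lemma keys_affine_form_mon_degree:
  "m \<in> Poly_Mapping.keys (affine_form v) \<Longrightarrow> mon_degree m \<le> 1"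
  "fst v = 0 \<Longrightarrow> m \<in> Poly_Mapping.keys (affine_form v) \<Longrightarrow> mon_degree m = 1"
proof -
  have sub: "Poly_Mapping.keys (affine_form v) \<subseteq> (if fst v = 0 then {} else {0}) \<union> range (\<lambda>i. Poly_Mapping.single i 1)"
    unfolding affine_form_def
    by (rule subset_trans[OF keys_add], rule Un_mono)
       (auto split: if_splits dest!: subsetD[OF keys_sum])
  show "m \<in> Poly_Mapping.keys (affine_form v) \<Longrightarrow> mon_degree m \<le> 1"
    "fst v = 0 \<Longrightarrow> m \<in> Poly_Mapping.keys (affine_form v) \<Longrightarrow> mon_degree m = 1"
    using subsetD[OF sub, of m] by (auto split: if_splits)
qed

lemma affine_form_axis: "affine_form (0, axis i 1) = Poly_Mapping.single (Poly_Mapping.single i 1) 1"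
proof -
  have "(\<Sum>j\<in>UNIV. Poly_Mapping.single (Poly_Mapping.single j 1) (axis i (1::real) $ j))
      = (\<Sum>j\<in>UNIV. if j = i then Poly_Mapping.single (Poly_Mapping.single i (1::nat)) (1::real) else 0)"
    by (intro sum.cong) (auto simp: axis_def)
  then show ?thesis by (simp add: affine_form_def)
qed

lemma affine_form_one: "affine_form (1, 0) = 1"
  by (simp add: affine_form_def)

lemma keys_affine_form_mult:
  assumes "\<And>u m. u \<in> Poly_Mapping.keys (affine_form v) \<Longrightarrow> m \<in> A \<Longrightarrow> u + m \<in> A'"
    and "Poly_Mapping.keys p \<subseteq> A"
  shows "Poly_Mapping.keys (affine_form v * p) \<subseteq> A'"
proof
  fix m assume "m \<in> Poly_Mapping.keys (affine_form v * p)"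
  then obtain a b where "m = a + b" "a \<in> Poly_Mapping.keys (affine_form v)" "b \<in> Poly_Mapping.keys p"
    using subsetD[OF keys_mult] by blast
  then show "m \<in> A'" using assms by auto
qed

lemma mon_degree_le_1:
  assumes "mon_degree (m :: 'n::finite \<Rightarrow>\<^sub>0 nat) \<le> 1"
  shows "m = 0 \<or> (\<exists>i. m = Poly_Mapping.single i 1)"
proof (cases "m = 0")
  case False
  then obtain i where i: "Poly_Mapping.lookup m i \<noteq> 0" by (metis lookup_zero poly_mapping_eqI)
  have "mon_degree m = Poly_Mapping.lookup m i + (\<Sum>j\<in>UNIV-{i}. Poly_Mapping.lookup m j)"
    by (simp add: mon_degree_def sum.remove)
  then have "Poly_Mapping.lookup m i = 1" "(\<Sum>j\<in>UNIV-{i}. Poly_Mapping.lookup m j) = 0"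
    using assms i by linarith+
  then have "m = Poly_Mapping.single i 1"
    by (intro poly_mapping_eqI) (auto simp: lookup_single when_def)
  then show ?thesis by blast
qed simp

lemma lookup_affine_form:
  fixes v :: "real \<times> (real ^ 'n::finite)"
  shows "Poly_Mapping.lookup (affine_form v) 0 = fst v"
  "Poly_Mapping.lookup (affine_form v) (Poly_Mapping.single i 1) = snd v $ i"
proof -
  have ne: "Poly_Mapping.single j (1::nat) \<noteq> 0" for j :: 'n
    by (metis lookup_single_eq lookup_zero zero_neq_one)
  have eq: "Poly_Mapping.single j (1::nat) = Poly_Mapping.single i 1 \<longleftrightarrow> j = i" for i j :: 'n
    by (metis lookup_single_eq lookup_single_not_eq zero_neq_one)
  show "Poly_Mapping.lookup (affine_form v) 0 = fst v"
    unfolding affine_form_def lookup_add lookup_sum lookup_single when_def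
    using ne by (simp del: One_nat_def)
  have "Poly_Mapping.lookup (affine_form v) (Poly_Mapping.single i 1) = (\<Sum>j\<in>UNIV. if j = i then snd v $ j else 0)"
    unfolding affine_form_def lookup_add lookup_sum lookup_single when_def eq
    using ne[of i] by (simp del: One_nat_def)
  then show "Poly_Mapping.lookup (affine_form v) (Poly_Mapping.single i 1) = snd v $ i" by simp
qed

lemma total_degree_le_1_affine_form:
  assumes "total_degree (l :: 'n::finite rpoly) \<le> 1"
  shows "\<exists>v. l = affine_form v"
proof -
  define v where "v = (Poly_Mapping.lookup l 0, \<chi> i. Poly_Mapping.lookup l (Poly_Mapping.single i 1))"
  have "Poly_Mapping.lookup l m = Poly_Mapping.lookup (affine_form v) m" for m
  proof (cases "mon_degree m \<le> 1")
    case True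
    then show ?thesis using mon_degree_le_1[OF True] by (auto simp: lookup_affine_form v_def simp del: One_nat_def)
  next
    case False
    then have "m \<notin> Poly_Mapping.keys l" "m \<notin> Poly_Mapping.keys (affine_form v)"
      using assms keys_affine_form_mon_degree(1)[of m v] by (auto simp: total_degree_le_iff)
    then show ?thesis by (simp add: in_keys_iff)
  qed
  then show ?thesis by (metis poly_mapping_eqI)
qed

text \<open>If the coefficient of \<open>x\<^sub>i\<close> in an affine form is nonzero, then \<open>x\<^sub>i\<close> can be eliminated modulo the form.\<close>

lemma eliminate_variable:
  fixes v :: "real \<times> (real ^ 'n::finite)"
  assumes i: "snd v $ i \<noteq> 0"
  shows "\<exists>q p'. p = q * affine_form v + p' \<and> (\<forall>m\<in>Poly_Mapping.keys p'. Poly_Mapping.lookup m i = 0)"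
proof -
  define a where "a = snd v $ i"
  define rest :: "'n rpoly" where "rest = Poly_Mapping.single 0 (fst v) + (\<Sum>j\<in>UNIV-{i}. Poly_Mapping.single (Poly_Mapping.single j 1) (snd v $ j))"
  have a: "a \<noteq> 0" using i by (simp add: a_def)
  define X where "X = Poly_Mapping.single (Poly_Mapping.single i (1::nat)) (1::real)"
  have "(\<Sum>j\<in>UNIV. Poly_Mapping.single (Poly_Mapping.single j (1::nat)) (snd v $ j))
      = Poly_Mapping.single 0 a * X + (\<Sum>j\<in>UNIV-{i}. Poly_Mapping.single (Poly_Mapping.single j 1) (snd v $ j))"
    by (subst sum.remove[of UNIV i]) (auto simp: X_def a_def mult_single)
  then have l: "affine_form v = rest + Poly_Mapping.single 0 a * X"
    unfolding affine_form_def rest_def by (simp only: add.assoc add.commute add.left_commute)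
  have "Poly_Mapping.single 0 (1/a) * (Poly_Mapping.single 0 a * X) = X"
    unfolding mult.assoc[symmetric] mult_single using a by simp
  then have X: "X = Poly_Mapping.single 0 (1/a) * affine_form v - Poly_Mapping.single 0 (1/a) * rest"
    unfolding l distrib_left by simp
  let ?free = "\<lambda>p'. \<forall>m\<in>Poly_Mapping.keys p'. Poly_Mapping.lookup m i = 0"
  have free_add: "?free (p + q)" if "?free p" "?free q" for p q :: "'n rpoly"
    using that keys_add[of p q] by blast
  have free_mult: "?free (p * q)" if "?free p" "?free q" for p q :: "'n rpoly"
  proof
    fix m assume "m \<in> Poly_Mapping.keys (p * q)"
    then obtain a b where "m = a + b" "a \<in> Poly_Mapping.keys p" "b \<in> Poly_Mapping.keys q"
      using keys_mult[of p q] by blast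
    then show "Poly_Mapping.lookup m i = 0" using that by (simp add: lookup_add)
  qed
  have free_rest: "?free rest"
  proof -
    have "?free (\<Sum>j\<in>UNIV-{i}. Poly_Mapping.single (Poly_Mapping.single j (1::nat)) (snd v $ j))"
    proof
      fix m assume "m \<in> Poly_Mapping.keys (\<Sum>j\<in>UNIV-{i}. Poly_Mapping.single (Poly_Mapping.single j (1::nat)) (snd v $ j))"
      from subsetD[OF keys_sum this] obtain j where j: "j \<noteq> i" "m \<in> Poly_Mapping.keys (Poly_Mapping.single (Poly_Mapping.single j (1::nat)) (snd v $ j))"
        by blast
      then have "m = Poly_Mapping.single j 1" by (simp split: if_splits)
      then show "Poly_Mapping.lookup m i = 0" using j(1) by (simp add: lookup_single_not_eq)
    qed
    then show ?thesis unfolding rest_def by (intro free_add) simp_all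
  qed
  have free_const: "?free (Poly_Mapping.single 0 c)" for c by auto
  let ?red = "\<lambda>p. \<exists>q p'. p = q * affine_form v + p' \<and> ?free p'"
  have mono: "?red (Poly_Mapping.single m c)" for m c
  proof (induction "Poly_Mapping.lookup m i" arbitrary: m)
    case 0
    then show ?case by (intro exI[of _ 0] exI[of _ "Poly_Mapping.single m c"]) auto
  next
    case (Suc k)
    define m1 where "m1 = m - Poly_Mapping.single i 1"
    have m: "m = Poly_Mapping.single i 1 + m1"
      using Suc.hyps(2) by (intro poly_mapping_eqI) (auto simp: m1_def lookup_add lookup_minus lookup_single when_def)
    have "k = Poly_Mapping.lookup m1 i" using Suc.hyps(2) by (simp add: m1_def lookup_minus)
    then obtain q1 p1 where qp: "Poly_Mapping.single m1 c = q1 * affine_form v + p1" "?free p1"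
      using Suc.hyps(1) by blast
    have "Poly_Mapping.single m c = X * (q1 * affine_form v + p1)"
      unfolding qp(1)[symmetric] X_def mult_single by (subst m) simp
    also have "\<dots> = (X * q1) * affine_form v + X * p1" by (simp add: algebra_simps)
    also have "X * p1 = (Poly_Mapping.single 0 (1/a) * p1) * affine_form v + Poly_Mapping.single 0 (-1/a) * rest * p1"
    proof -
      have "Poly_Mapping.single 0 (-1/a) = - Poly_Mapping.single (0 :: 'n \<Rightarrow>\<^sub>0 nat) (1/a)"
        by (simp add: single_uminus)
      then show ?thesis by (subst X) (simp add: left_diff_distrib right_diff_distrib mult_ac)
    qed
    finally have "Poly_Mapping.single m c = (X * q1 + Poly_Mapping.single 0 (1/a) * p1) * affine_form v + Poly_Mapping.single 0 (-1/a) * rest * p1"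
      by (simp add: algebra_simps)
    moreover have "?free (Poly_Mapping.single 0 (-1/a) * rest * p1)"
      by (intro free_mult free_const free_rest qp(2))
    ultimately show ?case by blast
  qed
  show "?red p"
  proof (induction p rule: rpoly_induct)
    case (monomial m c) show ?case by (rule mono)
  next
    case (add p q)
    then obtain q1 p1 q2 p2 where pq: "p = q1 * affine_form v + p1" "q = q2 * affine_form v + p2"
      and free: "?free p1" "?free p2"
      by blast
    have "p + q = (q1 + q2) * affine_form v + (p1 + p2)" by (simp add: pq distrib_right)
    with free_add[OF free] show ?case by blast
  qed
qed

text \<open>After elimination of \<open>x\<^sub>i\<close> modulo the form, the remainder does not depend on \<open>x\<^sub>i\<close>, so vanishing
  on the hyperplane makes it vanish everywhere.\<close>

lemma vanishing_ideal_hyperplane: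
  fixes v :: "real \<times> (real ^ 'n::finite)"
  assumes "snd v \<noteq> 0"
  shows "vanishing_ideal {x. v \<bullet> (1, x) = 0} = {p * affine_form v | p. True}"
proof
  show "{p * affine_form v | p. True} \<subseteq> vanishing_ideal {x. v \<bullet> (1, x) = 0}"
    by (auto simp: vanishing_ideal_def poly_eval_mult poly_eval_affine_form)
  show "vanishing_ideal {x. v \<bullet> (1, x) = 0} \<subseteq> {p * affine_form v | p. True}"
  proof
    fix p assume "p \<in> vanishing_ideal {x. v \<bullet> (1, x) = 0}"
    then have van: "v \<bullet> (1, x) = 0 \<Longrightarrow> poly_eval p x = 0" for x by (auto simp: vanishing_ideal_def)
    obtain i where i: "snd v $ i \<noteq> 0" using assms by (metis vec_eq_iff zero_index)
    obtain q p' where p: "p = q * affine_form v + p'"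
      and free: "\<forall>m\<in>Poly_Mapping.keys p'. Poly_Mapping.lookup m i = 0"
      using eliminate_variable[OF i] by blast
    have "poly_eval p' x = 0" for x
    proof -
      \<comment> \<open>Changing the coordinate \<open>x\<^sub>i\<close> moves \<open>x\<close> onto the hyperplane without changing \<open>p' x\<close>.\<close>
      define t where "t = - (v \<bullet> (1, x)) / snd v $ i"
      define y where "y = x + axis i t"
      have "v \<bullet> (1, y) = v \<bullet> (1, x) + snd v $ i * t"
        by (simp add: y_def inner_prod_def inner_add_right inner_axis)
      then have "v \<bullet> (1, y) = 0" using i by (simp add: t_def)
      then have "poly_eval p y = 0" "poly_eval (affine_form v) y = 0"
        by (simp_all add: van poly_eval_affine_form)
      then have "poly_eval p' y = 0" by (simp add: p poly_eval_add poly_eval_mult)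
      moreover have "poly_eval p' y = poly_eval p' x"
        unfolding poly_eval_def
        by (intro sum.cong refl arg_cong2[where f = "(*)"] prod.cong) (use free in \<open>auto simp: y_def axis_def\<close>)
      ultimately show ?thesis by simp
    qed
    then have "p' = 0" by (rule poly_eval_eq_zero_imp_zero)
    then show "p \<in> {p * affine_form v | p. True}" using p by auto
  qed
qed

section \<open>Counting monomials in upward closed sets\<close>

lemma nat_nondecreasing_subsequence:
  fixes s :: "nat \<Rightarrow> nat"
  shows "\<exists>f :: nat \<Rightarrow> nat. strict_mono f \<and> incseq (\<lambda>n. s (f n))"
proof -
  obtain f where f: "strict_mono f" "monoseq (\<lambda>n. s (f n))" using seq_monosub by blast
  show ?thesis
  proof (cases "incseq (\<lambda>n. s (f n))")
    case True
    then show ?thesis using f by blast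
  next
    case False
    then have dec: "decseq (\<lambda>n. s (f n))" using f(2) by (simp add: monoseq_iff)
    define v where "v = (LEAST v. v \<in> range (\<lambda>n. s (f n)))"
    have "v \<in> range (\<lambda>n. s (f n))" unfolding v_def by (rule LeastI) (rule rangeI)
    then obtain N where N: "v = s (f N)" by blast
    have "s (f (n + N)) = v" for n
    proof (rule antisym)
      show "s (f (n + N)) \<le> v" unfolding N by (rule decseqD[OF dec]) simp
      show "v \<le> s (f (n + N))" unfolding v_def by (rule Least_le) (rule rangeI)
    qed
    moreover have "strict_mono (\<lambda>n. f (n + N))"
      using f(1) by (simp add: strict_mono_def)
    ultimately show ?thesis by (intro exI[of _ "\<lambda>n. f (n + N)"]) (simp add: incseq_def)
  qed
qed

lemma nondecreasing_subsequence_family: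
  fixes s :: "nat \<Rightarrow> 'i \<Rightarrow> nat"
  assumes "finite I"
  shows "\<exists>f :: nat \<Rightarrow> nat. strict_mono f \<and> (\<forall>i\<in>I. incseq (\<lambda>n. s (f n) i))"
  using assms
proof (induction I)
  case empty
  show ?case by (intro exI[of _ "\<lambda>n. n"]) (simp add: strict_mono_def)
next
  case (insert i I)
  then obtain f where f: "strict_mono f" "\<forall>i\<in>I. incseq (\<lambda>n. s (f n) i)" by blast
  obtain g where g: "strict_mono g" "incseq (\<lambda>n. s (f (g n)) i)"
    using nat_nondecreasing_subsequence[of "\<lambda>n. s (f n) i"] by blast
  have "strict_mono (f \<circ> g)" using f(1) g(1) by (rule strict_mono_o)
  moreover have "incseq (\<lambda>n. s (f (g n)) j)" if "j \<in> I" for j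
    using f(2) that strict_mono_mono[OF g(1)] by (auto simp: incseq_def mono_def)
  ultimately show ?case using g(2) by (intro exI[of _ "f \<circ> g"]) (auto simp: o_def)
qed

text \<open>The exponent vectors of the multiples of the monomial \<open>m\<close>.\<close>

definition multiples :: "('n \<Rightarrow>\<^sub>0 nat) \<Rightarrow> ('n \<Rightarrow>\<^sub>0 nat) set" where
  "multiples m = range (\<lambda>u. m + u)"

lemma multiples_iff: "m' \<in> multiples m \<longleftrightarrow> (\<forall>i. Poly_Mapping.lookup m i \<le> Poly_Mapping.lookup m' i)"
proof
  assume "\<forall>i. Poly_Mapping.lookup m i \<le> Poly_Mapping.lookup m' i"
  then have "m' = m + (m' - m)" by (intro poly_mapping_eqI) (simp add: lookup_add lookup_minus)
  then show "m' \<in> multiples m" unfolding multiples_def by (rule range_eqI)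
qed (auto simp: multiples_def lookup_add)

text \<open>Dickson's lemma: the minimal elements of \<open>A\<close> form a finite set, since an infinite one would
  contain a sequence that increases in all coordinates.\<close>

lemma dickson:
  fixes A :: "('n::finite \<Rightarrow>\<^sub>0 nat) set"
  shows "\<exists>B. finite B \<and> B \<subseteq> A \<and> A \<subseteq> (\<Union>b\<in>B. multiples b)"
proof -
  define B where "B = {m\<in>A. \<forall>m'\<in>A. m \<in> multiples m' \<longrightarrow> m' = m}"
  have "finite B"
  proof (rule ccontr)
    assume "infinite B"
    then obtain s :: "nat \<Rightarrow> 'n \<Rightarrow>\<^sub>0 nat" where s: "inj s" "range s \<subseteq> B"
      using infinite_countable_subset by blast
    obtain f where f: "strict_mono f" "\<forall>i. incseq (\<lambda>n. Poly_Mapping.lookup (s (f n)) i)"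
      using nondecreasing_subsequence_family[of "UNIV :: 'n set" "\<lambda>n. Poly_Mapping.lookup (s n)"] by auto
    have "s (f 1) \<in> multiples (s (f 0))"
      using f(2) by (auto simp: multiples_iff incseq_def)
    moreover have "s (f 0) \<in> A" "s (f 1) \<in> B" using s(2) by (auto simp: B_def)
    ultimately have "s (f 0) = s (f 1)" by (auto simp: B_def)
    then have "f 0 = f 1" using s(1) by (simp add: inj_eq)
    then show False using f(1) by (metis strict_mono_eq zero_neq_one)
  qed
  moreover have "\<exists>b\<in>B. m \<in> multiples b" if "m \<in> A" for m
    using that
  proof (induction "mon_degree m" arbitrary: m rule: less_induct)
    case less
    show ?case
    proof (cases "m \<in> B")
      case True
      then show ?thesis by (auto simp: multiples_iff)
    next
      case False
      then obtain m' where m': "m' \<in> A" "m \<in> multiples m'" "m' \<noteq> m" using less.prems by (auto simp: B_def)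
      then obtain u where u: "m = m' + u" by (auto simp: multiples_def)
      with m'(3) have "u \<noteq> 0" by auto
      then have "mon_degree u > 0"
        by (auto simp: mon_degree_def poly_mapping_eq_iff fun_eq_iff intro: ccontr)
      then have "mon_degree m' < mon_degree m" by (simp add: u mon_degree_add)
      then obtain b where "b \<in> B" "m' \<in> multiples b" using less.hyps m'(1) by blast
      then show ?thesis using m'(2) by (auto simp: multiples_iff intro: order_trans)
    qed
  qed
  ultimately show ?thesis by (intro exI[of _ B]) (auto simp: B_def)
qed

text \<open>Agreement with a polynomial at all large arguments, as for Hilbert functions.\<close>

definition eventually_polynomial :: "(nat \<Rightarrow> nat) \<Rightarrow> bool" where
  "eventually_polynomial f \<longleftrightarrow> (\<exists>h :: real poly. \<forall>\<^sub>F d in sequentially. poly h (real d) = real (f d))"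

lemma eventually_polynomial_sum:
  assumes "finite I" "\<And>i. i \<in> I \<Longrightarrow> eventually_polynomial (f i)"
  shows "eventually_polynomial (\<lambda>d. \<Sum>i\<in>I. f i d)"
proof -
  obtain h where h: "\<And>i. i \<in> I \<Longrightarrow> \<forall>\<^sub>F d in sequentially. poly (h i) (real d) = real (f i d)"
    using assms(2) unfolding eventually_polynomial_def by metis
  have "\<forall>\<^sub>F d in sequentially. \<forall>i\<in>I. poly (h i) (real d) = real (f i d)"
    using assms(1) h by (simp add: eventually_ball_finite)
  then have "\<forall>\<^sub>F d in sequentially. poly (\<Sum>i\<in>I. h i) (real d) = real (\<Sum>i\<in>I. f i d)"
    by eventually_elim (simp add: poly_sum)
  then show ?thesis unfolding eventually_polynomial_def by blast
qed

text \<open>The number of exponent vectors of total degree \<open>d\<close> in \<open>U\<close>.\<close>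

definition count_degree :: "('n::finite \<Rightarrow>\<^sub>0 nat) set \<Rightarrow> nat \<Rightarrow> nat" where
  "count_degree U d = card {m\<in>U. mon_degree m = d}"

lemma lookup_Abs_finite [simp]:
  fixes f :: "'n::finite \<Rightarrow> nat"
  shows "Poly_Mapping.lookup (Abs_poly_mapping f) = f"
  by (rule lookup_Abs_poly_mapping) simp

lemma finite_mon_degree: "finite {m :: 'n::finite \<Rightarrow>\<^sub>0 nat. mon_degree m \<le> d}"
proof (rule inj_on_finite)
  show "inj_on Poly_Mapping.lookup {m :: 'n \<Rightarrow>\<^sub>0 nat. mon_degree m \<le> d}"
    by (auto intro: inj_onI poly_mapping_eqI)
  have "Poly_Mapping.lookup m i \<le> d" if "mon_degree m \<le> d" for m :: "'n \<Rightarrow>\<^sub>0 nat" and i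
    using that member_le_sum[of i UNIV "Poly_Mapping.lookup m"] by (simp add: mon_degree_def)
  then show "Poly_Mapping.lookup ` {m :: 'n \<Rightarrow>\<^sub>0 nat. mon_degree m \<le> d} \<subseteq> PiE UNIV (\<lambda>_. {..d})"
    by auto
  show "finite (PiE (UNIV :: 'n set) (\<lambda>_. {..d}))" by (rule finite_PiE) auto
qed

lemma finite_mon_degree_eq: "finite {m :: 'n::finite \<Rightarrow>\<^sub>0 nat. m \<in> U \<and> mon_degree m = d}"
  by (rule finite_subset[OF _ finite_mon_degree[of d]]) auto

lemma binomial_polynomial: "\<exists>h :: real poly. \<forall>d. poly h (real d) = real ((d + k) choose k)"
proof -
  define h :: "real poly" where "h = smult (1 / fact k) (\<Prod>i=0..<k. [:real k - real i, 1:])"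
  have "poly h (real d) = real ((d + k) choose k)" for d
    by (simp add: h_def poly_prod binomial_gbinomial gbinomial_prod_rev algebra_simps)
  then show ?thesis by blast
qed

lemma card_mon_degree_eq:
  "card {m :: 'n::finite \<Rightarrow>\<^sub>0 nat. mon_degree m = d} = (d + (CARD('n) - 1)) choose (CARD('n) - 1)"
proof -
  let ?N = "CARD('n)"
  obtain e where e: "bij_betw e {0..<?N} (UNIV :: 'n set)"
    using ex_bij_betw_nat_finite[of "UNIV :: 'n set"] by auto
  define e' where "e' = the_inv_into {0..<?N} e"
  have e': "e' i < ?N" "e (e' i) = i" for i
    using e f_the_inv_into_f_bij_betw[OF e] the_inv_into_into[of e "{0..<?N}" i "{0..<?N}"]
    by (auto simp: e'_def bij_betw_def)
  have ee': "k < ?N \<Longrightarrow> e' (e k) = k" for k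
    using e by (auto simp: e'_def bij_betw_def the_inv_into_f_f)
  let ?L = "{l :: nat list. length l = ?N \<and> sum_list l = d}"
  have "bij_betw (\<lambda>m. map (\<lambda>k. Poly_Mapping.lookup m (e k)) [0..<?N]) {m :: 'n \<Rightarrow>\<^sub>0 nat. mon_degree m = d} ?L"
  proof (rule bij_betw_byWitness[where f' = "\<lambda>l. Abs_poly_mapping (\<lambda>i. l ! e' i)"])
    show "\<forall>m\<in>{m :: 'n \<Rightarrow>\<^sub>0 nat. mon_degree m = d}. Abs_poly_mapping (\<lambda>i. map (\<lambda>k. Poly_Mapping.lookup m (e k)) [0..<?N] ! e' i) = m"
      by (auto intro!: poly_mapping_eqI simp: e')
    show "\<forall>l\<in>?L. map (\<lambda>k. Poly_Mapping.lookup (Abs_poly_mapping (\<lambda>i. l ! e' i)) (e k)) [0..<?N] = l"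
      by (auto intro!: nth_equalityI simp: ee')
    have "mon_degree m = sum_list (map (\<lambda>k. Poly_Mapping.lookup m (e k)) [0..<?N])" for m :: "'n \<Rightarrow>\<^sub>0 nat"
      by (simp add: mon_degree_def sum_list_sum_nth sum.reindex_bij_betw[OF e, symmetric])
    then show "(\<lambda>m. map (\<lambda>k. Poly_Mapping.lookup m (e k)) [0..<?N]) ` {m :: 'n \<Rightarrow>\<^sub>0 nat. mon_degree m = d} \<subseteq> ?L"
      by auto
    show "(\<lambda>l. Abs_poly_mapping (\<lambda>i. l ! e' i)) ` ?L \<subseteq> {m :: 'n \<Rightarrow>\<^sub>0 nat. mon_degree m = d}"
    proof clarify
      fix l :: "nat list" assume l: "length l = ?N" "d = sum_list l"
      have "mon_degree (Abs_poly_mapping (\<lambda>i. l ! e' i)) = (\<Sum>k\<in>{0..<?N}. l ! e' (e k))"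
        by (simp add: mon_degree_def sum.reindex_bij_betw[OF e, symmetric])
      also have "\<dots> = (\<Sum>k\<in>{0..<?N}. l ! k)" by (rule sum.cong) (simp_all add: ee')
      also have "\<dots> = sum_list l" by (simp add: sum_list_sum_nth l)
      finally show "mon_degree (Abs_poly_mapping (\<lambda>i. l ! e' i)) = sum_list l" .
    qed
  qed
  then have "card {m :: 'n \<Rightarrow>\<^sub>0 nat. mon_degree m = d} = card ?L" by (rule bij_betw_same_card)
  also have "\<dots> = (d + ?N - 1) choose d" by (rule card_length_sum_list)
  also have "\<dots> = (d + (?N - 1)) choose (?N - 1)"
    using binomial_symmetric[of d "d + (?N - 1)"] zero_less_card_finite[where 'a = 'n]
    by (cases "CARD('n)") auto
  finally show ?thesis .
qed

lemma eventually_polynomial_count_multiples: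
  "eventually_polynomial (count_degree (multiples (m :: 'n::finite \<Rightarrow>\<^sub>0 nat)))"
proof -
  obtain h :: "real poly" where h: "\<And>d. poly h (real d) = real ((d + (CARD('n) - 1)) choose (CARD('n) - 1))"
    using binomial_polynomial[of "CARD('n) - 1"] by blast
  let ?e = "mon_degree m"
  have "count_degree (multiples m) d = (d - ?e + (CARD('n) - 1)) choose (CARD('n) - 1)" if "d \<ge> ?e" for d
  proof -
    have "{m'\<in>multiples m. mon_degree m' = d} = (\<lambda>u. m + u) ` {u. mon_degree u = d - ?e}"
      using that by (fastforce simp: multiples_def mon_degree_add)
    then have "count_degree (multiples m) d = card {u :: 'n \<Rightarrow>\<^sub>0 nat. mon_degree u = d - ?e}"
      by (simp add: count_degree_def card_image)
    then show ?thesis by (simp add: card_mon_degree_eq)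
  qed
  then have "poly (pcompose h [:- real ?e, 1:]) (real d) = real (count_degree (multiples m) d)" if "d \<ge> ?e" for d
    using that h[of "d - ?e"] by (simp add: poly_pcompose of_nat_diff)
  then show ?thesis unfolding eventually_polynomial_def
    by (intro exI[of _ "pcompose h [:- real ?e, 1:]"]) (auto simp: eventually_sequentially)
qed

lemma multiples_Int: "\<exists>w. multiples b \<inter> multiples b' = multiples (w :: 'n::finite \<Rightarrow>\<^sub>0 nat)"
  by (rule exI[of _ "Abs_poly_mapping (\<lambda>i. max (Poly_Mapping.lookup b i) (Poly_Mapping.lookup b' i))"])
     (auto simp: multiples_iff)

lemma count_degree_Un:
  "count_degree (U \<union> V) d + count_degree (U \<inter> V) d = count_degree U d + count_degree V d"
proof -
  have "{m \<in> U \<union> V. mon_degree m = d} = {m \<in> U. mon_degree m = d} \<union> {m \<in> V. mon_degree m = d}"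
    "{m \<in> U \<inter> V. mon_degree m = d} = {m \<in> U. mon_degree m = d} \<inter> {m \<in> V. mon_degree m = d}" by auto
  then show ?thesis
    using card_Un_Int[OF finite_mon_degree_eq[of U d] finite_mon_degree_eq[of V d]]
    by (simp add: count_degree_def)
qed

text \<open>Inclusion and exclusion: the intersection of two sets of multiples is the set of multiples of the
  least common multiple.\<close>

lemma eventually_polynomial_count_Union_multiples:
  fixes B :: "('n::finite \<Rightarrow>\<^sub>0 nat) set"
  assumes "finite B"
  shows "eventually_polynomial (count_degree (\<Union>b\<in>B. multiples b))"
  using assms
proof (induction "card B" arbitrary: B rule: less_induct)
  case less
  show ?case
  proof (cases "B = {}")
    case True
    then show ?thesis unfolding eventually_polynomial_def
      by (intro exI[of _ 0]) (simp add: count_degree_def)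
  next
    case False
    then obtain b B' where B: "B = insert b B'" "b \<notin> B'" by (meson all_not_in_conv mk_disjoint_insert)
    with less.prems have fin: "finite B'" by simp
    have "\<forall>b'. \<exists>v. multiples b \<inter> multiples b' = multiples v" using multiples_Int by blast
    then obtain w where w: "\<And>b'. multiples b \<inter> multiples b' = multiples (w b')"
      by (auto dest!: choice)
    let ?U = "\<Union>b\<in>B'. multiples b" and ?W = "\<Union>v\<in>w ` B'. multiples v"
    have "card B' < card B" "card (w ` B') < card B" using B fin card_image_le[OF fin, of w] by auto
    then obtain h1 h2 :: "real poly"
      where h1: "\<forall>\<^sub>F d in sequentially. poly h1 (real d) = real (count_degree ?U d)"
        and h2: "\<forall>\<^sub>F d in sequentially. poly h2 (real d) = real (count_degree ?W d)"
      using less.hyps[of B'] less.hyps[of "w ` B'"] fin unfolding eventually_polynomial_def by blast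
    obtain h3 :: "real poly"
      where h3: "\<forall>\<^sub>F d in sequentially. poly h3 (real d) = real (count_degree (multiples b) d)"
      using eventually_polynomial_count_multiples[of b] unfolding eventually_polynomial_def by blast
    have W: "?U \<inter> multiples b = ?W" using w by auto
    have U: "(\<Union>b\<in>B. multiples b) = ?U \<union> multiples b" using B by auto
    have "\<forall>\<^sub>F d in sequentially. poly (h1 + h3 - h2) (real d) = real (count_degree (\<Union>b\<in>B. multiples b) d)"
      using h1 h2 h3
    proof eventually_elim
      case (elim d)
      then show ?case using count_degree_Un[of ?U "multiples b" d] unfolding U W by simp
    qed
    then show ?thesis unfolding eventually_polynomial_def by blast
  qed
qed

lemma eventually_polynomial_count_upclosed:
  fixes U :: "('n::finite \<Rightarrow>\<^sub>0 nat) set"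
  assumes "\<And>m u. m \<in> U \<Longrightarrow> m + u \<in> U"
  shows "eventually_polynomial (count_degree U)"
proof -
  obtain B where B: "finite B" "B \<subseteq> U" "U \<subseteq> (\<Union>b\<in>B. multiples b)" using dickson[of U] by (elim exE conjE)
  have "multiples b \<subseteq> U" if "b \<in> B" for b
  proof
    fix m assume "m \<in> multiples b"
    then obtain u where "m = b + u" unfolding multiples_def by (rule rangeE)
    moreover have "b \<in> U" using that B(2) by (rule subsetD[rotated])
    ultimately show "m \<in> U" using assms[of b u] by simp
  qed
  then have "(\<Union>b\<in>B. multiples b) \<subseteq> U" by (rule UN_least)
  with B(3) have "U = (\<Union>b\<in>B. multiples b)" by simp
  then show ?thesis using eventually_polynomial_count_Union_multiples[OF B(1)] by simp
qed

section \<open>Leading positions in tuples of polynomials\<close>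

text \<open>The action of polynomials on tuples.\<close>

definition pmul :: "'n::finite rpoly \<Rightarrow> 'n tuple \<Rightarrow> 'n tuple" where
  "pmul p F = (\<lambda>\<sigma>. p * F \<sigma>)"

lemma pmul_simps:
  "pmul p (F + G) = pmul p F + pmul p G" "pmul (p + q) F = pmul p F + pmul q F"
  "pmul p (pmul q F) = pmul (p * q) F" "pmul 1 F = F" "pmul p 0 = 0" "pmul 0 F = 0"
  by (auto simp: pmul_def fun_eq_iff algebra_simps)

lemma tuple_scale_eq_pmul: "tuple_scale c F = pmul (Poly_Mapping.single 0 c) F"
  by (simp add: tuple_scale_def pmul_def)

lemma pmul_tuple_scale: "pmul p (tuple_scale c F) = tuple_scale c (pmul p F)"
  by (simp add: tuple_scale_eq_pmul pmul_simps mult.commute)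

text \<open>The coefficient of a tuple at a position, that is, at a pair of a facet and an exponent
  vector.\<close>

definition coef :: "'n::finite tuple \<Rightarrow> (real ^ 'n) set \<times> ('n \<Rightarrow>\<^sub>0 nat) \<Rightarrow> real" where
  "coef F a = Poly_Mapping.lookup (F (fst a)) (snd a)"

lemma coef_simps [simp]:
  "coef (F + G) a = coef F a + coef G a" "coef (F - G) a = coef F a - coef G a"
  "coef (tuple_scale c F) a = c * coef F a" "coef 0 a = 0"
  by (auto simp: coef_def lookup_add lookup_minus tuple_scale_def lookup_const_mult)

lemma coef_sum: "coef (\<Sum>i\<in>I. f i) a = (\<Sum>i\<in>I. coef (f i) a)"
  by (induction I rule: infinite_finite_induct)
    (simp_all only: sum.infinite sum.empty sum.insert coef_simps not_False_eq_True)

lemma tuple_eqI: "(\<And>a. coef F a = coef G a) \<Longrightarrow> F = G"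
  by (auto simp: coef_def fun_eq_iff intro: poly_mapping_eqI)

text \<open>The positions of total degree \<open>d\<close> with a nonzero coefficient. For a tuple of degree at most \<open>d\<close>
  this is the support of its part of degree \<open>d\<close>.\<close>

definition degree_support :: "nat \<Rightarrow> 'n::finite tuple \<Rightarrow> ((real ^ 'n) set \<times> ('n \<Rightarrow>\<^sub>0 nat)) set" where
  "degree_support d F = {a. coef F a \<noteq> 0 \<and> mon_degree (snd a) = d}"

lemma degree_support_monomial_mult:
  fixes F :: "'n::finite tuple"
  shows "degree_support (d + mon_degree u) (pmul (Poly_Mapping.single u 1) F) = (\<lambda>(\<sigma>, m). (\<sigma>, m + u)) ` degree_support d F"
proof (rule set_eqI)
  fix a :: "(real ^ 'n) set \<times> ('n \<Rightarrow>\<^sub>0 nat)"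
  obtain \<sigma> m where a: "a = (\<sigma>, m)" by fastforce
  let ?G = "pmul (Poly_Mapping.single u 1) F"
  have shift: "coef ?G (\<sigma>, m' + u) = coef F (\<sigma>, m')" for m'
    using lookup_monomial_mult[of u 1 "F \<sigma>" m'] by (simp add: coef_def pmul_def add.commute)
  show "a \<in> degree_support (d + mon_degree u) ?G \<longleftrightarrow> a \<in> (\<lambda>(\<sigma>, m). (\<sigma>, m + u)) ` degree_support d F"
  proof
    assume l: "a \<in> degree_support (d + mon_degree u) ?G"
    then have "m \<in> Poly_Mapping.keys (Poly_Mapping.single u 1 * F \<sigma>)"
      by (simp add: degree_support_def coef_def pmul_def a in_keys_iff)
    then obtain m' where m': "m = m' + u" using keys_monomial_mult[of u 1 "F \<sigma>"] by (auto simp: add.commute)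
    then have "(\<sigma>, m') \<in> degree_support d F"
      using l by (simp add: degree_support_def a shift mon_degree_add)
    then show "a \<in> (\<lambda>(\<sigma>, m). (\<sigma>, m + u)) ` degree_support d F" using a m' by force
  next
    assume "a \<in> (\<lambda>(\<sigma>, m). (\<sigma>, m + u)) ` degree_support d F"
    then show "a \<in> degree_support (d + mon_degree u) ?G"
      by (auto simp: degree_support_def shift mon_degree_add a)
  qed
qed

text \<open>Positions can be ordered compatibly with multiplication by monomials:
  they are compared by the code of the exponent vector,
  with ties broken by an enumeration of the facets.\<close>

lemma exists_monomial_key:
  fixes \<Sigma> :: "'a set"
  assumes "finite \<Sigma>"
  shows "\<exists>\<kappa> :: 'a \<times> ('n::finite \<Rightarrow>\<^sub>0 nat) \<Rightarrow> nat. inj_on \<kappa> (\<Sigma> \<times> UNIV) \<and>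
    (\<forall>\<sigma>\<in>\<Sigma>. \<forall>\<sigma>'\<in>\<Sigma>. \<forall>m m' u. \<kappa> (\<sigma>, m) \<le> \<kappa> (\<sigma>', m') \<longrightarrow> \<kappa> (\<sigma>, m + u) \<le> \<kappa> (\<sigma>', m' + u))"
proof -
  obtain idx :: "'a \<Rightarrow> nat" and K where idx: "idx ` \<Sigma> = {i. i < K}" "inj_on idx \<Sigma>"
    using finite_imp_inj_to_nat_seg[OF assms] by auto
  have lex: "x * K + i \<le> y * K + j \<longleftrightarrow> x < y \<or> x = y \<and> i \<le> j" if "i < K" "j < K" for x y i j :: nat
  proof (cases x y rule: linorder_cases)
    case less
    then have "Suc x * K \<le> y * K" by (intro mult_le_mono1) simp
    then show ?thesis using less that by simp
  next
    case greater
    then have "Suc y * K \<le> x * K" by (intro mult_le_mono1) simp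
    then show ?thesis using greater that by simp
  qed simp
  define \<kappa> :: "'a \<times> ('n \<Rightarrow>\<^sub>0 nat) \<Rightarrow> nat" where "\<kappa> a = mon_code (snd a) * K + idx (fst a)" for a
  have le: "\<kappa> (\<sigma>, m) \<le> \<kappa> (\<sigma>', m') \<longleftrightarrow> mon_code m < mon_code m' \<or> mon_code m = mon_code m' \<and> idx \<sigma> \<le> idx \<sigma>'"
    if "\<sigma> \<in> \<Sigma>" "\<sigma>' \<in> \<Sigma>" for \<sigma> \<sigma>' m m'
  proof -
    have "idx \<sigma> < K" "idx \<sigma>' < K" using idx(1) that by auto
    then show ?thesis by (simp add: \<kappa>_def lex)
  qed
  have "inj_on \<kappa> (\<Sigma> \<times> UNIV)"
  proof (rule inj_onI, clarify)
    fix \<sigma> \<sigma>' and m m' :: "'n \<Rightarrow>\<^sub>0 nat"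
    assume \<sigma>: "\<sigma> \<in> \<Sigma>" "\<sigma>' \<in> \<Sigma>" and eq: "\<kappa> (\<sigma>, m) = \<kappa> (\<sigma>', m')"
    have "mon_code m = mon_code m' \<and> idx \<sigma> = idx \<sigma>'"
      using le[OF \<sigma>, of m m'] le[OF \<sigma>(2,1), of m' m] eq by auto
    then show "\<sigma> = \<sigma>' \<and> m = m'"
      using idx(2) \<sigma> inj_mon_code by (auto simp: inj_on_def inj_def)
  qed
  moreover have "\<kappa> (\<sigma>, m + u) \<le> \<kappa> (\<sigma>', m' + u)" if "\<sigma> \<in> \<Sigma>" "\<sigma>' \<in> \<Sigma>" "\<kappa> (\<sigma>, m) \<le> \<kappa> (\<sigma>', m')" for \<sigma> \<sigma>' m m' u
    using that mon_code_pos[of u] by (auto simp: le mon_code_add)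
  ultimately show ?thesis by blast
qed

text \<open>A monomial order on the positions over a finite set of facets, given by an injective key with
  values in the natural numbers.\<close>

locale monomial_key =
  fixes \<Sigma> :: "(real ^ 'n::finite) set set"
    and \<kappa> :: "(real ^ 'n) set \<times> ('n \<Rightarrow>\<^sub>0 nat) \<Rightarrow> nat"
  assumes fin: "finite \<Sigma>"
    and inj: "inj_on \<kappa> (\<Sigma> \<times> UNIV)"
    and shift: "\<lbrakk>\<sigma> \<in> \<Sigma>; \<sigma>' \<in> \<Sigma>; \<kappa> (\<sigma>, m) \<le> \<kappa> (\<sigma>', m')\<rbrakk> \<Longrightarrow> \<kappa> (\<sigma>, m + u) \<le> \<kappa> (\<sigma>', m' + u)"
begin

text \<open>Tuples indexed by \<open>\<Sigma>\<close>, that is, zero at all other sets.\<close>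

definition supported :: "'n tuple \<Rightarrow> bool" where
  "supported F \<longleftrightarrow> (\<forall>\<sigma>. \<sigma> \<notin> \<Sigma> \<longrightarrow> F \<sigma> = 0)"

text \<open>The leading position of the part of degree \<open>d\<close>.\<close>

definition is_lead :: "nat \<Rightarrow> 'n tuple \<Rightarrow> (real ^ 'n) set \<times> ('n \<Rightarrow>\<^sub>0 nat) \<Rightarrow> bool" where
  "is_lead d F a \<longleftrightarrow> a \<in> degree_support d F \<and> (\<forall>b\<in>degree_support d F. \<kappa> b \<le> \<kappa> a)"

lemma degree_support_subset:
  "supported F \<Longrightarrow> degree_support d F \<subseteq> \<Sigma> \<times> {m. mon_degree m = d}"
  by (auto simp: supported_def degree_support_def coef_def)

lemma finite_degree_support: "supported F \<Longrightarrow> finite (degree_support d F)"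
  by (rule finite_subset[OF degree_support_subset])
     (use fin finite_mon_degree_eq[of UNIV d] in auto)

lemma lead_exists:
  assumes "supported F" "degree_support d F \<noteq> {}"
  shows "\<exists>a. is_lead d F a"
proof -
  let ?K = "\<kappa> ` degree_support d F"
  have "finite ?K" "?K \<noteq> {}" using finite_degree_support assms by auto
  then have "Max ?K \<in> ?K" "\<forall>b\<in>degree_support d F. \<kappa> b \<le> Max ?K" by auto
  then obtain a where "a \<in> degree_support d F" "Max ?K = \<kappa> a" by (elim imageE)
  with \<open>\<forall>b\<in>_. _\<close> have "is_lead d F a" by (simp add: is_lead_def)
  then show ?thesis ..
qed

lemma lead_unique:
  assumes "supported F" "is_lead d F a" "is_lead d F b"
  shows "a = b"
proof -
  have "a \<in> \<Sigma> \<times> UNIV" "b \<in> \<Sigma> \<times> UNIV"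
    using assms degree_support_subset[of F d] by (auto simp: is_lead_def)
  moreover have "\<kappa> a = \<kappa> b" using assms by (auto simp: is_lead_def intro: antisym)
  ultimately show ?thesis using inj by (auto dest: inj_onD)
qed

lemma lead_monomial_mult:
  assumes "supported F" "is_lead d F (\<sigma>, m)"
  shows "is_lead (d + mon_degree u) (pmul (Poly_Mapping.single u 1) F) (\<sigma>, m + u)"
  using assms degree_support_subset[OF assms(1), of d]
  unfolding is_lead_def degree_support_monomial_mult by (force intro!: shift)

text \<open>Division: a subspace that realizes all leading positions of \<open>M\<close> allows the part of degree
  \<open>d\<close> of each element of \<open>M\<close> to be cancelled.\<close>

lemma reduce_by_leads:
  assumes M: "tuple_space.subspace M" "\<And>F. F \<in> M \<Longrightarrow> supported F"
    and N: "tuple_space.subspace N" "N \<subseteq> M"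
    and lead: "\<And>F a. \<lbrakk>F \<in> M; is_lead d F a\<rbrakk> \<Longrightarrow> \<exists>G\<in>N. is_lead d G a"
    and F: "F \<in> M"
  shows "\<exists>G\<in>N. degree_support d (F - G) = {}"
proof -
  have "\<exists>G\<in>N. degree_support d (F - G) = {}"
    if "F \<in> M" "\<forall>b\<in>degree_support d F. \<kappa> b < k" for k F
    using that
  proof (induction k arbitrary: F)
    case 0
    then show ?case using tuple_space.subspace_0[OF N(1)] by (intro bexI[of _ 0]) auto
  next
    case (Suc k)
    show ?case
    proof (cases "degree_support d F = {}")
      case True
      then show ?thesis using tuple_space.subspace_0[OF N(1)] by (intro bexI[of _ 0]) auto
    next
      case False
      then obtain a where a: "is_lead d F a" using lead_exists M(2) Suc.prems(1) by blast
      then obtain G where G: "G \<in> N" "is_lead d G a" using lead Suc.prems(1) by blast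
      define c where "c = coef F a / coef G a"
      define F' where "F' = F - tuple_scale c G"
      have cG: "tuple_scale c G \<in> N" using G(1) tuple_space.subspace_scale[OF N(1)] by blast
      have F': "F' \<in> M" using Suc.prems(1) cG N(2) tuple_space.subspace_diff[OF M(1)] by (auto simp: F'_def)
      have "coef G a \<noteq> 0" using G(2) by (simp add: is_lead_def degree_support_def)
      then have zero: "coef F' a = 0" by (simp add: F'_def c_def)
      have "\<kappa> b < k" if b: "b \<in> degree_support d F'" for b
      proof -
        have "b \<in> degree_support d F \<or> b \<in> degree_support d G"
          using b by (auto simp: degree_support_def F'_def)
        then have le: "\<kappa> b \<le> \<kappa> a" using a G(2) by (auto simp: is_lead_def)
        have "b \<noteq> a" using b zero by (auto simp: degree_support_def)
        moreover have "a \<in> \<Sigma> \<times> UNIV" "b \<in> \<Sigma> \<times> UNIV"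
          using a b degree_support_subset[OF M(2)[OF F'], of d] degree_support_subset[OF M(2)[OF Suc.prems(1)], of d]
          by (auto simp: is_lead_def)
        ultimately have "\<kappa> b \<noteq> \<kappa> a" using inj by (auto dest: inj_onD)
        moreover have "\<kappa> a < Suc k" using a Suc.prems(2) by (simp add: is_lead_def)
        ultimately show ?thesis using le by simp
      qed
      then obtain G' where "G' \<in> N" "degree_support d (F' - G') = {}" using Suc.IH F' by blast
      moreover have "F' - G' = F - (tuple_scale c G + G')" by (simp add: F'_def algebra_simps)
      moreover have "tuple_scale c G + G' \<in> N"
        using \<open>G' \<in> N\<close> cG tuple_space.subspace_add[OF N(1)] by blast
      ultimately show ?thesis by metis
    qed
  qed
  moreover have "\<forall>b\<in>degree_support d F. \<kappa> b < Suc (Max (\<kappa> ` degree_support d F))"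
    using finite_degree_support[OF M(2)[OF F]] by (simp add: less_Suc_eq_le)
  ultimately show ?thesis using F by blast
qed

text \<open>The leading positions of degree \<open>d\<close> of all elements of \<open>M\<close>.\<close>

definition leads :: "nat \<Rightarrow> 'n tuple set \<Rightarrow> ((real ^ 'n) set \<times> ('n \<Rightarrow>\<^sub>0 nat)) set" where
  "leads d M = {a. \<exists>F\<in>M. is_lead d F a}"

lemma leads_subset:
  "(\<And>F. F \<in> M \<Longrightarrow> supported F) \<Longrightarrow> leads d M \<subseteq> \<Sigma> \<times> {m. mon_degree m = d}"
  using degree_support_subset by (fastforce simp: leads_def is_lead_def)

text \<open>If the elements of \<open>M\<close> are determined by their parts of degree \<open>d\<close>, then one element for each leading
  position gives a basis: it spans by reduction, and it is triangular with respect to the keys.\<close>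

lemma basis_of_leads:
  assumes M: "tuple_space.subspace M" "\<And>F. F \<in> M \<Longrightarrow> supported F"
    and hom: "\<And>F. \<lbrakk>F \<in> M; degree_support d F = {}\<rbrakk> \<Longrightarrow> F = 0"
  shows "\<exists>B. finite B \<and> tuple_space.independent B \<and> tuple_space.span B = M \<and> card B = card (leads d M)"
proof -
  have finA: "finite (leads d M)"
    by (rule finite_subset[OF leads_subset[OF M(2)]])
       (use fin finite_mon_degree_eq[of UNIV d] in auto)
  have "\<forall>a\<in>leads d M. \<exists>F. F \<in> M \<and> is_lead d F a" by (auto simp: leads_def)
  then obtain f where f: "\<And>a. a \<in> leads d M \<Longrightarrow> f a \<in> M \<and> is_lead d (f a) a" by metis
  let ?B = "f ` leads d M"
  have inj_f: "inj_on f (leads d M)"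
    using f lead_unique M(2) by (metis inj_onI)
  have BM: "?B \<subseteq> M" using f by auto
  then have span: "tuple_space.span ?B \<subseteq> M" by (rule tuple_space.span_minimal[OF _ M(1)])
  have "F \<in> tuple_space.span ?B" if F: "F \<in> M" for F
  proof -
    have "\<exists>G\<in>tuple_space.span ?B. degree_support d (F - G) = {}"
    proof (rule reduce_by_leads[OF M tuple_space.subspace_span span _ F])
      fix F a assume "F \<in> M" "is_lead d F a"
      then have "a \<in> leads d M" by (auto simp: leads_def)
      then show "\<exists>G\<in>tuple_space.span ?B. is_lead d G a"
        using f by (meson imageI tuple_space.span_base)
    qed
    then obtain G where G: "G \<in> tuple_space.span ?B" "degree_support d (F - G) = {}" by blast
    then have "F - G = 0" using hom F span tuple_space.subspace_diff[OF M(1)] by blast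
    then show ?thesis using G(1) by simp
  qed
  moreover have "tuple_space.independent ?B"
  proof
    assume "tuple_space.dependent ?B"
    then obtain u where u: "\<exists>v\<in>?B. u v \<noteq> 0" "(\<Sum>v\<in>?B. tuple_scale (u v) v) = 0"
      using tuple_space.dependent_finite[of ?B] finA by auto
    let ?S = "{a\<in>leads d M. u (f a) \<noteq> 0}"
    have S: "finite ?S" "?S \<noteq> {}" using finA u(1) by auto
    then have "Max (\<kappa> ` ?S) \<in> \<kappa> ` ?S" by (intro Max_in) auto
    then obtain a where a: "a \<in> ?S" "\<kappa> a = Max (\<kappa> ` ?S)" by auto
    have max: "\<kappa> b \<le> \<kappa> a" if "b \<in> ?S" for b using a(2) S that by simp
    have nonlead: "coef (f b) a = 0" if b: "b \<in> ?S" "b \<noteq> a" for b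
    proof (rule ccontr)
      assume "coef (f b) a \<noteq> 0"
      moreover have "mon_degree (snd a) = d" using a(1) f[of a] by (auto simp: is_lead_def degree_support_def)
      ultimately have "a \<in> degree_support d (f b)" by (simp add: degree_support_def)
      then have "\<kappa> a \<le> \<kappa> b" using f[of b] b by (auto simp: is_lead_def)
      with max[OF b(1)] have "\<kappa> a = \<kappa> b" by simp
      moreover have "a \<in> \<Sigma> \<times> UNIV" "b \<in> \<Sigma> \<times> UNIV" using a(1) b(1) leads_subset[of M d] M(2) by auto
      ultimately show False using b(2) inj by (auto dest: inj_onD)
    qed
    have z: "u (f b) * coef (f b) a = 0" if "b \<in> leads d M" "b \<noteq> a" for b
    proof (cases "u (f b) = 0")
      case False
      with that have "b \<in> ?S" by simp
      then show ?thesis using nonlead[OF _ that(2)] by simp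
    qed simp
    have "0 = coef (\<Sum>v\<in>?B. tuple_scale (u v) v) a" by (simp add: u(2))
    also have "\<dots> = (\<Sum>b\<in>leads d M. u (f b) * coef (f b) a)"
      by (simp add: coef_sum sum.reindex[OF inj_f])
    also have "\<dots> = u (f a) * coef (f a) a"
    proof -
      have "(\<Sum>b\<in>leads d M - {a}. u (f b) * coef (f b) a) = 0"
        using z by (intro sum.neutral) blast
      then show ?thesis using a(1) finA by (subst sum.remove[of _ a]) simp_all
    qed
    finally show False using a(1) f[of a] by (auto simp: is_lead_def degree_support_def)
  qed
  ultimately show ?thesis using span finA card_image[OF inj_f] by (intro exI[of _ ?B]) auto
qed

text \<open>The family \<open>M\<close> may consist of the graded pieces of a graded module, or of the pieces of bounded
  degree of a filtered one.\<close>

context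
  fixes M :: "nat \<Rightarrow> 'n tuple set"
  assumes M_sub: "\<And>d. tuple_space.subspace (M d)"
    and M_supp: "\<And>d F. F \<in> M d \<Longrightarrow> supported F"
    and M_mult: "\<And>d F i. F \<in> M d \<Longrightarrow> pmul (Poly_Mapping.single (Poly_Mapping.single i 1) 1) F \<in> M (Suc d)"
begin

lemma graded_monomial_mult: "F \<in> M d \<Longrightarrow> pmul (Poly_Mapping.single u 1) F \<in> M (d + mon_degree u)"
proof (induction "mon_degree u" arbitrary: u)
  case 0
  then have "u = 0" by (simp add: mon_degree_def poly_mapping_eq_iff fun_eq_iff)
  then show ?case using 0 by (simp add: pmul_simps)
next
  case (Suc e)
  then have "\<exists>i. Poly_Mapping.lookup u i \<noteq> 0" by (auto simp: mon_degree_def intro: ccontr)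
  then obtain i where i: "Poly_Mapping.lookup u i \<noteq> 0" by blast
  define u' where "u' = u - Poly_Mapping.single i 1"
  have u: "u = Poly_Mapping.single i 1 + u'"
    using i by (intro poly_mapping_eqI) (auto simp: u'_def lookup_add lookup_minus lookup_single when_def)
  have e: "mon_degree u = Suc (mon_degree u')" by (subst u) (simp only: mon_degree_add mon_degree_single plus_1_eq_Suc)
  then have "pmul (Poly_Mapping.single u' 1) F \<in> M (d + mon_degree u')" using Suc by simp
  from M_mult[OF this, of i] show ?case
    unfolding pmul_simps mult_single u[symmetric] by (simp add: e)
qed

lemma leads_graded_upclosed:
  assumes "(\<sigma>, m) \<in> leads d (M d)"
  shows "(\<sigma>, m + u) \<in> leads (d + mon_degree u) (M (d + mon_degree u))"
proof -
  obtain F where F: "F \<in> M d" "is_lead d F (\<sigma>, m)" using assms by (auto simp: leads_def)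
  show ?thesis unfolding leads_def
    using lead_monomial_mult[OF M_supp[OF F(1)] F(2)] graded_monomial_mult[OF F(1)] by blast
qed

text \<open>Noetherianity: beyond the degrees of finitely many minimal leading positions, each leading position
  of degree \<open>d + 1\<close> is a variable times one of degree \<open>d\<close>. So the variables times \<open>M d\<close> generate \<open>M (d + 1)\<close>
  up to elements without a part of degree \<open>d + 1\<close>.\<close>

lemma eventually_generated:
  "\<exists>D. \<forall>d\<ge>D. \<forall>F\<in>M (Suc d). \<exists>G\<in>tuple_space.span (\<Union>i. pmul (Poly_Mapping.single (Poly_Mapping.single i 1) 1) ` M d).
     degree_support (Suc d) (F - G) = {}"
proof -
  define U where "U \<sigma> = {m. (\<sigma>, m) \<in> leads (mon_degree m) (M (mon_degree m))}" for \<sigma>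
  have "\<forall>\<sigma>. \<exists>B. finite B \<and> B \<subseteq> U \<sigma> \<and> U \<sigma> \<subseteq> (\<Union>b\<in>B. multiples b)" using dickson by (intro allI)
  from choice[OF this] obtain B
    where B: "\<forall>\<sigma>. finite (B \<sigma>) \<and> B \<sigma> \<subseteq> U \<sigma> \<and> U \<sigma> \<subseteq> (\<Union>b\<in>B \<sigma>. multiples b)" ..
  define D where "D = Max (insert 0 (mon_degree ` (\<Union>\<sigma>\<in>\<Sigma>. B \<sigma>)))"
  have D: "mon_degree b \<le> D" if "b \<in> B \<sigma>" "\<sigma> \<in> \<Sigma>" for b \<sigma>
    unfolding D_def using that B fin by (intro Max_ge) auto
  show ?thesis
  proof (intro exI[of _ D] allI impI ballI)
    fix d F assume d: "D \<le> d" and F: "F \<in> M (Suc d)"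
    let ?N = "tuple_space.span (\<Union>i. pmul (Poly_Mapping.single (Poly_Mapping.single i 1) 1) ` M d)"
    have NM: "?N \<subseteq> M (Suc d)" by (rule tuple_space.span_minimal[OF _ M_sub]) (use M_mult in blast)
    show "\<exists>G\<in>?N. degree_support (Suc d) (F - G) = {}"
    proof (rule reduce_by_leads[OF M_sub M_supp tuple_space.subspace_span NM _ F])
      fix F a assume F: "F \<in> M (Suc d)" and a: "is_lead (Suc d) F a"
      obtain \<sigma> m where am: "a = (\<sigma>, m)" by fastforce
      have \<sigma>: "\<sigma> \<in> \<Sigma>" "mon_degree m = Suc d"
        using a degree_support_subset[OF M_supp[OF F]] by (auto simp: is_lead_def am)
      then have "m \<in> U \<sigma>" using F a by (auto simp: U_def leads_def am)
      then obtain b where b: "b \<in> B \<sigma>" "m \<in> multiples b" using B by blast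
      then obtain u where u: "m = b + u" by (auto simp: multiples_def)
      have "mon_degree u \<noteq> 0" using D[OF b(1) \<sigma>(1)] d \<sigma>(2) by (simp add: u mon_degree_add)
      then have "\<exists>i. Poly_Mapping.lookup u i \<noteq> 0" by (auto simp: mon_degree_def)
      then obtain i where i: "Poly_Mapping.lookup u i \<noteq> 0" by blast
      define u' where "u' = u - Poly_Mapping.single i 1"
      have u': "u = u' + Poly_Mapping.single i 1"
        using i by (intro poly_mapping_eqI) (auto simp: u'_def lookup_add lookup_minus lookup_single when_def)
      have deg: "mon_degree b + mon_degree u' = d"
        using \<sigma>(2) by (simp add: u u' mon_degree_add)
      have "(\<sigma>, b) \<in> leads (mon_degree b) (M (mon_degree b))" using b(1) B by (auto simp: U_def)
      then have "(\<sigma>, b + u') \<in> leads d (M d)" using leads_graded_upclosed[of \<sigma> b _ u'] deg by auto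
      then obtain G where G: "G \<in> M d" "is_lead d G (\<sigma>, b + u')" by (auto simp: leads_def)
      have "is_lead (Suc d) (pmul (Poly_Mapping.single (Poly_Mapping.single i 1) 1) G) a"
        using lead_monomial_mult[OF M_supp[OF G(1)] G(2), of "Poly_Mapping.single i 1"]
        unfolding am u u' by (simp add: add.assoc)
      moreover have "pmul (Poly_Mapping.single (Poly_Mapping.single i 1) 1) G \<in> ?N"
        using G(1) by (intro tuple_space.span_base) blast
      ultimately show "\<exists>G\<in>?N. is_lead (Suc d) G a" by blast
    qed
  qed
qed

lemma hilbert_function_eventually_polynomial:
  assumes hom: "\<And>d F. \<lbrakk>F \<in> M d; degree_support d F = {}\<rbrakk> \<Longrightarrow> F = 0"
  shows "eventually_polynomial (\<lambda>d. tuple_space.dim (M d))"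
proof -
  define U where "U \<sigma> = {m. (\<sigma>, m) \<in> leads (mon_degree m) (M (mon_degree m))}" for \<sigma>
  have "tuple_space.dim (M d) = (\<Sum>\<sigma>\<in>\<Sigma>. count_degree (U \<sigma>) d)" for d
  proof -
    obtain B where B: "tuple_space.independent B" "tuple_space.span B = M d" "card B = card (leads d (M d))"
      using basis_of_leads[OF M_sub, of d d] M_supp hom by blast
    have "leads d (M d) = (SIGMA \<sigma>:\<Sigma>. {m\<in>U \<sigma>. mon_degree m = d})"
      using leads_subset[of "M d" d] M_supp by (auto simp: U_def)
    then have "card (leads d (M d)) = (\<Sum>\<sigma>\<in>\<Sigma>. count_degree (U \<sigma>) d)"
      using fin by (simp only: count_degree_def) (rule card_SigmaI, auto intro: finite_mon_degree_eq)
    moreover have "tuple_space.dim (M d) = card B"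
      using tuple_space.dim_eq_card[OF _ B(1), of "M d"] B(2) by (metis tuple_space.span_span)
    ultimately show ?thesis using B(3) by simp
  qed
  moreover have "eventually_polynomial (count_degree (U \<sigma>))" for \<sigma>
  proof (rule eventually_polynomial_count_upclosed)
    fix m u assume "m \<in> U \<sigma>"
    then show "m + u \<in> U \<sigma>" using leads_graded_upclosed[of \<sigma> m _ u] by (auto simp: U_def mon_degree_add)
  qed
  ultimately show ?thesis using eventually_polynomial_sum[OF fin, of "\<lambda>\<sigma>. count_degree (U \<sigma>)"] by simp
qed

end

end

lemma coef_tuple_monomial:
  "coef (\<lambda>\<sigma>. if \<sigma> = fst a then Poly_Mapping.single (snd a) 1 else 0) b = (if b = a then 1 else 0)"
  by (cases a; cases b) (auto simp: coef_def lookup_single when_def)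

lemma finite_spanning_set:
  fixes M :: "'n::finite tuple set"
  assumes "finite X" "\<And>F a. F \<in> M \<Longrightarrow> a \<notin> X \<Longrightarrow> coef F a = 0"
  shows "\<exists>G. finite G \<and> G \<subseteq> M \<and> M \<subseteq> tuple_space.span G"
proof -
  define e :: "(real ^ 'n) set \<times> ('n \<Rightarrow>\<^sub>0 nat) \<Rightarrow> 'n tuple"
    where "e a = (\<lambda>\<sigma>. if \<sigma> = fst a then Poly_Mapping.single (snd a) 1 else 0)" for a
  have "F \<in> tuple_space.span (e ` X)" if F: "F \<in> M" for F
  proof -
    have "F = (\<Sum>a\<in>X. tuple_scale (coef F a) (e a))"
    proof (rule tuple_eqI)
      fix b
      have "coef (\<Sum>a\<in>X. tuple_scale (coef F a) (e a)) b = (\<Sum>a\<in>X. if a = b then coef F a else 0)"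
        unfolding coef_sum by (intro sum.cong) (auto simp: e_def coef_tuple_monomial)
      also have "\<dots> = coef F b" using assms F by simp
      finally show "coef F b = coef (\<Sum>a\<in>X. tuple_scale (coef F a) (e a)) b" by simp
    qed
    also have "\<dots> \<in> tuple_space.span (e ` X)"
      by (intro tuple_space.span_sum tuple_space.span_scale tuple_space.span_base) auto
    finally show ?thesis .
  qed
  then have M: "M \<subseteq> tuple_space.span (e ` X)" by blast
  obtain G where G: "G \<subseteq> M" "tuple_space.independent G" "M \<subseteq> tuple_space.span G"
    using tuple_space.maximal_independent_subset by blast
  have "finite G"
    using tuple_space.independent_span_bound[of "e ` X" G] assms(1) G(1,2) M by blast
  with G show ?thesis by blast
qed

section \<open>Growth modulo products of forms\<close>

text \<open>The order of growth of the graded pieces of a polynomial ring in \<open>q\<close> variables. For \<open>q = 0\<close> these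
  pieces are zero in positive degrees.\<close>

definition growth :: "nat \<Rightarrow> nat \<Rightarrow> nat" where
  "growth q d = (if q = 0 then 0 else (d + 1) ^ (q - 1))"

lemma pmul_span: "F \<in> tuple_space.span X \<Longrightarrow> pmul p F \<in> tuple_space.span (pmul p ` X)"
proof (induction rule: tuple_space.span_induct_alt)
  case base
  show ?case unfolding pmul_simps by (rule tuple_space.span_zero)
next
  case (step c x y)
  show ?case unfolding pmul_simps(1) pmul_tuple_scale
    using step by (intro tuple_space.span_add[OF tuple_space.span_scale[OF tuple_space.span_base]] imageI)
qed

lemma growth_mono: "d \<le> d' \<Longrightarrow> growth q d \<le> growth q d'"
  by (simp add: growth_def power_mono)

text \<open>If the exponents in \<open>Y0\<close> are bounded by \<open>s\<close>, then all but one of the other exponents can be chosen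
  freely; if there are no others, then the total exponent is bounded.\<close>

lemma card_bounded_exponents:
  fixes Y :: "'a set"
  assumes Y: "finite Y" "Y0 \<subseteq> Y" and e: "card Y0 * s < e"
  shows "card {\<alpha> \<in> Y \<rightarrow>\<^sub>E {..e}. (\<Sum>y\<in>Y. \<alpha> y) = e \<and> (\<forall>y\<in>Y0. \<alpha> y < s)}
    \<le> s ^ card Y0 * growth (card (Y - Y0)) e" (is "card ?X \<le> _")
proof (cases "Y0 = Y")
  case True
  have "\<alpha> \<notin> ?X" for \<alpha>
  proof
    assume a: "\<alpha> \<in> ?X"
    then have "(\<Sum>y\<in>Y. \<alpha> y) \<le> (\<Sum>y\<in>Y. s)" using True by (intro sum_mono) (auto intro: less_imp_le)
    then show False using a e True by simp
  qed
  then have "?X = {}" by blast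
  then show ?thesis by (metis card.empty le0)
next
  case False
  then obtain z where z: "z \<in> Y" "z \<notin> Y0" using Y(2) by blast
  let ?R = "\<lambda>y. if y \<in> Y0 then {..<s} else {..e}"
  have fin: "finite (PiE (Y - {z}) ?R)" using Y(1) by (intro finite_PiE) auto
  have "inj_on (\<lambda>\<alpha>. restrict \<alpha> (Y - {z})) ?X"
  proof (rule inj_onI)
    fix \<alpha> \<beta> assume a: "\<alpha> \<in> ?X" "\<beta> \<in> ?X" and eq: "restrict \<alpha> (Y - {z}) = restrict \<beta> (Y - {z})"
    have *: "\<alpha> y = \<beta> y" if "y \<in> Y - {z}" for y using fun_cong[OF eq, of y] that by simp
    have "(\<Sum>y\<in>Y. \<alpha> y) = \<alpha> z + (\<Sum>y\<in>Y - {z}. \<alpha> y)" "(\<Sum>y\<in>Y. \<beta> y) = \<beta> z + (\<Sum>y\<in>Y - {z}. \<beta> y)"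
      using Y(1) z(1) by (simp_all add: sum.remove)
    moreover have "(\<Sum>y\<in>Y - {z}. \<alpha> y) = (\<Sum>y\<in>Y - {z}. \<beta> y)" using * by (intro sum.cong) auto
    ultimately have "\<alpha> z = \<beta> z" using a by simp
    then have "\<forall>y\<in>Y. \<alpha> y = \<beta> y" using * by auto
    moreover have "\<alpha> \<in> Y \<rightarrow>\<^sub>E {..e}" "\<beta> \<in> Y \<rightarrow>\<^sub>E {..e}" using a by blast+
    ultimately show "\<alpha> = \<beta>" by (intro PiE_ext[of \<alpha> Y "\<lambda>_. {..e}" \<beta>]) blast+
  qed
  moreover have "(\<lambda>\<alpha>. restrict \<alpha> (Y - {z})) ` ?X \<subseteq> PiE (Y - {z}) ?R"
  proof (rule image_subsetI)
    fix \<alpha> assume a: "\<alpha> \<in> ?X"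
    have "\<alpha> y \<in> ?R y" if "y \<in> Y - {z}" for y
      using a that by (cases "y \<in> Y0") (simp_all add: PiE_iff)
    then show "restrict \<alpha> (Y - {z}) \<in> PiE (Y - {z}) ?R" by (simp only: restrict_PiE_iff) blast
  qed
  ultimately have "card ?X \<le> card (PiE (Y - {z}) ?R)" using fin by (rule card_inj_on_le)
  also have "\<dots> = (\<Prod>y\<in>Y - {z}. card (?R y))" using Y(1) by (simp add: card_PiE)
  also have "Y - {z} = Y0 \<union> (Y - Y0 - {z})" using z Y(2) by auto
  also have "(\<Prod>y\<in>Y0 \<union> (Y - Y0 - {z}). card (?R y)) = (\<Prod>y\<in>Y0. card (?R y)) * (\<Prod>y\<in>Y - Y0 - {z}. card (?R y))"
    using Y by (intro prod.union_disjoint) (auto intro: finite_subset)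
  also have "(\<Prod>y\<in>Y0. card (?R y)) = s ^ card Y0" by simp
  also have "(\<Prod>y\<in>Y - Y0 - {z}. card (?R y)) = (\<Prod>y\<in>Y - Y0 - {z}. e + 1)" by (intro prod.cong) auto
  also have "\<dots> = growth (card (Y - Y0)) e"
    using z Y(1) by (auto simp: growth_def card_Diff_singleton card_gt_0_iff)
  finally show ?thesis .
qed

text \<open>A family of spaces of tuples on which the forms with coefficient vectors in \<open>E\<close> raise the index
  by one and generate everything from \<open>M D\<close> on. With \<open>E = {0} \<times> UNIV\<close> these are the linear
  forms acting on graded pieces, and with \<open>E = UNIV\<close> all polynomials of degree at most one acting on
  the pieces of bounded degree, as in the homogenization.\<close>

locale finitely_generated_filtration =
  fixes M :: "nat \<Rightarrow> 'n::finite tuple set" and E :: "(real \<times> (real ^ 'n)) set" and D :: nat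
    and G :: "'n tuple set"
  assumes M_sub: "\<And>d. tuple_space.subspace (M d)"
    and E_sub: "subspace E"
    and M_mult: "\<And>v d F. \<lbrakk>v \<in> E; F \<in> M d\<rbrakk> \<Longrightarrow> pmul (affine_form v) F \<in> M (Suc d)"
    and gen: "\<And>d. D \<le> d \<Longrightarrow> M (Suc d) \<subseteq> tuple_space.span {pmul (affine_form v) F | v F. v \<in> E \<and> F \<in> M d}"
    and G: "finite G" "G \<subseteq> M D" "M D \<subseteq> tuple_space.span G"
begin

lemma mult_power: "v \<in> E \<Longrightarrow> F \<in> M d \<Longrightarrow> pmul (affine_form v ^ k) F \<in> M (d + k)"
proof (induction k)
  case 0
  then show ?case by (simp add: pmul_simps)
next
  case (Suc k)
  then have "pmul (affine_form v) (pmul (affine_form v ^ k) F) \<in> M (Suc (d + k))" by (intro M_mult)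
  then show ?case by (simp add: pmul_simps)
qed

lemma mult_prod_powers:
  assumes "finite Y" "Y \<subseteq> E" "F \<in> M d"
  shows "pmul (\<Prod>y\<in>Y. affine_form y ^ \<alpha> y) F \<in> M (d + (\<Sum>y\<in>Y. \<alpha> y))"
  using assms(1,2)
proof (induction Y)
  case empty
  then show ?case using assms(3) by (simp add: pmul_simps)
next
  case (insert y Y)
  then have "pmul (affine_form y ^ \<alpha> y) (pmul (\<Prod>y\<in>Y. affine_form y ^ \<alpha> y) F) \<in> M (d + (\<Sum>y\<in>Y. \<alpha> y) + \<alpha> y)"
    by (intro mult_power) auto
  then show ?case using insert.hyps by (simp add: pmul_simps add_ac)
qed

lemma mult_product_power:
  assumes "finite S" "h ` S \<subseteq> E" "F \<in> M d"
  shows "pmul ((\<Prod>\<tau>\<in>S. affine_form (h \<tau>)) ^ s) F \<in> M (d + s * card S)"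
  using assms(1,2)
proof (induction S)
  case empty
  then show ?case using assms(3) by (simp add: pmul_simps)
next
  case (insert \<tau> S)
  then have "pmul (affine_form (h \<tau>) ^ s) (pmul ((\<Prod>\<tau>\<in>S. affine_form (h \<tau>)) ^ s) F) \<in> M (d + s * card S + s)"
    by (intro mult_power) auto
  then show ?case using insert.hyps by (simp add: pmul_simps power_mult_distrib add_ac)
qed

lemma prod_power_update:
  assumes "finite Y" "y \<in> Y"
  shows "(\<Prod>z\<in>Y. affine_form z ^ (\<alpha>(y := \<alpha> y + k)) z) = affine_form y ^ k * (\<Prod>z\<in>Y. affine_form z ^ \<alpha> z)"
    "(\<Sum>z\<in>Y. (\<alpha>(y := \<alpha> y + k)) z) = k + (\<Sum>z\<in>Y. \<alpha> z)"
proof -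
  have "(\<Prod>z\<in>Y - {y}. affine_form z ^ (\<alpha>(y := \<alpha> y + k)) z) = (\<Prod>z\<in>Y - {y}. affine_form z ^ \<alpha> z)"
    by (intro prod.cong) auto
  then show "(\<Prod>z\<in>Y. affine_form z ^ (\<alpha>(y := \<alpha> y + k)) z) = affine_form y ^ k * (\<Prod>z\<in>Y. affine_form z ^ \<alpha> z)"
    using assms by (simp add: prod.remove[of Y y] power_add mult_ac)
  have "(\<Sum>z\<in>Y - {y}. (\<alpha>(y := \<alpha> y + k)) z) = (\<Sum>z\<in>Y - {y}. \<alpha> z)"
    by (intro sum.cong) auto
  then show "(\<Sum>z\<in>Y. (\<alpha>(y := \<alpha> y + k)) z) = k + (\<Sum>z\<in>Y. \<alpha> z)"
    using assms by (simp add: sum.remove[of Y y])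
qed

text \<open>The products of degree \<open>e\<close> of forms from \<open>Y\<close>, applied to the generators.\<close>

definition form_monomials :: "(real \<times> (real ^ 'n)) set \<Rightarrow> nat \<Rightarrow> 'n tuple set" where
  "form_monomials Y e = {pmul (\<Prod>y\<in>Y. affine_form y ^ \<alpha> y) g | \<alpha> g. (\<Sum>y\<in>Y. \<alpha> y) = e \<and> g \<in> G}"

lemma mult_form_monomials:
  assumes Y: "finite Y" and v: "v \<in> span Y" and F: "F \<in> form_monomials Y e"
  shows "pmul (affine_form v) F \<in> tuple_space.span (form_monomials Y (Suc e))"
  using v
proof (induction rule: span_induct_alt)
  case base
  show ?case unfolding affine_form_0 pmul_simps by (rule tuple_space.span_zero)
next
  case (step c y w)
  obtain \<alpha> g where F': "F = pmul (\<Prod>y\<in>Y. affine_form y ^ \<alpha> y) g" "(\<Sum>y\<in>Y. \<alpha> y) = e" "g \<in> G"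
    using F by (auto simp: form_monomials_def)
  have "pmul (affine_form y) F = pmul (\<Prod>z\<in>Y. affine_form z ^ (\<alpha>(y := \<alpha> y + 1)) z) g"
    unfolding prod_power_update(1)[OF Y step.hyps(1)] by (simp add: F' pmul_simps)
  moreover have "(\<Sum>z\<in>Y. (\<alpha>(y := \<alpha> y + 1)) z) = Suc e"
    unfolding prod_power_update(2)[OF Y step.hyps(1)] by (simp add: F')
  ultimately have "pmul (affine_form y) F \<in> form_monomials Y (Suc e)"
    unfolding form_monomials_def using F'(3) by blast
  moreover have "pmul (affine_form (c *\<^sub>R y + w)) F = tuple_scale c (pmul (affine_form y) F) + pmul (affine_form w) F"
    by (simp only: affine_form_add affine_form_scale pmul_simps tuple_scale_eq_pmul)
  ultimately show ?case using step.IH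
    by (simp only:) (rule tuple_space.span_add[OF tuple_space.span_scale[OF tuple_space.span_base]])
qed

lemma spanned_by_form_monomials:
  assumes Y: "finite Y" "span Y = E"
  shows "M (D + e) \<subseteq> tuple_space.span (form_monomials Y e)"
proof (induction e)
  case 0
  have "G \<subseteq> form_monomials Y 0"
  proof
    fix g assume "g \<in> G"
    then show "g \<in> form_monomials Y 0"
      unfolding form_monomials_def mem_Collect_eq
      by (intro exI[of _ "\<lambda>_. 0"] exI[of _ g])
         (simp only: power_0 prod.neutral_const pmul_simps sum.neutral_const simp_thms)
  qed
  then have "tuple_space.span G \<subseteq> tuple_space.span (form_monomials Y 0)" by (rule tuple_space.span_mono)
  then show ?case using G(3) by simp
next
  case (Suc e)
  let ?S = "tuple_space.span (form_monomials Y (Suc e))"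
  have "pmul (affine_form v) F \<in> ?S" if "v \<in> E" "F \<in> M (D + e)" for v F
  proof -
    have "pmul (affine_form v) F \<in> tuple_space.span (pmul (affine_form v) ` form_monomials Y e)"
      using Suc that(2) by (intro pmul_span) blast
    also have "\<dots> \<subseteq> ?S"
      using mult_form_monomials[OF Y(1)] that(1) Y(2)
      by (intro tuple_space.span_minimal[OF _ tuple_space.subspace_span]) blast
    finally show ?thesis .
  qed
  then have "tuple_space.span {pmul (affine_form v) F | v F. v \<in> E \<and> F \<in> M (D + e)} \<subseteq> ?S"
    by (intro tuple_space.span_minimal[OF _ tuple_space.subspace_span]) blast
  with gen[of "D + e"] show ?case by simp
qed

text \<open>Modulo the \<open>s\<close>-th powers of some of the forms in a spanning set, the filtration grows like a polynomial ring in
  the remaining forms.\<close>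

lemma growth_modulo_powers:
  assumes Y: "finite Y" "span Y = E" "Y0 \<subseteq> Y" and e: "card Y0 * s < e" "s \<le> e"
  shows "\<exists>B. finite B \<and> card B \<le> card G * s ^ card Y0 * growth (card (Y - Y0)) e \<and>
    M (D + e) \<subseteq> tuple_space.span (B \<union> {pmul (affine_form y ^ s) F | y F. y \<in> Y0 \<and> F \<in> M (D + e - s)})"
proof -
  let ?X = "{\<alpha> \<in> Y \<rightarrow>\<^sub>E {..e}. (\<Sum>y\<in>Y. \<alpha> y) = e \<and> (\<forall>y\<in>Y0. \<alpha> y < s)}"
  let ?mon = "\<lambda>(\<alpha>, g). pmul (\<Prod>y\<in>Y. affine_form y ^ \<alpha> y) g"
  let ?B = "?mon ` (?X \<times> G)"
  let ?P = "{pmul (affine_form y ^ s) F | y F. y \<in> Y0 \<and> F \<in> M (D + e - s)}"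
  have finX: "finite ?X"
    using finite_PiE[OF Y(1), of "\<lambda>_. {..e}"] by (rule rev_finite_subset) blast+
  have YE: "Y \<subseteq> E" using Y(2) span_superset[of Y] by simp
  have "card ?B \<le> card (?X \<times> G)" using finX G(1) by (intro card_image_le) auto
  also have "\<dots> = card G * card ?X" by (simp add: card_cartesian_product)
  also have "\<dots> \<le> card G * (s ^ card Y0 * growth (card (Y - Y0)) e)"
    using card_bounded_exponents[OF Y(1,3) e(1)] by (rule mult_le_mono2)
  finally have card: "card ?B \<le> card G * s ^ card Y0 * growth (card (Y - Y0)) e" by (simp add: mult.assoc)
  have "F \<in> ?B \<union> ?P" if F: "F \<in> form_monomials Y e" for F
  proof -
    obtain \<alpha> g where F': "F = pmul (\<Prod>y\<in>Y. affine_form y ^ \<alpha> y) g" "(\<Sum>y\<in>Y. \<alpha> y) = e" "g \<in> G"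
      using F by (auto simp: form_monomials_def)
    show ?thesis
    proof (cases "\<forall>y\<in>Y0. \<alpha> y < s")
      case True
      have "\<alpha> y \<le> e" if "y \<in> Y" for y using F'(2) member_le_sum[OF that _ Y(1), of \<alpha>] by simp
      then have "restrict \<alpha> Y \<in> ?X" using True F'(2) Y(3) by auto
      moreover have "F = ?mon (restrict \<alpha> Y, g)" by (simp add: F')
      ultimately show ?thesis using F'(3) by blast
    next
      case False
      then obtain y where y: "y \<in> Y0" "s \<le> \<alpha> y" by auto
      \<comment> \<open>An \<open>s\<close>-th power of this form splits off.\<close>
      define \<beta> where "\<beta> = \<alpha>(y := \<alpha> y - s)"
      have \<alpha>: "\<alpha> = \<beta>(y := \<beta> y + s)" using y(2) by (auto simp: \<beta>_def)
      have yY: "y \<in> Y" using y(1) Y(3) by auto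
      define F1 where "F1 = pmul (\<Prod>z\<in>Y. affine_form z ^ \<beta> z) g"
      have sum: "e = s + (\<Sum>z\<in>Y. \<beta> z)"
        unfolding F'(2)[symmetric] by (subst \<alpha>) (rule prod_power_update(2)[OF Y(1) yY])
      have "F1 \<in> M (D + (\<Sum>z\<in>Y. \<beta> z))"
        unfolding F1_def using F'(3) G(2) YE by (intro mult_prod_powers[OF Y(1)]) auto
      then have "F1 \<in> M (D + e - s)" using sum by (simp add: add.commute)
      moreover have "F = pmul (affine_form y ^ s) F1"
        unfolding F'(1) F1_def pmul_simps(3)
        by (subst \<alpha>) (simp only: prod_power_update(1)[OF Y(1) yY])
      ultimately show ?thesis using y(1) by blast
    qed
  qed
  then have "tuple_space.span (form_monomials Y e) \<subseteq> tuple_space.span (?B \<union> ?P)"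
    by (intro tuple_space.span_mono) blast
  then have "M (D + e) \<subseteq> tuple_space.span (?B \<union> ?P)"
    using spanned_by_form_monomials[OF Y(1,2), of e] by blast
  moreover have "finite ?B" using finX G(1) by simp
  ultimately show ?thesis using card by blast
qed

text \<open>The quotients \<open>M d / N d\<close> grow at most like a polynomial ring in \<open>q\<close> variables.\<close>

definition growth_bounded :: "(nat \<Rightarrow> 'n tuple set) \<Rightarrow> nat \<Rightarrow> bool" where
  "growth_bounded N q \<longleftrightarrow> (\<exists>c d0. \<forall>d\<ge>d0. \<exists>B. finite B \<and> card B \<le> c * growth q d \<and>
     M d \<subseteq> tuple_space.span (B \<union> N d))"

text \<open>The induction behind the theorem. Suppose that the \<open>s\<close>-th power of the product of the forms in \<open>S\<close>
  carries \<open>M\<close> into \<open>N\<close> whenever the other forms span a space of dimension at most \<open>k\<close>. If they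
  span more, choose \<open>k + 1\<close> independent ones among them. Modulo their \<open>s\<close>-th powers the growth is that
  of a polynomial ring in \<open>dim E - (k + 1)\<close> variables, and multiples of such a power are dealt with by
  moving the corresponding form into \<open>S\<close>. If \<open>dim E \<le> k\<close>, then the truncated difference is zero and
  only the first case occurs.\<close>

theorem growth_bounded_of_products:
  fixes h :: "'a \<Rightarrow> real \<times> (real ^ 'n)"
  assumes T: "finite T" "\<And>\<tau>. \<tau> \<in> T \<Longrightarrow> h \<tau> \<in> E"
    and prod: "\<And>S d F. \<lbrakk>S \<subseteq> T; dim (h ` (T - S)) \<le> k; F \<in> M d\<rbrakk> \<Longrightarrow>
      pmul ((\<Prod>\<tau>\<in>S. affine_form (h \<tau>)) ^ s) F \<in> N (d + s * card S)"
  shows "growth_bounded N (dim E - Suc k)"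
proof -
  define q where "q = dim E - Suc k"
  \<comment> \<open>the part of \<open>M\<close> that the power for \<open>S\<close> carries into \<open>N\<close>\<close>
  define Q where "Q S d = {F \<in> M d. pmul ((\<Prod>\<tau>\<in>S. affine_form (h \<tau>)) ^ s) F \<in> N (d + s * card S)}" for S d
  have "growth_bounded (Q S) q" if "S \<subseteq> T" for S
    using that
  proof (induction "card (T - S)" arbitrary: S rule: less_induct)
    case less
    have finS: "finite S" using less.prems T(1) finite_subset by blast
    show ?case
    proof (cases "dim (h ` (T - S)) \<le> k")
      case True
      then have "M d \<subseteq> Q S d" for d using prod[OF less.prems] by (auto simp: Q_def)
      then have "M d \<subseteq> tuple_space.span ({} \<union> Q S d)" for d
        using tuple_space.span_superset[of "Q S d"] unfolding Un_empty_left by (rule subset_trans)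
      then show ?thesis unfolding growth_bounded_def
        by (intro exI[of _ 0] allI impI exI[of _ "{}"]) auto
    next
      case False
      obtain Y1 where Y1: "Y1 \<subseteq> h ` (T - S)" "independent Y1" "card Y1 = dim (h ` (T - S))"
        using basis_exists by metis
      obtain Y0 where Y0: "Y0 \<subseteq> Y1" "card Y0 = Suc k" "finite Y0"
        using obtain_subset_with_card_n[of "Suc k" Y1] False Y1(3) by (metis not_less_eq_eq)
      have indep: "independent Y0" using Y0(1) Y1(2) independent_mono by blast
      have Y0E: "Y0 \<subseteq> E" using Y0(1) Y1(1) T(2) by auto
      obtain Y where Y: "Y0 \<subseteq> Y" "Y \<subseteq> E" "independent Y" "E \<subseteq> span Y"
        using maximal_independent_subset_extend[OF Y0E indep] by blast
      have finY: "finite Y" using Y(3) independent_imp_finite by blast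
      have spanY: "span Y = E" using Y span_minimal[OF Y(2) E_sub] by auto
      have "card Y = dim E" using basis_card_eq_dim Y by blast
      then have q: "card (Y - Y0) = q" using Y(1) Y0(2,3) by (simp add: card_Diff_subset q_def)
      define t where "t = inv_into (T - S) h"
      have t: "t y \<in> T - S \<and> h (t y) = y" if "y \<in> Y0" for y
      proof -
        have "y \<in> h ` (T - S)" using that Y0(1) Y1(1) by blast
        then show ?thesis unfolding t_def by (simp only: inv_into_into f_inv_into_f simp_thms)
      qed
      have IH: "growth_bounded (Q (insert (t y) S)) q" if "y \<in> Y0" for y
      proof (rule less.hyps)
        show "card (T - insert (t y) S) < card (T - S)"
          using t[OF that] T(1) by (intro psubset_card_mono) auto
        show "insert (t y) S \<subseteq> T" using t[OF that] less.prems by auto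
      qed
      then have "\<forall>y\<in>Y0. \<exists>cd. \<forall>d\<ge>snd cd. \<exists>B. finite B \<and> card B \<le> fst cd * growth q d \<and>
          M d \<subseteq> tuple_space.span (B \<union> Q (insert (t y) S) d)"
        by (simp add: growth_bounded_def)
      from bchoice[OF this] obtain cd where cd: "\<forall>y\<in>Y0. \<forall>d\<ge>snd (cd y). \<exists>B. finite B \<and> card B \<le> fst (cd y) * growth q d \<and>
          M d \<subseteq> tuple_space.span (B \<union> Q (insert (t y) S) d)" ..
      define c where "c = card G * s ^ card Y0 + (\<Sum>y\<in>Y0. fst (cd y))"
      define d0 where "d0 = D + s + card Y0 * s + 1 + (\<Sum>y\<in>Y0. snd (cd y))"
      have "\<exists>B. finite B \<and> card B \<le> c * growth q d \<and> M d \<subseteq> tuple_space.span (B \<union> Q S d)" if d: "d0 \<le> d" for d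
      proof -
        define e where "e = d - D"
        have e: "d = D + e" "card Y0 * s < e" "s \<le> e" using d by (auto simp: e_def d0_def)
        obtain B0 where B0: "finite B0" "card B0 \<le> card G * s ^ card Y0 * growth q e"
          "M d \<subseteq> tuple_space.span (B0 \<union> {pmul (affine_form y ^ s) F | y F. y \<in> Y0 \<and> F \<in> M (d - s)})"
          using growth_modulo_powers[OF finY spanY Y(1) e(2,3)] unfolding q e(1) by blast
        have "\<forall>y\<in>Y0. \<exists>B. finite B \<and> card B \<le> fst (cd y) * growth q (d - s) \<and>
            M (d - s) \<subseteq> tuple_space.span (B \<union> Q (insert (t y) S) (d - s))"
        proof
          fix y assume y: "y \<in> Y0"
          then have "snd (cd y) \<le> (\<Sum>y\<in>Y0. snd (cd y))" using Y0(3) by (intro member_le_sum) auto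
          then have "snd (cd y) \<le> d - s" using d by (simp add: d0_def)
          then show "\<exists>B. finite B \<and> card B \<le> fst (cd y) * growth q (d - s) \<and>
            M (d - s) \<subseteq> tuple_space.span (B \<union> Q (insert (t y) S) (d - s))" using cd y by blast
        qed
        from bchoice[OF this] obtain B1 where B1: "\<And>y. y \<in> Y0 \<Longrightarrow> finite (B1 y)"
          "\<And>y. y \<in> Y0 \<Longrightarrow> card (B1 y) \<le> fst (cd y) * growth q (d - s)"
          "\<And>y. y \<in> Y0 \<Longrightarrow> M (d - s) \<subseteq> tuple_space.span (B1 y \<union> Q (insert (t y) S) (d - s))" by blast
        define B where "B = B0 \<union> (\<Union>y\<in>Y0. pmul (affine_form y ^ s) ` B1 y)"
        have finB: "finite B" using B0(1) B1(1) Y0(3) by (auto simp: B_def)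
        have "card B \<le> card B0 + card (\<Union>y\<in>Y0. pmul (affine_form y ^ s) ` B1 y)"
          unfolding B_def by (rule card_Un_le)
        also have "card (\<Union>y\<in>Y0. pmul (affine_form y ^ s) ` B1 y) \<le> (\<Sum>y\<in>Y0. card (pmul (affine_form y ^ s) ` B1 y))"
          by (rule card_UN_le[OF Y0(3)])
        also have "\<dots> \<le> (\<Sum>y\<in>Y0. fst (cd y) * growth q d)"
        proof (rule sum_mono)
          fix y assume y: "y \<in> Y0"
          have "card (pmul (affine_form y ^ s) ` B1 y) \<le> card (B1 y)" using B1(1) y by (intro card_image_le) auto
          also have "\<dots> \<le> fst (cd y) * growth q (d - s)" using B1(2) y by blast
          also have "\<dots> \<le> fst (cd y) * growth q d" by (intro mult_left_mono growth_mono) auto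
          finally show "card (pmul (affine_form y ^ s) ` B1 y) \<le> fst (cd y) * growth q d" .
        qed
        also have "card B0 \<le> card G * s ^ card Y0 * growth q d"
          by (rule order_trans[OF B0(2)], rule mult_le_mono2, rule growth_mono) (simp add: e(1))
        finally have cardB: "card B \<le> c * growth q d"
          by (simp add: c_def distrib_right sum_distrib_right)
        have "pmul (affine_form y ^ s) F \<in> tuple_space.span (B \<union> Q S d)" if y: "y \<in> Y0" and F: "F \<in> M (d - s)" for y F
        proof -
          have "pmul (affine_form y ^ s) F' \<in> Q S d" if F': "F' \<in> Q (insert (t y) S) (d - s)" for F'
          proof -
            have "pmul (affine_form y ^ s) F' \<in> M (d - s + s)"
              using F' y Y0E by (intro mult_power) (auto simp: Q_def)
            moreover have "pmul ((\<Prod>\<tau>\<in>S. affine_form (h \<tau>)) ^ s) (pmul (affine_form y ^ s) F')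
                = pmul ((\<Prod>\<tau>\<in>insert (t y) S. affine_form (h \<tau>)) ^ s) F'"
              using t[OF y] finS by (simp add: pmul_simps power_mult_distrib mult.commute)
            moreover have "pmul ((\<Prod>\<tau>\<in>insert (t y) S. affine_form (h \<tau>)) ^ s) F' \<in> N (d - s + s * card (insert (t y) S))"
              using F' by (simp add: Q_def)
            moreover have "d - s + s * card (insert (t y) S) = d + s * card S" "d - s + s = d"
              using t[OF y] finS e by auto
            ultimately show ?thesis by (simp add: Q_def)
          qed
          then have "pmul (affine_form y ^ s) ` (B1 y \<union> Q (insert (t y) S) (d - s)) \<subseteq> B \<union> Q S d"
            using y by (auto simp: B_def)
          moreover have "pmul (affine_form y ^ s) F \<in> tuple_space.span (pmul (affine_form y ^ s) ` (B1 y \<union> Q (insert (t y) S) (d - s)))"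
            using B1(3)[OF y] F by (intro pmul_span) blast
          ultimately show ?thesis using tuple_space.span_mono by blast
        qed
        then have "B0 \<union> {pmul (affine_form y ^ s) F | y F. y \<in> Y0 \<and> F \<in> M (d - s)} \<subseteq> tuple_space.span (B \<union> Q S d)"
          by (auto simp: B_def intro: tuple_space.span_base)
        then have "tuple_space.span (B0 \<union> {pmul (affine_form y ^ s) F | y F. y \<in> Y0 \<and> F \<in> M (d - s)}) \<subseteq> tuple_space.span (B \<union> Q S d)"
          by (rule tuple_space.span_minimal[OF _ tuple_space.subspace_span])
        with B0(3) finB cardB show ?thesis by blast
      qed
      then show ?thesis unfolding growth_bounded_def by blast
    qed
  qed
  from this[of "{}"] obtain c d0 where *: "\<And>d. d0 \<le> d \<Longrightarrow> \<exists>B. finite B \<and> card B \<le> c * growth q d \<and>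
      M d \<subseteq> tuple_space.span (B \<union> Q {} d)" by (auto simp: growth_bounded_def)
  have "Q {} d \<subseteq> N d" for d by (auto simp: Q_def pmul_simps)
  then have "tuple_space.span (B \<union> Q {} d) \<subseteq> tuple_space.span (B \<union> N d)" for B d
    by (intro tuple_space.span_mono) blast
  with * show ?thesis unfolding growth_bounded_def q_def[symmetric] by (meson subset_trans)
qed

end

section \<open>Hilbert polynomials\<close>

text \<open>A polynomial that is nonnegative and of bounded growth at large integers has no coefficients from
  \<open>q\<close> on: if its degree were at least \<open>q\<close>, then it and the bound minus it would have leading coefficients
  of opposite signs.\<close>

lemma coeff_eq_0_of_growth:
  fixes p :: "real poly"
  assumes "\<forall>\<^sub>F d in sequentially. 0 \<le> poly p (real d) \<and> poly p (real d) \<le> real (c * growth q d)"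
    and "q \<le> i"
  shows "coeff p i = 0"
proof -
  have lead: "0 \<le> lead_coeff f" if f: "\<forall>\<^sub>F d in sequentially. 0 \<le> poly f (real d)" for f :: "real poly"
  proof (rule ccontr)
    assume "\<not> 0 \<le> lead_coeff f"
    then have "0 < lead_coeff (- f)" by simp
    then obtain x where x: "\<And>y. x \<le> y \<Longrightarrow> lead_coeff (- f) \<le> poly (- f) y" using poly_pinfty_gt_lc by blast
    have "\<forall>\<^sub>F d in sequentially. x \<le> real d"
      using filterlim_real_sequentially unfolding filterlim_at_top by blast
    with f have "\<forall>\<^sub>F d in sequentially. False"
    proof eventually_elim
      case (elim d)
      then show ?case using x[of "real d"] \<open>0 < lead_coeff (- f)\<close> by simp
    qed
    then show False by simp
  qed
  define b :: "real poly" where "b = (if q = 0 then 0 else smult (real c) ([:1, 1:] ^ (q - 1)))"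
  have b: "poly b (real d) = real (c * growth q d)" for d by (simp add: b_def growth_def add.commute)
  have degb: "degree b \<le> q - 1"
    using degree_power_le[of "[:1, 1 :: real:]" "q - 1"] by (auto simp: b_def intro: order_trans[OF degree_smult_le])
  show ?thesis
  proof (rule ccontr)
    assume nz: "coeff p i \<noteq> 0"
    then have deg: "q \<le> degree p" using assms(2) le_degree order_trans by blast
    have p0: "p \<noteq> 0" using nz by auto
    have "0 \<le> lead_coeff p" using assms(1) by (intro lead) (auto elim: eventually_mono)
    have bp: "0 \<le> lead_coeff (b - p)"
      using assms(1) by (intro lead) (auto simp: b elim: eventually_mono)
    have "lead_coeff (b - p) = - lead_coeff p"
    proof (cases "q = 0")
      case True
      then show ?thesis by (simp add: b_def)
    next
      case False
      then have lt: "degree b < degree p" using deg degb by simp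
      then have "degree (b - p) = degree p"
        using degree_add_eq_right[of b "- p"] by simp
      then show ?thesis using lt by (simp add: coeff_eq_0)
    qed
    then have "lead_coeff p = 0" using bp \<open>0 \<le> lead_coeff p\<close> by simp
    then show False using p0 by simp
  qed
qed

lemma poly_eqI_eventually:
  fixes f g :: "real poly"
  assumes "\<forall>\<^sub>F d in sequentially. poly f (real d) = poly g (real d)"
  shows "f = g"
proof (rule poly_eqI)
  fix i
  have "coeff (f - g) i = 0"
    by (rule coeff_eq_0_of_growth[where c = 0 and q = 0]) (use assms in \<open>auto elim: eventually_mono\<close>)
  then show "coeff f i = coeff g i" by simp
qed

lemma hilbert_poly_eqI:
  assumes "\<forall>\<^sub>F d in sequentially. poly h (real d) = real (tuple_space.dim (graded_part P M d))"
  shows "hilbert_poly P M = h"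
  unfolding hilbert_poly_def
proof (rule the_equality)
  fix h' assume "\<forall>\<^sub>F d in sequentially. poly h' (real d) = real (tuple_space.dim (graded_part P M d))"
  with assms have "\<forall>\<^sub>F d in sequentially. poly h' (real d) = poly h (real d)"
    by eventually_elim simp
  then show "h' = h" by (rule poly_eqI_eventually)
qed (rule assms)

section \<open>Hyperplanes spanned by faces\<close>

lemma total_degree_affine_form:
  assumes "snd v \<noteq> 0"
  shows "total_degree (affine_form v) = 1"
proof -
  obtain i where "snd v $ i \<noteq> 0" using assms by (metis vec_eq_iff zero_index)
  then have "Poly_Mapping.single i 1 \<in> Poly_Mapping.keys (affine_form v)"
    by (simp only: in_keys_iff lookup_affine_form not_False_eq_True)
  then have "1 \<le> total_degree (affine_form v)"
    unfolding total_degree_def by (intro Max_ge) (auto intro!: image_eqI[where x = "Poly_Mapping.single i 1"])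
  moreover have "total_degree (affine_form v) \<le> 1"
    unfolding total_degree_le_iff using keys_affine_form_mon_degree(1) by blast
  ultimately show ?thesis by simp
qed

lemma hyperplane_form_exists:
  fixes \<tau> :: "(real ^ 'n::finite) set"
  assumes "aff_dim \<tau> = int CARD('n) - 1"
  shows "\<exists>w. hyperplane_form \<tau> = affine_form w \<and> snd w \<noteq> 0 \<and> affine hull \<tau> = {x. w \<bullet> (1, x) = 0}"
proof -
  have "aff_dim \<tau> = int (DIM(real ^ 'n) - 1)" using assms zero_less_card_finite[where 'a = 'n] by simp
  then have "\<exists>a b. a \<noteq> 0 \<and> affine hull \<tau> = {x. a \<bullet> x = b}" by (simp only: aff_dim_eq_hyperplane)
  then obtain a b where ab: "a \<noteq> 0" "affine hull \<tau> = {x. a \<bullet> x = b}" by (elim exE conjE)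
  define v where "v = (- b, a)"
  have v: "snd v \<noteq> 0" "affine hull \<tau> = {x. v \<bullet> (1, x) = 0}"
    using ab by (auto simp: v_def inner_prod_def)
  define l where "l = hyperplane_form \<tau>"
  have "total_degree l = 1 \<and> {p * l | p. True} = vanishing_ideal (affine hull \<tau>)"
    unfolding l_def hyperplane_form_def
    by (rule someI[where x = "affine_form v"])
       (simp only: total_degree_affine_form[OF v(1)] v(2) vanishing_ideal_hyperplane[OF v(1)] simp_thms)
  then have l: "total_degree l = 1" "{p * l | p. True} = vanishing_ideal (affine hull \<tau>)" by auto
  obtain w where w: "l = affine_form w" using total_degree_le_1_affine_form[of l] l(1) by auto
  have "1 * l \<in> {p * l | p. True}" by blast
  then have "l \<in> vanishing_ideal (affine hull \<tau>)" by (simp only: l(2) mult_1_left)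
  then have van: "w \<bullet> (1, x) = 0" if "x \<in> affine hull \<tau>" for x
    using that by (simp add: w vanishing_ideal_def poly_eval_affine_form)
  have "affine_form v \<in> {p * l | p. True}"
    unfolding l(2) v(2) vanishing_ideal_hyperplane[OF v(1)] by (auto intro: exI[of _ 1])
  then obtain p where p: "affine_form v = p * l" by blast
  have "x \<in> affine hull \<tau>" if "w \<bullet> (1, x) = 0" for x
    using arg_cong[OF p, of "\<lambda>q. poly_eval q x"] that
    by (simp add: v(2) poly_eval_mult w poly_eval_affine_form)
  then have aff: "affine hull \<tau> = {x. w \<bullet> (1, x) = 0}" using van by blast
  have "snd w \<noteq> 0"
  proof
    assume 0: "snd w = 0"
    have "\<tau> \<noteq> {}" using assms by auto
    then obtain x where "x \<in> affine hull \<tau>" by (metis affine_hull_eq_empty ex_in_conv)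
    then have "fst w = 0" using van[of x] 0 by (simp add: inner_prod_def)
    then have "w = 0" using 0 by (simp add: prod_eq_iff)
    then have "l = 0" by (simp add: w)
    then show False using l(1) by (simp add: total_degree_def)
  qed
  then show ?thesis using w aff unfolding l_def by blast
qed

text \<open>The vector \<open>(b, a)\<close> of coefficients of the form \<open>b + a \<bullet> x\<close> chosen for the hyperplane
  spanned by \<open>\<tau>\<close>.\<close>

definition normal :: "(real ^ 'n::finite) set \<Rightarrow> real \<times> (real ^ 'n)" where
  "normal \<tau> = (SOME w. hyperplane_form \<tau> = affine_form w \<and> snd w \<noteq> 0 \<and> affine hull \<tau> = {x. w \<bullet> (1, x) = 0})"

lemma normal:
  fixes \<tau> :: "(real ^ 'n::finite) set"
  assumes "aff_dim \<tau> = int CARD('n) - 1"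
  shows "hyperplane_form \<tau> = affine_form (normal \<tau>)" "affine hull \<tau> = {x. normal \<tau> \<bullet> (1, x) = 0}"
proof -
  have "hyperplane_form \<tau> = affine_form (normal \<tau>) \<and> snd (normal \<tau>) \<noteq> 0 \<and> affine hull \<tau> = {x. normal \<tau> \<bullet> (1, x) = 0}"
    unfolding normal_def by (rule someI_ex[OF hyperplane_form_exists[OF assms]])
  then show "hyperplane_form \<tau> = affine_form (normal \<tau>)" "affine hull \<tau> = {x. normal \<tau> \<bullet> (1, x) = 0}"
    by blast+
qed

text \<open>The cone over the hyperplane is the kernel of the homogenized form.\<close>

lemma cone_hyperplane_eq:
  fixes \<tau> :: "(real ^ 'n::finite) set"
  assumes \<tau>: "aff_dim \<tau> = int CARD('n) - 1"
  shows "cone_hyperplane \<tau> = {z. normal \<tau> \<bullet> z = 0}"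
proof
  have "\<tau> \<subseteq> affine hull \<tau>" by (rule hull_subset)
  then have "{1} \<times> \<tau> \<subseteq> {z. normal \<tau> \<bullet> z = 0}" unfolding normal(2)[OF \<tau>] by auto
  then show "cone_hyperplane \<tau> \<subseteq> {z. normal \<tau> \<bullet> z = 0}"
    unfolding cone_hyperplane_def by (rule span_minimal) (rule subspace_hyperplane)
  let ?C = "span ({1::real} \<times> \<tau>)"
  have "affine {y. (1, y) \<in> ?C}"
    unfolding affine_def
  proof clarify
    fix x y u v assume xy: "(1, x) \<in> ?C" "(1, y) \<in> ?C" and uv: "u + v = (1::real)"
    have "u *\<^sub>R (1, x) + v *\<^sub>R (1, y) \<in> ?C" using xy by (intro span_add span_scale)
    then show "(1, u *\<^sub>R x + v *\<^sub>R y) \<in> ?C" using uv by simp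
  qed
  moreover have "\<tau> \<subseteq> {y. (1, y) \<in> ?C}" by (auto intro: span_base)
  ultimately have aff: "(1, y) \<in> ?C" if "y \<in> affine hull \<tau>" for y
    using that hull_minimal by blast
  show "{z. normal \<tau> \<bullet> z = 0} \<subseteq> cone_hyperplane \<tau>"
  proof
    fix z assume z: "z \<in> {z. normal \<tau> \<bullet> z = 0}"
    obtain t x where tx: "z = (t, x)" by fastforce
    show "z \<in> cone_hyperplane \<tau>"
    proof (cases "t = 0")
      case False
      define y where "y = (1 / t) *\<^sub>R x"
      have zy: "z = t *\<^sub>R (1, y)" using False by (simp add: tx y_def)
      have "t * (normal \<tau> \<bullet> (1, y)) = 0" using z unfolding zy by (simp only: mem_Collect_eq inner_scaleR_right)
      then have "normal \<tau> \<bullet> (1, y) = 0" using False by (simp only: mult_eq_0_iff simp_thms)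
      then have "(1, y) \<in> ?C" by (intro aff) (simp only: normal(2)[OF \<tau>] mem_Collect_eq)
      then show ?thesis unfolding cone_hyperplane_def zy by (rule span_scale)
    next
      case True
      \<comment> \<open>A vector at height 0 is a difference of two points at height 1.\<close>
      have "\<tau> \<noteq> {}" using \<tau> by auto
      then obtain y where y: "y \<in> affine hull \<tau>" by (metis affine_hull_eq_empty ex_in_conv)
      then have "y + x \<in> affine hull \<tau>"
        using z by (simp add: normal(2)[OF \<tau>] tx True inner_prod_def inner_add_right)
      then have "(1, y + x) - (1, y) \<in> ?C" using y by (intro span_diff aff)
      then show ?thesis by (simp add: cone_hyperplane_def tx True)
    qed
  qed
qed

lemma rk_Inter_hyperplanes:
  fixes A :: "(real \<times> (real ^ 'n::finite)) set"
  shows "rk (\<Inter>a\<in>A. {z. a \<bullet> z = 0}) = dim A"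
proof -
  have "(\<Inter>a\<in>A. {z. a \<bullet> z = 0}) = {y \<in> UNIV. \<forall>x\<in>span A. orthogonal x y}"
  proof (intro equalityI subsetI)
    fix z assume "z \<in> (\<Inter>a\<in>A. {z. a \<bullet> z = 0})"
    then have "orthogonal z x" if "x \<in> A" for x using that by (simp add: orthogonal_def inner_commute)
    then have "orthogonal z x" if "x \<in> span A" for x using that orthogonal_to_span[of x A z] by blast
    then show "z \<in> {y \<in> UNIV. \<forall>x\<in>span A. orthogonal x y}" by (simp add: orthogonal_commute)
  next
    fix z assume "z \<in> {y \<in> UNIV. \<forall>x\<in>span A. orthogonal x y}"
    then show "z \<in> (\<Inter>a\<in>A. {z. a \<bullet> z = 0})" using span_superset[of A] by (auto simp: orthogonal_def)
  qed
  moreover have "dim {y \<in> UNIV. \<forall>x\<in>span A. orthogonal x y} + dim (span A) = dim (UNIV :: (real \<times> (real ^ 'n)) set)"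
    by (rule dim_subspace_orthogonal_to_vectors) auto
  ultimately show ?thesis by (simp add: rk_def)
qed

section \<open>Sums of subspaces\<close>

lemma subspace_set_sum:
  assumes "finite I" "\<And>i. i \<in> I \<Longrightarrow> tuple_space.subspace (S i)"
  shows "tuple_space.subspace (\<Sum>i\<in>I. S i)"
proof (rule tuple_space.subspaceI)
  show "0 \<in> (\<Sum>i\<in>I. S i)"
    unfolding set_sum_alt[OF assms(1)] mem_Collect_eq
    using assms(2) by (intro exI[of _ "\<lambda>_. 0"]) (auto simp only: sum.neutral_const intro: tuple_space.subspace_0)
next
  fix F G assume "F \<in> (\<Sum>i\<in>I. S i)" "G \<in> (\<Sum>i\<in>I. S i)"
  then obtain f g where "F = sum f I" "\<forall>i\<in>I. f i \<in> S i" "G = sum g I" "\<forall>i\<in>I. g i \<in> S i"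
    unfolding set_sum_alt[OF assms(1)] by blast
  then show "F + G \<in> (\<Sum>i\<in>I. S i)"
    unfolding set_sum_alt[OF assms(1)] mem_Collect_eq
    using assms(2) by (intro exI[of _ "\<lambda>i. f i + g i"])
      (auto simp only: sum.distrib intro: tuple_space.subspace_add)
next
  fix c F assume "F \<in> (\<Sum>i\<in>I. S i)"
  then obtain f where "F = sum f I" "\<forall>i\<in>I. f i \<in> S i"
    unfolding set_sum_alt[OF assms(1)] by blast
  then show "tuple_scale c F \<in> (\<Sum>i\<in>I. S i)"
    unfolding set_sum_alt[OF assms(1)] mem_Collect_eq
    using assms(2) by (intro exI[of _ "\<lambda>i. tuple_scale c (f i)"])
      (auto simp only: tuple_space.scale_sum_right intro: tuple_space.subspace_scale)
qed

lemma set_sum_upper: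
  assumes "finite I" "\<And>i. i \<in> I \<Longrightarrow> 0 \<in> S i" "i \<in> I"
  shows "S i \<subseteq> (\<Sum>i\<in>I. S i :: 'a::comm_monoid_add set)"
proof
  fix x assume "x \<in> S i"
  then show "x \<in> (\<Sum>i\<in>I. S i)"
    unfolding set_sum_alt[OF assms(1)] mem_Collect_eq
    using assms by (intro exI[of _ "\<lambda>j. if j = i then x else 0"]) auto
qed

lemma set_sum_least:
  assumes "finite I" "\<And>i. i \<in> I \<Longrightarrow> S i \<subseteq> V" "tuple_space.subspace V"
  shows "(\<Sum>i\<in>I. S i) \<subseteq> V"
proof
  fix F assume "F \<in> (\<Sum>i\<in>I. S i)"
  then obtain f where f: "F = sum f I" "\<forall>i\<in>I. f i \<in> S i"
    unfolding set_sum_alt[OF assms(1)] by blast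
  show "F \<in> V" unfolding f(1) using f(2) assms(2,3) by (intro tuple_space.subspace_sum) auto
qed

section \<open>Splines on a pure complex\<close>

text \<open>Extension by zero of the restriction to the facets in \<open>K\<close>.\<close>

definition restrict_tuple :: "(real ^ 'n::finite) set set \<Rightarrow> 'n tuple \<Rightarrow> 'n tuple" where
  "restrict_tuple K F = (\<lambda>\<sigma>. if \<sigma> \<in> K then F \<sigma> else 0)"

text \<open>A pure complex of full dimension and an order \<open>r\<close> of smoothness. Below, \<open>T\<close> is the set of interior
  faces of codimension one.\<close>

locale pure_complex =
  fixes P :: "(real ^ 'n::finite) set set" and r :: nat
  assumes complex: "polytopal_complex P" and pure: "pure_full_dim P"
begin

abbreviation "T \<equiv> interior_codim1_faces P"

lemma finite_P: "finite P" using complex by (simp add: polytopal_complex_def)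

lemma finite_facets: "finite (facets P)"
  by (rule finite_subset[OF _ finite_P]) (auto simp: facets_def)

lemma T_dim: "\<tau> \<in> T \<Longrightarrow> aff_dim \<tau> = int CARD('n) - 1"
  by (simp add: interior_codim1_faces_def faces_of_dim_def)

lemma finite_T: "finite T"
  by (rule finite_subset[OF _ finite_P]) (auto simp: interior_codim1_faces_def faces_of_dim_def)

lemma adjacent_in_T:
  assumes "\<sigma> \<in> facets P" "\<sigma>' \<in> facets P" "\<sigma> \<inter> \<sigma>' \<in> faces_of_dim P (int CARD('n) - 1)"
  shows "\<sigma> \<inter> \<sigma>' \<in> T"
proof -
  have "\<sigma> \<noteq> \<sigma>'" using assms pure by (auto simp: pure_full_dim_def faces_of_dim_def)
  then show ?thesis using assms by (auto simp: interior_codim1_faces_def)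
qed

lemma adjacent_face:
  assumes "\<sigma> \<in> facets P" "\<sigma>' \<in> facets P"
  shows "\<sigma> \<inter> \<sigma>' face_of \<sigma>"
  using assms complex by (auto simp: facets_def polytopal_complex_def)

lemma subspace_splines: "tuple_space.subspace (splines P r)"
proof (rule tuple_space.subspaceI)
  fix F G assume F: "F \<in> splines P r" and G: "G \<in> splines P r"
  have "hyperplane_form (\<sigma> \<inter> \<sigma>') ^ (r + 1) dvd (F + G) \<sigma> - (F + G) \<sigma>'"
    if "\<sigma> \<in> facets P" "\<sigma>' \<in> facets P" "\<sigma> \<inter> \<sigma>' \<in> faces_of_dim P (int CARD('n) - 1)" for \<sigma> \<sigma>'
  proof -
    have "(F + G) \<sigma> - (F + G) \<sigma>' = (F \<sigma> - F \<sigma>') + (G \<sigma> - G \<sigma>')" by simp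
    moreover have "hyperplane_form (\<sigma> \<inter> \<sigma>') ^ (r + 1) dvd F \<sigma> - F \<sigma>'"
      "hyperplane_form (\<sigma> \<inter> \<sigma>') ^ (r + 1) dvd G \<sigma> - G \<sigma>'"
      using F G that by (simp_all add: splines_def)
    ultimately show ?thesis by (simp only: dvd_add)
  qed
  moreover have "(F + G) \<sigma> = 0" if "\<sigma> \<notin> facets P" for \<sigma> using F G that by (simp add: splines_def)
  ultimately show "F + G \<in> splines P r" unfolding splines_def by blast
next
  fix c F assume "F \<in> splines P r"
  then show "tuple_scale c F \<in> splines P r"
    unfolding splines_def by (simp add: tuple_scale_def dvd_mult flip: right_diff_distrib)
qed (simp add: splines_def)

lemma pmul_splines: "F \<in> splines P r \<Longrightarrow> pmul p F \<in> splines P r"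
  unfolding splines_def by (simp add: pmul_def dvd_mult flip: right_diff_distrib)

lemma subspace_supported_splines: "tuple_space.subspace (supported_splines P r Q)"
proof -
  have "tuple_space.subspace {F :: 'n tuple. \<forall>\<sigma>\<in>facets P. \<sigma> \<notin> Q \<longrightarrow> F \<sigma> = 0}"
    by (rule tuple_space.subspaceI) (auto simp: tuple_scale_def)
  moreover have "supported_splines P r Q = splines P r \<inter> {F. \<forall>\<sigma>\<in>facets P. \<sigma> \<notin> Q \<longrightarrow> F \<sigma> = 0}"
    by (auto simp: supported_splines_def)
  ultimately show ?thesis using subspace_splines by (simp only: tuple_space.subspace_inter)
qed

lemma finite_components: "finite (components_PW P W)"
proof -
  have "finite (GW_verts P W)" by (rule finite_subset[OF _ finite_facets]) (auto simp: GW_verts_def)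
  then have "finite (GW_verts P W // ((GW_adj P W)\<^sup>* \<inter> GW_verts P W \<times> GW_verts P W))"
    by (intro finite_quotient) auto
  then show ?thesis using finite_facets by (simp add: components_PW_def)
qed

lemma subspace_CW: "tuple_space.subspace (CW P r W)"
  unfolding CW_def by (rule subspace_set_sum[OF finite_components subspace_supported_splines])

lemma supported_subset_CW: "Q \<in> components_PW P W \<Longrightarrow> supported_splines P r Q \<subseteq> CW P r W"
  unfolding CW_def
  by (rule set_sum_upper[OF finite_components]) (auto intro: tuple_space.subspace_0[OF subspace_supported_splines])

lemma CW_subset_splines: "CW P r W \<subseteq> splines P r"
  unfolding CW_def
  by (rule set_sum_least[OF finite_components _ subspace_splines]) (auto simp: supported_splines_def)

lemma CW_pmul: "F \<in> CW P r W \<Longrightarrow> pmul p F \<in> CW P r W"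
proof -
  assume "F \<in> CW P r W"
  then obtain f where f: "F = sum f (components_PW P W)" "\<forall>Q\<in>components_PW P W. f Q \<in> supported_splines P r Q"
    unfolding CW_def set_sum_alt[OF finite_components] by blast
  have "pmul p (sum f X) = (\<Sum>Q\<in>X. pmul p (f Q))" for X
    by (induction X rule: infinite_finite_induct) (simp_all only: sum.infinite sum.empty sum.insert pmul_simps not_False_eq_True)
  moreover have "pmul p (f Q) \<in> supported_splines P r Q" if "Q \<in> components_PW P W" for Q
  proof -
    have "f Q \<in> splines P r" "\<forall>\<sigma>\<in>facets P. \<sigma> \<notin> Q \<longrightarrow> f Q \<sigma> = 0"
      using f(2) that by (auto simp: supported_splines_def)
    then show ?thesis using pmul_splines[of "f Q" p] by (simp add: supported_splines_def pmul_def)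
  qed
  ultimately show ?thesis unfolding f(1) CW_def set_sum_alt[OF finite_components] mem_Collect_eq
    by (intro exI[of _ "\<lambda>Q. pmul p (f Q)"]) simp
qed

lemma finite_cone_lattice_upto: "finite (cone_lattice_upto P k)"
proof -
  have "cone_lattice P = Inter ` Pow (cone_hyperplane ` T)" by (auto simp: cone_lattice_def)
  then have "finite (cone_lattice P)" using finite_T by simp
  then show ?thesis by (simp add: cone_lattice_upto_def)
qed

lemma subspace_LS: "tuple_space.subspace (LS P r k)"
  unfolding LS_def by (rule subspace_set_sum[OF finite_cone_lattice_upto subspace_CW])

lemma LS_subset_splines: "LS P r k \<subseteq> splines P r"
  unfolding LS_def by (rule set_sum_least[OF finite_cone_lattice_upto CW_subset_splines subspace_splines])

lemma LS_pmul: "F \<in> LS P r k \<Longrightarrow> pmul p F \<in> LS P r k"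
proof -
  assume "F \<in> LS P r k"
  then obtain f where f: "F = sum f (cone_lattice_upto P k)" "\<forall>W\<in>cone_lattice_upto P k. f W \<in> CW P r W"
    unfolding LS_def set_sum_alt[OF finite_cone_lattice_upto] by blast
  have "pmul p (sum f X) = (\<Sum>Q\<in>X. pmul p (f Q))" for X
    by (induction X rule: infinite_finite_induct) (simp_all only: sum.infinite sum.empty sum.insert pmul_simps not_False_eq_True)
  then show ?thesis unfolding f(1) LS_def set_sum_alt[OF finite_cone_lattice_upto] mem_Collect_eq
    using f(2) CW_pmul by (intro exI[of _ "\<lambda>W. pmul p (f W)"]) simp
qed

lemma hyperplane_form_T: "\<tau> \<in> T \<Longrightarrow> hyperplane_form \<tau> = affine_form (normal \<tau>)"
  by (rule normal(1)[OF T_dim])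

text \<open>After multiplication by the power for \<open>S\<close>, a spline may be cut off along the faces in \<open>S\<close>.\<close>

lemma restrict_spline:
  assumes F: "F \<in> splines P r" and S: "S \<subseteq> T"
    and sep: "\<And>\<sigma> \<sigma>'. \<lbrakk>\<sigma> \<in> facets P; \<sigma>' \<in> facets P; \<sigma> \<in> K; \<sigma>' \<notin> K; \<sigma> \<inter> \<sigma>' \<in> T\<rbrakk> \<Longrightarrow> \<sigma> \<inter> \<sigma>' \<in> S"
  shows "restrict_tuple K (pmul ((\<Prod>\<tau>\<in>S. affine_form (normal \<tau>)) ^ (r + 1)) F) \<in> splines P r"
proof -
  let ?L = "(\<Prod>\<tau>\<in>S. affine_form (normal \<tau>)) ^ (r + 1)"
  let ?G = "restrict_tuple K (pmul ?L F)"
  have L: "hyperplane_form \<tau> ^ (r + 1) dvd ?L" if "\<tau> \<in> S" for \<tau>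
  proof -
    have "affine_form (normal \<tau>) dvd (\<Prod>\<tau>\<in>S. affine_form (normal \<tau>))"
      using that finite_subset[OF S finite_T] by (intro dvd_prodI)
    then have "affine_form (normal \<tau>) ^ (r + 1) dvd ?L" by (rule dvd_power_same)
    moreover have "\<tau> \<in> T" using that S by blast
    ultimately show ?thesis by (simp only: hyperplane_form_T)
  qed
  have "hyperplane_form (\<sigma> \<inter> \<sigma>') ^ (r + 1) dvd ?G \<sigma> - ?G \<sigma>'"
    if \<sigma>: "\<sigma> \<in> facets P" "\<sigma>' \<in> facets P" "\<sigma> \<inter> \<sigma>' \<in> faces_of_dim P (int CARD('n) - 1)" for \<sigma> \<sigma>'
  proof -
    have T: "\<sigma> \<inter> \<sigma>' \<in> T" "\<sigma>' \<inter> \<sigma> \<in> T" using adjacent_in_T[OF \<sigma>] by (simp_all add: Int_commute)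
    have dvd: "hyperplane_form (\<sigma> \<inter> \<sigma>') ^ (r + 1) dvd F \<sigma> - F \<sigma>'" using F \<sigma> by (simp add: splines_def)
    consider "\<sigma> \<in> K" "\<sigma>' \<in> K" | "\<sigma> \<in> K" "\<sigma>' \<notin> K" | "\<sigma> \<notin> K" "\<sigma>' \<in> K" | "\<sigma> \<notin> K" "\<sigma>' \<notin> K" by blast
    then show ?thesis
    proof cases
      case 1
      then have "?G \<sigma> - ?G \<sigma>' = ?L * (F \<sigma> - F \<sigma>')" by (simp add: restrict_tuple_def pmul_def right_diff_distrib)
      then show ?thesis using dvd by (simp only: dvd_mult)
    next
      case 2
      then have "?G \<sigma> - ?G \<sigma>' = ?L * F \<sigma>" by (simp add: restrict_tuple_def pmul_def)
      moreover have "\<sigma> \<inter> \<sigma>' \<in> S" using sep \<sigma>(1,2) 2 T(1) by blast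
      ultimately show ?thesis using L by (simp only: dvd_mult2)
    next
      case 3
      then have "?G \<sigma> - ?G \<sigma>' = ?L * (- F \<sigma>')" by (simp add: restrict_tuple_def pmul_def)
      moreover have "\<sigma> \<inter> \<sigma>' \<in> S" using sep[of \<sigma>' \<sigma>] \<sigma>(1,2) 3 T(2) by (simp add: Int_commute)
      ultimately show ?thesis using L by (simp only: dvd_mult2)
    qed (simp add: restrict_tuple_def)
  qed
  moreover have "?G \<sigma> = 0" if "\<sigma> \<notin> facets P" for \<sigma>
    using F that by (simp add: restrict_tuple_def pmul_def splines_def)
  ultimately show ?thesis unfolding splines_def by blast
qed

lemma facet_in_generated: "\<sigma> \<in> facets P \<Longrightarrow> \<sigma> \<in> K \<Longrightarrow> \<sigma> \<in> generated_subcomplex K"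
  using complex by (auto simp: generated_subcomplex_def facets_def polytopal_complex_def polytope_imp_convex intro!: bexI[of _ \<sigma>] face_of_refl)

lemma restrict_supported:
  "restrict_tuple K G \<in> splines P r \<Longrightarrow> restrict_tuple K G \<in> supported_splines P r (generated_subcomplex K)"
  using facet_in_generated by (auto simp: supported_splines_def restrict_tuple_def)

lemma UNIV_in_lattice: "UNIV \<in> cone_lattice_upto P k"
proof -
  have "(UNIV :: (real \<times> (real ^ 'n)) set) \<in> cone_lattice P"
    unfolding cone_lattice_def mem_Collect_eq by (rule exI[of _ "{}"]) simp
  moreover have "rk (UNIV :: (real \<times> (real ^ 'n)) set) \<le> k" by (simp add: rk_def)
  ultimately show ?thesis by (simp add: cone_lattice_upto_def)
qed

lemma lattice_of_complement:
  assumes S: "S \<subseteq> T" and k: "dim (normal ` (T - S)) \<le> k"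
  shows "\<Inter>(cone_hyperplane ` (T - S)) \<in> cone_lattice_upto P k"
proof -
  have "\<Inter>(cone_hyperplane ` (T - S)) = (\<Inter>a\<in>normal ` (T - S). {z. a \<bullet> z = 0})"
    using cone_hyperplane_eq[OF T_dim] by auto
  then have "rk (\<Inter>(cone_hyperplane ` (T - S))) \<le> k" using k by (simp only: rk_Inter_hyperplanes)
  then show ?thesis unfolding cone_lattice_upto_def cone_lattice_def by blast
qed

lemma sum_tuple_apply: "(\<Sum>i\<in>I. f i) \<sigma> = (\<Sum>i\<in>I. (f i :: 'n tuple) \<sigma>)"
  by (induction I rule: infinite_finite_induct) auto

text \<open>The tuples all of whose monomials lie in \<open>A\<close>. This covers both the homogeneous tuples of degree
  \<open>d\<close> and the tuples of degree at most \<open>d\<close>.\<close>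

definition with_keys :: "('n \<Rightarrow>\<^sub>0 nat) set \<Rightarrow> 'n tuple set" where
  "with_keys A = {F. \<forall>\<sigma>\<in>facets P. Poly_Mapping.keys (F \<sigma>) \<subseteq> A}"

lemma subspace_with_keys: "tuple_space.subspace (with_keys A)"
proof (rule tuple_space.subspaceI)
  show "0 \<in> with_keys A" by (simp add: with_keys_def)
next
  fix F G assume "F \<in> with_keys A" "G \<in> with_keys A"
  then have "Poly_Mapping.keys (F \<sigma> + G \<sigma>) \<subseteq> A" if "\<sigma> \<in> facets P" for \<sigma>
    using that keys_add[of "F \<sigma>" "G \<sigma>"] unfolding with_keys_def by blast
  then show "F + G \<in> with_keys A" by (simp add: with_keys_def)
next
  fix c F assume "F \<in> with_keys A"
  then have "Poly_Mapping.keys (Poly_Mapping.single 0 c * F \<sigma>) \<subseteq> A" if "\<sigma> \<in> facets P" for \<sigma>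
    using that keys_monomial_mult[of 0 c "F \<sigma>"] unfolding with_keys_def by auto
  then show "tuple_scale c F \<in> with_keys A" by (simp add: with_keys_def tuple_scale_def)
qed

text \<open>The sums of lattice-supported splines all of which have their monomials in \<open>A\<close>.\<close>

definition lattice_sum :: "('n \<Rightarrow>\<^sub>0 nat) set \<Rightarrow> nat \<Rightarrow> 'n tuple set" where
  "lattice_sum A k = (\<Sum>W\<in>cone_lattice_upto P k. CW P r W \<inter> with_keys A)"

lemma subspace_lattice_sum: "tuple_space.subspace (lattice_sum A k)"
  unfolding lattice_sum_def
  by (rule subspace_set_sum[OF finite_cone_lattice_upto tuple_space.subspace_inter[OF subspace_CW subspace_with_keys]])

lemma CW_subset_LS: "W \<in> cone_lattice_upto P k \<Longrightarrow> CW P r W \<subseteq> LS P r k"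
  unfolding LS_def
  by (rule set_sum_upper[OF finite_cone_lattice_upto tuple_space.subspace_0[OF subspace_CW]])

lemma lattice_sum_subset_LS: "lattice_sum A k \<subseteq> LS P r k \<inter> with_keys A"
  unfolding lattice_sum_def
  by (rule set_sum_least[OF finite_cone_lattice_upto _ tuple_space.subspace_inter[OF subspace_LS subspace_with_keys]])
     (use CW_subset_LS in blast)

text \<open>Let \<open>W\<close> be cut out by the hyperplanes of the faces outside \<open>S\<close>, and multiply a spline by the power
  of the product of the forms of the faces in \<open>S\<close>. A face between different components of \<open>P\<^sub>W\<close>, or
  at a facet outside \<open>P\<^sub>W\<close>, belongs to \<open>S\<close>. So the product is the sum of its pieces on the
  components and on the single facets outside \<open>P\<^sub>W\<close>, and these pieces are splines.\<close>

lemma product_in_lattice_sum: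
  assumes F: "F \<in> splines P r" and S: "S \<subseteq> T" and k: "dim (normal ` (T - S)) \<le> k"
    and A: "pmul ((\<Prod>\<tau>\<in>S. affine_form (normal \<tau>)) ^ (r + 1)) F \<in> with_keys A"
  shows "pmul ((\<Prod>\<tau>\<in>S. affine_form (normal \<tau>)) ^ (r + 1)) F \<in> lattice_sum A k"
    (is "?G \<in> ?N")
proof -
  have sub: "tuple_space.subspace (CW P r W \<inter> with_keys A)" for W
    by (rule tuple_space.subspace_inter[OF subspace_CW subspace_with_keys])
  have subN: "tuple_space.subspace ?N" by (rule subspace_lattice_sum)
  have upper: "CW P r W \<inter> with_keys A \<subseteq> ?N" if "W \<in> cone_lattice_upto P k" for W
    unfolding lattice_sum_def
    by (rule set_sum_upper[OF finite_cone_lattice_upto tuple_space.subspace_0[OF sub] that])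
  have piece: "restrict_tuple K ?G \<in> ?N"
    if W: "W \<in> cone_lattice_upto P k" and K: "generated_subcomplex K \<in> components_PW P W"
      and sep: "\<And>\<sigma> \<sigma>'. \<lbrakk>\<sigma> \<in> facets P; \<sigma>' \<in> facets P; \<sigma> \<in> K; \<sigma>' \<notin> K; \<sigma> \<inter> \<sigma>' \<in> T\<rbrakk> \<Longrightarrow> \<sigma> \<inter> \<sigma>' \<in> S" for W K
  proof -
    have "restrict_tuple K ?G \<in> CW P r W"
      using supported_subset_CW[OF K] restrict_supported[OF restrict_spline[OF F S sep]] by blast
    moreover have "restrict_tuple K ?G \<in> with_keys A"
      using A by (simp add: with_keys_def restrict_tuple_def)
    ultimately show ?thesis using upper[OF W] by blast
  qed
  define W where "W = \<Inter>(cone_hyperplane ` (T - S))"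
  have W: "W \<in> cone_lattice_upto P k" unfolding W_def by (rule lattice_of_complement[OF S k])
  have sub_W: "W \<subseteq> cone_hyperplane \<tau>" if "\<tau> \<in> T" "\<tau> \<notin> S" for \<tau> using that by (auto simp: W_def)
  \<comment> \<open>For \<open>W = UNIV\<close> all facets are treated singly.\<close>
  define V where "V = (if W = UNIV then {} else GW_verts P W)"
  define R where "R = (GW_adj P W)\<^sup>* \<inter> GW_verts P W \<times> GW_verts P W"
  have "sym (GW_adj P W)" by (auto simp: sym_def GW_adj_def Int_commute)
  then have sym: "sym ((GW_adj P W)\<^sup>*)" by (rule sym_rtrancl)
  have equiv: "equiv (GW_verts P W) R"
  proof (rule equivI)
    show "R \<subseteq> GW_verts P W \<times> GW_verts P W" by (simp add: R_def)
    show "refl_on (GW_verts P W) R" by (simp add: refl_on_def R_def)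
    show "sym R" using symD[OF sym] by (intro symI) (simp add: R_def)
    show "trans R" by (intro transI) (auto simp: R_def)
  qed
  define Q where "Q = (if W = UNIV then {} else GW_verts P W // R)"
  have finQ: "finite Q"
  proof -
    have "finite (GW_verts P W)" by (rule finite_subset[OF _ finite_facets]) (auto simp: GW_verts_def)
    then show ?thesis unfolding Q_def R_def by (auto intro: finite_quotient)
  qed
  have comp: "restrict_tuple K ?G \<in> ?N" if K: "K \<in> Q" for K
  proof (rule piece[OF W])
    have ne: "W \<noteq> UNIV" and KQ: "K \<in> GW_verts P W // R" using K by (auto simp: Q_def split: if_splits)
    show "generated_subcomplex K \<in> components_PW P W"
      using ne KQ by (auto simp: components_PW_def R_def)
    fix \<sigma> \<sigma>' assume \<sigma>: "\<sigma> \<in> facets P" "\<sigma>' \<in> facets P" "\<sigma> \<in> K" "\<sigma>' \<notin> K" "\<sigma> \<inter> \<sigma>' \<in> T"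
    show "\<sigma> \<inter> \<sigma>' \<in> S"
    proof (rule ccontr)
      assume "\<sigma> \<inter> \<sigma>' \<notin> S"
      then have Wt: "W \<subseteq> cone_hyperplane (\<sigma> \<inter> \<sigma>')" using sub_W \<sigma>(5) by blast
      have "\<sigma> \<inter> \<sigma>' face_of \<sigma>" "\<sigma> \<inter> \<sigma>' face_of \<sigma>'"
        using adjacent_face[OF \<sigma>(1,2)] adjacent_face[OF \<sigma>(2,1)] by (simp_all add: Int_commute)
      then have "\<sigma> \<in> GW_verts P W" "\<sigma>' \<in> GW_verts P W"
        using \<sigma>(1,2,5) Wt by (auto simp: GW_verts_def)
      moreover have "\<sigma> \<inter> \<sigma>' \<in> faces_of_dim P (int CARD('n) - 1)"
        using \<sigma>(5) by (simp add: interior_codim1_faces_def)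
      ultimately have "(\<sigma>, \<sigma>') \<in> R" using Wt by (auto simp: R_def GW_adj_def)
      then have "\<sigma>' \<in> K" using KQ \<sigma>(3) equiv in_quotient_imp_closed by metis
      then show False using \<sigma>(4) by blast
    qed
  qed
  have single: "restrict_tuple {\<sigma>} ?G \<in> ?N" if \<sigma>: "\<sigma> \<in> facets P - V" for \<sigma>
  proof (rule piece[OF UNIV_in_lattice])
    show "generated_subcomplex {\<sigma>} \<in> components_PW P UNIV" using \<sigma> by (auto simp: components_PW_def)
    fix \<sigma>1 \<sigma>' assume s: "\<sigma>1 \<in> facets P" "\<sigma>' \<in> facets P" "\<sigma>1 \<in> {\<sigma>}" "\<sigma>' \<notin> {\<sigma>}" "\<sigma>1 \<inter> \<sigma>' \<in> T"
    show "\<sigma>1 \<inter> \<sigma>' \<in> S"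
    proof (rule ccontr)
      assume nS: "\<sigma>1 \<inter> \<sigma>' \<notin> S"
      then have Wt: "W \<subseteq> cone_hyperplane (\<sigma>1 \<inter> \<sigma>')" using sub_W s(5) by blast
      then have "\<sigma> \<in> GW_verts P W" using s adjacent_face[OF s(1,2)] by (auto simp: GW_verts_def)
      then have "W = UNIV" using \<sigma> by (auto simp: V_def split: if_splits)
      \<comment> \<open>This is impossible, since the cone over a hyperplane is not the whole space.\<close>
      then have "cone_hyperplane (\<sigma>1 \<inter> \<sigma>') = UNIV" using Wt by auto
      then have "normal (\<sigma>1 \<inter> \<sigma>') = 0"
        unfolding cone_hyperplane_eq[OF T_dim[OF s(5)]]
        using inner_eq_zero_iff[of "normal (\<sigma>1 \<inter> \<sigma>')"] by blast
      then have "affine hull (\<sigma>1 \<inter> \<sigma>') = UNIV" using normal(2)[OF T_dim[OF s(5)]] by simp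
      then have "aff_dim (\<sigma>1 \<inter> \<sigma>') = int CARD('n)" by (metis aff_dim_affine_hull aff_dim_UNIV DIM_cart DIM_real mult_1_right)
      then show False using T_dim[OF s(5)] by simp
    qed
  qed
  have part: "(\<Sum>K\<in>Q. restrict_tuple K ?G \<sigma>) = (if \<sigma> \<in> V then ?G \<sigma> else 0)" for \<sigma>
  proof (cases "\<sigma> \<in> V")
    case True
    then have ne: "W \<noteq> UNIV" and v: "\<sigma> \<in> GW_verts P W" by (auto simp: V_def split: if_splits)
    have K: "R `` {\<sigma>} \<in> Q" "\<sigma> \<in> R `` {\<sigma>}"
      using ne v equiv_class_self[OF equiv v] by (auto simp: Q_def intro: quotientI)
    have "restrict_tuple K ?G \<sigma> = 0" if "K \<in> Q - {R `` {\<sigma>}}" for K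
    proof -
      have "\<sigma> \<notin> K"
        using that K ne quotient_disj[OF equiv, of K "R `` {\<sigma>}"] by (auto simp: Q_def)
      then show ?thesis by (simp add: restrict_tuple_def)
    qed
    then have "(\<Sum>K\<in>Q. restrict_tuple K ?G \<sigma>) = restrict_tuple (R `` {\<sigma>}) ?G \<sigma>"
      using finQ K(1) by (subst sum.remove[of _ "R `` {\<sigma>}"]) (auto intro: sum.neutral)
    then show ?thesis using True K(2) by (simp add: restrict_tuple_def)
  next
    case False
    have "\<sigma> \<notin> K" if "K \<in> Q" for K
      using that False in_quotient_imp_subset[OF equiv, of K] by (auto simp: Q_def V_def split: if_splits)
    then show ?thesis using False by (auto simp: restrict_tuple_def intro: sum.neutral)
  qed
  have "?G \<sigma> = ((\<Sum>K\<in>Q. restrict_tuple K ?G) + (\<Sum>\<rho>\<in>facets P - V. restrict_tuple {\<rho>} ?G)) \<sigma>" for \<sigma>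
  proof -
    have "(\<Sum>\<rho>\<in>facets P - V. restrict_tuple {\<rho>} ?G \<sigma>) = (\<Sum>\<rho>\<in>facets P - V. if \<rho> = \<sigma> then ?G \<sigma> else 0)"
      by (rule sum.cong) (auto simp: restrict_tuple_def)
    also have "\<dots> = (if \<sigma> \<in> facets P - V then ?G \<sigma> else 0)" using finite_facets by simp
    finally have "(\<Sum>\<rho>\<in>facets P - V. restrict_tuple {\<rho>} ?G \<sigma>) = (if \<sigma> \<in> facets P - V then ?G \<sigma> else 0)" .
    note rest = this
    have zero: "?G \<sigma> = 0" if "\<sigma> \<notin> facets P" using F that by (simp add: splines_def pmul_def)
    have "?G \<sigma> = (if \<sigma> \<in> V then ?G \<sigma> else 0) + (if \<sigma> \<in> facets P - V then ?G \<sigma> else 0)"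
    proof (cases "\<sigma> \<in> facets P")
      case False
      show ?thesis unfolding zero[OF False] by simp
    qed simp
    then show ?thesis by (simp only: plus_fun_apply sum_tuple_apply part rest)
  qed
  then have "?G = (\<Sum>K\<in>Q. restrict_tuple K ?G) + (\<Sum>\<rho>\<in>facets P - V. restrict_tuple {\<rho>} ?G)" by (rule ext)
  moreover have "\<dots> \<in> ?N"
    using comp single subN by (intro tuple_space.subspace_add tuple_space.subspace_sum)
  ultimately show ?thesis by (simp only:)
qed

section \<open>Comparison with lattice-supported splines\<close>

lemma graded_part_eq: "graded_part P M d = M \<inter> with_keys {m. mon_degree m = d}"
  by (auto simp: graded_part_def with_keys_def homogeneous_def)

lemma splines_upto_eq: "splines_upto P r d = splines P r \<inter> with_keys {m. mon_degree m \<le> d}"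
  by (auto simp: splines_upto_def with_keys_def total_degree_le_iff)

lemma CW_upto_eq: "CW_upto P r W d = CW P r W \<inter> with_keys {m. mon_degree m \<le> d}"
  using CW_subset_splines by (auto simp: CW_upto_def splines_upto_eq)

lemma splines_off_facets: "F \<in> splines P r \<Longrightarrow> \<sigma> \<notin> facets P \<Longrightarrow> F \<sigma> = 0"
  by (simp add: splines_def)

lemma coef_nonzero_facet: "F \<in> splines P r \<Longrightarrow> coef F a \<noteq> 0 \<Longrightarrow> fst a \<in> facets P"
  using splines_off_facets[of F "fst a"] by (cases "fst a \<in> facets P") (simp_all add: coef_def)

lemma obtain_key:
  obtains \<kappa> :: "(real ^ 'n) set \<times> ('n \<Rightarrow>\<^sub>0 nat) \<Rightarrow> nat" where "monomial_key (facets P) \<kappa>"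
proof -
  obtain \<kappa> :: "(real ^ 'n) set \<times> ('n \<Rightarrow>\<^sub>0 nat) \<Rightarrow> nat" where \<kappa>: "inj_on \<kappa> (facets P \<times> UNIV)"
    "\<forall>\<sigma>\<in>facets P. \<forall>\<sigma>'\<in>facets P. \<forall>m m' u. \<kappa> (\<sigma>, m) \<le> \<kappa> (\<sigma>', m') \<longrightarrow> \<kappa> (\<sigma>, m + u) \<le> \<kappa> (\<sigma>', m' + u)"
    using exists_monomial_key[OF finite_facets] by blast
  have "monomial_key (facets P) \<kappa>"
    by unfold_locales (use finite_facets \<kappa> in blast)+
  then show thesis by (rule that)
qed

lemma finite_spanning_set_of_splines:
  assumes "M \<subseteq> splines P r" "M \<subseteq> with_keys {m. mon_degree m \<le> d}"
  shows "\<exists>G. finite G \<and> G \<subseteq> M \<and> M \<subseteq> tuple_space.span G"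
proof (rule finite_spanning_set)
  show "finite (facets P \<times> {m :: 'n \<Rightarrow>\<^sub>0 nat. mon_degree m \<le> d})"
    by (intro finite_cartesian_product finite_facets finite_mon_degree)
  fix F a assume F: "F \<in> M" and a: "a \<notin> facets P \<times> {m :: 'n \<Rightarrow>\<^sub>0 nat. mon_degree m \<le> d}"
  show "coef F a = 0"
  proof (rule ccontr)
    assume nz: "coef F a \<noteq> 0"
    then have k: "snd a \<in> Poly_Mapping.keys (F (fst a))" by (simp add: coef_def in_keys_iff)
    have "fst a \<in> facets P" using F assms(1) nz coef_nonzero_facet by blast
    moreover from this have "mon_degree (snd a) \<le> d" using F assms(2) k unfolding with_keys_def by blast
    ultimately show False using a by (cases a) auto
  qed
qed

text \<open>The graded and the filtered case in one statement: \<open>A d\<close> contains the monomials of degree \<open>d\<close>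
  or of degree at most \<open>d\<close>, and \<open>E\<close> the coefficient vectors of the forms that map index \<open>d\<close> to
  \<open>d + 1\<close>. The constant form 1 belongs to them only in the filtered case.\<close>

theorem growth_modulo_lattice_sums:
  fixes A :: "nat \<Rightarrow> ('n \<Rightarrow>\<^sub>0 nat) set" and E :: "(real \<times> (real ^ 'n)) set"
  assumes A_degree: "\<And>d. A d \<subseteq> {m. mon_degree m \<le> d}"
    and A_step: "\<And>d. A (Suc d) \<subseteq> {m. mon_degree m = Suc d} \<union> (if (1, 0) \<in> E then A d else {})"
    and E_sub: "subspace E"
    and E_mult: "\<And>v d p. \<lbrakk>v \<in> E; Poly_Mapping.keys p \<subseteq> A d\<rbrakk> \<Longrightarrow> Poly_Mapping.keys (affine_form v * p) \<subseteq> A (Suc d)"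
    and E_axis: "\<And>i. (0, axis i 1) \<in> E"
    and normal_E: "normal ` T \<subseteq> E"
  shows "\<exists>c d0. \<forall>d\<ge>d0. \<exists>B. finite B \<and> card B \<le> c * growth (dim E - Suc k) d \<and>
    splines P r \<inter> with_keys (A d) \<subseteq>
      tuple_space.span (B \<union> lattice_sum (A d) k)"
proof -
  define M where "M d = splines P r \<inter> with_keys (A d)" for d
  have M_sub: "tuple_space.subspace (M d)" for d
    unfolding M_def by (rule tuple_space.subspace_inter[OF subspace_splines subspace_with_keys])
  have M_mult: "pmul (affine_form v) F \<in> M (Suc d)" if "v \<in> E" "F \<in> M d" for v F d
  proof -
    have "Poly_Mapping.keys (affine_form v * F \<sigma>) \<subseteq> A (Suc d)" if "\<sigma> \<in> facets P" for \<sigma>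
      using \<open>v \<in> E\<close> \<open>F \<in> M d\<close> that by (intro E_mult) (auto simp: M_def with_keys_def)
    moreover have "pmul (affine_form v) F \<in> splines P r" using \<open>F \<in> M d\<close> by (simp add: M_def pmul_splines)
    ultimately show ?thesis by (simp add: M_def with_keys_def) (simp add: pmul_def)
  qed
  obtain \<kappa> where "monomial_key (facets P) \<kappa>" by (rule obtain_key)
  then interpret key: monomial_key "facets P" \<kappa> .
  have supp: "key.supported F" if "F \<in> M d" for F d
    using that splines_off_facets by (auto simp: M_def key.supported_def)
  have X: "pmul (Poly_Mapping.single (Poly_Mapping.single i 1) 1) F \<in> M (Suc d)" if "F \<in> M d" for d F i
    using M_mult[OF E_axis that] by (simp only: affine_form_axis)
  have "\<exists>D. \<forall>d\<ge>D. \<forall>F\<in>M (Suc d). \<exists>G\<in>tuple_space.span (\<Union>i. pmul (Poly_Mapping.single (Poly_Mapping.single i 1) 1) ` M d).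
      degree_support (Suc d) (F - G) = {}"
    by (rule key.eventually_generated) (fact M_sub supp X)+
  then obtain D where D: "\<forall>d\<ge>D. \<forall>F\<in>M (Suc d). \<exists>G\<in>tuple_space.span (\<Union>i. pmul (Poly_Mapping.single (Poly_Mapping.single i 1) 1) ` M d).
      degree_support (Suc d) (F - G) = {}" ..
  have gen: "M (Suc d) \<subseteq> tuple_space.span {pmul (affine_form v) F | v F. v \<in> E \<and> F \<in> M d}" (is "_ \<subseteq> tuple_space.span ?S")
    if d: "D \<le> d" for d
  proof
    fix F assume F: "F \<in> M (Suc d)"
    let ?U = "\<Union>i. pmul (Poly_Mapping.single (Poly_Mapping.single i 1) 1) ` M d"
    obtain G where G: "G \<in> tuple_space.span ?U" "degree_support (Suc d) (F - G) = {}" using D d F by blast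
    have "pmul (Poly_Mapping.single (Poly_Mapping.single i 1) 1) F' \<in> ?S" if "F' \<in> M d" for i F'
      using that E_axis[of i] affine_form_axis[of i] unfolding mem_Collect_eq by metis
    then have "?U \<subseteq> ?S" by blast
    then have GS: "G \<in> tuple_space.span ?S" using G(1) tuple_space.span_mono by blast
    have "tuple_space.span ?U \<subseteq> M (Suc d)"
      by (rule tuple_space.span_minimal[OF _ M_sub]) (use X in blast)
    then have R: "F - G \<in> M (Suc d)" using F G(1) tuple_space.subspace_diff[OF M_sub] by blast
    \<comment> \<open>The remainder has lower degree. In the filtered case it lies in \<open>M d\<close>, on which the constant form 1 acts; in the graded case it is zero.\<close>
    have keys: "Poly_Mapping.keys ((F - G) \<sigma>) \<subseteq> (if (1, 0) \<in> E then A d else {})" if "\<sigma> \<in> facets P" for \<sigma>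
    proof
      fix m assume m: "m \<in> Poly_Mapping.keys ((F - G) \<sigma>)"
      then have "coef (F - G) (\<sigma>, m) \<noteq> 0" by (simp only: coef_def in_keys_iff fst_conv snd_conv not_False_eq_True)
      then have "mon_degree m \<noteq> Suc d" using G(2) unfolding degree_support_def by auto
      moreover have "m \<in> A (Suc d)" using R m that by (auto simp only: M_def with_keys_def)
      ultimately show "m \<in> (if (1, 0) \<in> E then A d else {})" using A_step[of d] by blast
    qed
    have "F - G \<in> tuple_space.span ?S"
    proof (cases "(1, 0) \<in> E")
      case True
      then have "F - G \<in> M d" using R keys unfolding M_def with_keys_def by simp
      then have "pmul (affine_form (1, 0)) (F - G) \<in> ?S" using True by blast
      then show ?thesis unfolding affine_form_one pmul_simps by (rule tuple_space.span_base)
    next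
      case False
      have "(F - G) \<sigma> = 0" for \<sigma>
      proof (cases "\<sigma> \<in> facets P")
        case True
        then show ?thesis using keys[OF True] False by (simp only: if_False subset_empty keys_eq_empty)
      next
        case False
        then show ?thesis using R splines_off_facets[OF _ False, of "F - G"] unfolding M_def by blast
      qed
      then have "F - G = 0" by (simp only: fun_eq_iff zero_fun_def simp_thms)
      then show ?thesis by (simp only: tuple_space.span_zero)
    qed
    then have "F - G + G \<in> tuple_space.span ?S" using GS by (rule tuple_space.span_add)
    then show "F \<in> tuple_space.span ?S" by (simp only: diff_add_cancel)
  qed
  have "\<exists>G. finite G \<and> G \<subseteq> M D \<and> M D \<subseteq> tuple_space.span G"
    by (rule finite_spanning_set_of_splines[where d = D])
       (use A_degree[of D] in \<open>auto simp: M_def with_keys_def\<close>)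
  then obtain G where G: "finite G" "G \<subseteq> M D" "M D \<subseteq> tuple_space.span G" by blast
  interpret fil: finitely_generated_filtration M E D G
    by unfold_locales (fact M_sub E_sub M_mult gen G)+
  define N where "N d = lattice_sum (A d) k" for d
  have "fil.growth_bounded N (dim E - Suc k)"
  proof (rule fil.growth_bounded_of_products[where s = "r + 1"])
    show "finite T" by (rule finite_T)
    show "normal \<tau> \<in> E" if "\<tau> \<in> T" for \<tau> using that normal_E by blast
    fix S d F assume S: "S \<subseteq> T" and k: "dim (normal ` (T - S)) \<le> k" and F: "F \<in> M d"
    have "pmul ((\<Prod>\<tau>\<in>S. affine_form (normal \<tau>)) ^ (r + 1)) F \<in> M (d + (r + 1) * card S)"
      using S normal_E F finite_T by (intro fil.mult_product_power) (auto intro: finite_subset)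
    then show "pmul ((\<Prod>\<tau>\<in>S. affine_form (normal \<tau>)) ^ (r + 1)) F \<in> N (d + (r + 1) * card S)"
      using F unfolding N_def M_def by (intro product_in_lattice_sum[OF _ S k]) auto
  qed
  then show ?thesis unfolding fil.growth_bounded_def M_def N_def .
qed

lemma dim_graded_part:
  assumes C: "tuple_space.subspace C" "C \<subseteq> splines P r"
  shows "\<exists>B. finite B \<and> tuple_space.independent B \<and> tuple_space.span B = graded_part P C d \<and>
    card B = tuple_space.dim (graded_part P C d)"
proof -
  have sub: "tuple_space.subspace (graded_part P C d)"
    unfolding graded_part_eq by (rule tuple_space.subspace_inter[OF C(1) subspace_with_keys])
  have "graded_part P C d \<subseteq> splines P r" "graded_part P C d \<subseteq> with_keys {m. mon_degree m \<le> d}"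
    using C(2) by (auto simp: graded_part_eq with_keys_def)
  from finite_spanning_set_of_splines[OF this]
  obtain G where G: "finite G" "G \<subseteq> graded_part P C d" "graded_part P C d \<subseteq> tuple_space.span G"
    by (elim exE conjE)
  obtain B where B: "B \<subseteq> graded_part P C d" "tuple_space.independent B" "graded_part P C d \<subseteq> tuple_space.span B"
    "card B = tuple_space.dim (graded_part P C d)" by (rule tuple_space.basis_exists)
  moreover have "finite B" using tuple_space.independent_span_bound[OF G(1) B(2)] B(1) G(3) by blast
  moreover have "tuple_space.span B = graded_part P C d"
    using B(1,3) tuple_space.span_minimal[OF B(1) sub] by blast
  ultimately show ?thesis by blast
qed

lemma hilbert_function_submodule:
  assumes C: "tuple_space.subspace C" "C \<subseteq> splines P r" "\<And>F p. F \<in> C \<Longrightarrow> pmul p F \<in> C"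
  shows "eventually_polynomial (\<lambda>d. tuple_space.dim (graded_part P C d))"
proof -
  obtain \<kappa> where "monomial_key (facets P) \<kappa>" by (rule obtain_key)
  then interpret key: monomial_key "facets P" \<kappa> .
  show ?thesis
  proof (rule key.hilbert_function_eventually_polynomial)
    show "tuple_space.subspace (graded_part P C d)" for d
      unfolding graded_part_eq by (rule tuple_space.subspace_inter[OF C(1) subspace_with_keys])
    show "key.supported F" if "F \<in> graded_part P C d" for d F
      using that C(2) splines_off_facets by (auto simp: key.supported_def graded_part_def)
    show "pmul (Poly_Mapping.single (Poly_Mapping.single i 1) 1) F \<in> graded_part P C (Suc d)"
      if F: "F \<in> graded_part P C d" for d F i
    proof -
      have "Poly_Mapping.keys (Poly_Mapping.single (Poly_Mapping.single i 1) 1 * F \<sigma>) \<subseteq> {m. mon_degree m = Suc d}"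
        if "\<sigma> \<in> facets P" for \<sigma>
        using keys_monomial_mult[of "Poly_Mapping.single i 1" 1 "F \<sigma>"] F that
        by (force simp: graded_part_eq with_keys_def mon_degree_add)
      then show ?thesis using F C(3) by (simp add: graded_part_eq with_keys_def) (simp add: pmul_def)
    qed
    show "F = 0" if F: "F \<in> graded_part P C d" and e: "degree_support d F = {}" for d F
    proof (rule tuple_eqI)
      fix a
      show "coef F a = coef 0 a"
      proof (rule ccontr)
        assume "coef F a \<noteq> coef 0 a"
        then have nz: "coef F a \<noteq> 0" by (simp only: coef_simps not_False_eq_True)
        then have s: "snd a \<in> Poly_Mapping.keys (F (fst a))" by (simp add: coef_def in_keys_iff)
        moreover have "F \<in> splines P r" using F C(2) by (auto simp: graded_part_eq)
        ultimately have "fst a \<in> facets P" using nz coef_nonzero_facet by blast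
        then have "mon_degree (snd a) = d" using F s by (auto simp: graded_part_eq with_keys_def)
        then have "a \<in> degree_support d F" using nz by (simp add: degree_support_def)
        then show False using e by blast
      qed
    qed
  qed
qed

lemma LS_upto_eq: "LS_upto P r k d = lattice_sum {m. mon_degree m \<le> d} k"
  unfolding LS_upto_def lattice_sum_def CW_upto_eq ..

text \<open>In the central case all forms are linear, so their coefficient vectors lie in the \<open>n\<close>-dimensional
  space \<open>{0} \<times> UNIV\<close>.\<close>

lemma graded_growth:
  assumes "central_at 0 P"
  shows "\<exists>c d0. \<forall>d\<ge>d0. \<exists>B. finite B \<and> card B \<le> c * growth (CARD('n) - Suc k) d \<and>
    graded_part P (splines P r) d \<subseteq> tuple_space.span (B \<union> graded_part P (LS P r k) d)"
proof -
  let ?E = "{0::real} \<times> (UNIV :: (real ^ 'n) set)"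
  let ?A = "\<lambda>d. {m :: 'n \<Rightarrow>\<^sub>0 nat. mon_degree m = d}"
  have E: "subspace ?E" by (intro subspace_Times) auto
  have dim: "dim ?E = CARD('n)" by (subst dim_Times) auto
  have mult: "Poly_Mapping.keys (affine_form v * p) \<subseteq> ?A (Suc d)"
    if v: "v \<in> ?E" and p: "Poly_Mapping.keys p \<subseteq> ?A d" for v d p
  proof (rule keys_affine_form_mult[OF _ p])
    fix u m assume u: "u \<in> Poly_Mapping.keys (affine_form v)" and m: "m \<in> ?A d"
    have "fst v = 0" using v by auto
    then have "mon_degree u = 1" using u keys_affine_form_mon_degree(2) by blast
    then show "u + m \<in> ?A (Suc d)" using m by (simp add: mon_degree_add)
  qed
  have "normal \<tau> \<in> ?E" if \<tau>: "\<tau> \<in> T" for \<tau>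
  proof -
    have "0 \<in> affine hull \<tau>" using assms \<tau> by (auto simp: central_at_def hyperplane_arrangement_def)
    then have "normal \<tau> \<bullet> (1, 0) = 0" unfolding normal(2)[OF T_dim[OF \<tau>]] by simp
    then have "fst (normal \<tau>) = 0" by (simp add: inner_prod_def)
    then show ?thesis by (simp add: mem_Times_iff)
  qed
  then have normal_E: "normal ` T \<subseteq> ?E" by blast
  have "\<exists>c d0. \<forall>d\<ge>d0. \<exists>B. finite B \<and> card B \<le> c * growth (dim ?E - Suc k) d \<and>
    splines P r \<inter> with_keys (?A d) \<subseteq>
      tuple_space.span (B \<union> lattice_sum (?A d) k)"
    by (intro growth_modulo_lattice_sums[where E = ?E and A = ?A] E mult normal_E) auto
  then obtain c d0 where *: "\<And>d. d0 \<le> d \<Longrightarrow> \<exists>B. finite B \<and> card B \<le> c * growth (CARD('n) - Suc k) d \<and>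
    graded_part P (splines P r) d \<subseteq> tuple_space.span (B \<union> lattice_sum (?A d) k)"
    unfolding dim graded_part_eq by blast
  have "tuple_space.span (B \<union> lattice_sum (?A d) k) \<subseteq> tuple_space.span (B \<union> graded_part P (LS P r k) d)" for B d
    using lattice_sum_subset_LS[of "?A d" k] unfolding graded_part_eq
    by (intro tuple_space.span_mono Un_mono) auto
  with * show ?thesis by (meson subset_trans)
qed

lemma graded_LS_eventually_all:
  assumes "central_at 0 P"
  shows "\<forall>\<^sub>F d in sequentially. graded_part P (LS P r (CARD('n) - 1)) d = graded_part P (splines P r) d"
proof -
  obtain c d0 where *: "\<And>d. d0 \<le> d \<Longrightarrow> \<exists>B. finite B \<and> card B \<le> c * growth (CARD('n) - Suc (CARD('n) - 1)) d \<and>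
    graded_part P (splines P r) d \<subseteq> tuple_space.span (B \<union> graded_part P (LS P r (CARD('n) - 1)) d)"
    using graded_growth[OF assms, of "CARD('n) - 1"] by blast
  have "graded_part P (LS P r (CARD('n) - 1)) d = graded_part P (splines P r) d" if d: "d0 \<le> d" for d
  proof
    show "graded_part P (LS P r (CARD('n) - 1)) d \<subseteq> graded_part P (splines P r) d"
      using LS_subset_splines by (auto simp: graded_part_def)
    obtain B where B: "finite B" "card B \<le> c * growth (CARD('n) - Suc (CARD('n) - 1)) d"
      "graded_part P (splines P r) d \<subseteq> tuple_space.span (B \<union> graded_part P (LS P r (CARD('n) - 1)) d)"
      using *[OF d] by blast
    have "B = {}" using B(1,2) by (simp add: growth_def)
    moreover have "tuple_space.subspace (graded_part P (LS P r (CARD('n) - 1)) d)"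
      unfolding graded_part_eq by (rule tuple_space.subspace_inter[OF subspace_LS subspace_with_keys])
    ultimately show "graded_part P (splines P r) d \<subseteq> graded_part P (LS P r (CARD('n) - 1)) d"
      using B(3) by (metis Un_empty_left tuple_space.span_eq_iff)
  qed
  then show ?thesis unfolding eventually_sequentially by blast
qed

lemma hilbert_poly_coeffs_agree:
  assumes central: "central_at 0 P" and i: "CARD('n) - Suc k \<le> i"
  shows "coeff (hilbert_poly P (splines P r)) i = coeff (hilbert_poly P (LS P r k)) i"
proof -
  let ?C = "\<lambda>d. graded_part P (splines P r) d" and ?L = "\<lambda>d. graded_part P (LS P r k) d"
  obtain h where h: "\<forall>\<^sub>F d in sequentially. poly h (real d) = real (tuple_space.dim (?C d))"
    using hilbert_function_submodule[OF subspace_splines subset_refl pmul_splines]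
    unfolding eventually_polynomial_def by blast
  obtain g where g: "\<forall>\<^sub>F d in sequentially. poly g (real d) = real (tuple_space.dim (?L d))"
    using hilbert_function_submodule[OF subspace_LS LS_subset_splines LS_pmul]
    unfolding eventually_polynomial_def by blast
  obtain c d0 where c: "\<And>d. d0 \<le> d \<Longrightarrow> \<exists>B. finite B \<and> card B \<le> c * growth (CARD('n) - Suc k) d \<and>
    ?C d \<subseteq> tuple_space.span (B \<union> ?L d)"
    using graded_growth[OF central, of k] by blast
  have bound: "tuple_space.dim (?L d) \<le> tuple_space.dim (?C d) \<and>
      tuple_space.dim (?C d) \<le> c * growth (CARD('n) - Suc k) d + tuple_space.dim (?L d)" if d: "d0 \<le> d" for d
  proof
    obtain B1 where B1: "finite B1" "tuple_space.span B1 = ?C d" "card B1 = tuple_space.dim (?C d)"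
      using dim_graded_part[OF subspace_splines subset_refl, of d] by blast
    obtain B2 where B2: "finite B2" "tuple_space.span B2 = ?L d" "card B2 = tuple_space.dim (?L d)"
      using dim_graded_part[OF subspace_LS LS_subset_splines, of k d] by blast
    have "?L d \<subseteq> ?C d" using LS_subset_splines by (auto simp: graded_part_def)
    then show "tuple_space.dim (?L d) \<le> tuple_space.dim (?C d)"
      using tuple_space.dim_le_card[of "?L d" B1] B1 by simp
    obtain B where B: "finite B" "card B \<le> c * growth (CARD('n) - Suc k) d" "?C d \<subseteq> tuple_space.span (B \<union> ?L d)"
      using c[OF d] by blast
    have "B \<union> ?L d \<subseteq> tuple_space.span (B \<union> B2)"
      using tuple_space.span_superset[of "B \<union> B2"] tuple_space.span_mono[of B2 "B \<union> B2"] B2(2) by blast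
    then have "?C d \<subseteq> tuple_space.span (B \<union> B2)"
      using B(3) tuple_space.span_minimal[OF _ tuple_space.subspace_span] by blast
    then have "tuple_space.dim (?C d) \<le> card (B \<union> B2)" using B(1) B2(1) by (intro tuple_space.dim_le_card) auto
    also have "\<dots> \<le> card B + card B2" by (rule card_Un_le)
    finally show "tuple_space.dim (?C d) \<le> c * growth (CARD('n) - Suc k) d + tuple_space.dim (?L d)"
      using B(2) B2(3) by simp
  qed
  have "\<forall>\<^sub>F d in sequentially. d0 \<le> d" by (rule eventually_ge_at_top)
  with h g have "\<forall>\<^sub>F d in sequentially. 0 \<le> poly (h - g) (real d) \<and>
      poly (h - g) (real d) \<le> real (c * growth (CARD('n) - Suc k) d)"
  proof eventually_elim
    case (elim d)
    have "real (tuple_space.dim (?L d)) \<le> real (tuple_space.dim (?C d))"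
      "real (tuple_space.dim (?C d)) \<le> real (c * growth (CARD('n) - Suc k) d + tuple_space.dim (?L d))"
      using bound[OF elim(3)] by (simp_all only: of_nat_le_iff)
    then show ?case using elim(1,2) by simp
  qed
  then have "coeff (h - g) i = 0" using i by (rule coeff_eq_0_of_growth)
  then show ?thesis by (simp add: hilbert_poly_eqI[OF h] hilbert_poly_eqI[OF g])
qed

text \<open>The filtered case uses all \<open>n + 1\<close> coefficients of the forms. With \<open>k = n\<close> no free variable is
  left, so the growth bound is zero.\<close>

lemma LS_upto_eventually_all: "\<forall>\<^sub>F d in sequentially. LS_upto P r CARD('n) d = splines_upto P r d"
proof -
  let ?E = "UNIV :: (real \<times> (real ^ 'n)) set"
  let ?A = "\<lambda>d. {m :: 'n \<Rightarrow>\<^sub>0 nat. mon_degree m \<le> d}"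
  have mult: "Poly_Mapping.keys (affine_form v * p) \<subseteq> ?A (Suc d)"
    if p: "Poly_Mapping.keys p \<subseteq> ?A d" for v d p
  proof (rule keys_affine_form_mult[OF _ p])
    fix u m assume u: "u \<in> Poly_Mapping.keys (affine_form v)" and m: "m \<in> ?A d"
    have "mon_degree u \<le> 1" using u keys_affine_form_mon_degree(1) by blast
    then show "u + m \<in> ?A (Suc d)" using m by (simp add: mon_degree_add)
  qed
  have "\<exists>c d0. \<forall>d\<ge>d0. \<exists>B. finite B \<and> card B \<le> c * growth (dim ?E - Suc CARD('n)) d \<and>
    splines P r \<inter> with_keys (?A d) \<subseteq>
      tuple_space.span (B \<union> lattice_sum (?A d) CARD('n))"
    by (intro growth_modulo_lattice_sums[where E = ?E and A = ?A] mult) auto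
  then obtain c d0 where *: "\<And>d. d0 \<le> d \<Longrightarrow> \<exists>B. finite B \<and> card B \<le> c * growth (dim ?E - Suc CARD('n)) d \<and>
    splines_upto P r d \<subseteq> tuple_space.span (B \<union> LS_upto P r CARD('n) d)"
    unfolding splines_upto_eq LS_upto_eq by blast
  have q: "dim ?E - Suc CARD('n) = 0" by simp
  have "LS_upto P r CARD('n) d = splines_upto P r d" if d: "d0 \<le> d" for d
  proof
    show "LS_upto P r CARD('n) d \<subseteq> splines_upto P r d"
      unfolding LS_upto_eq splines_upto_eq using lattice_sum_subset_LS LS_subset_splines by blast
    obtain B where B: "finite B" "card B \<le> c * growth (dim ?E - Suc CARD('n)) d"
      "splines_upto P r d \<subseteq> tuple_space.span (B \<union> LS_upto P r CARD('n) d)" using *[OF d] by blast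
    have "B = {}" using B(1,2) unfolding q by (simp add: growth_def)
    moreover have "tuple_space.subspace (LS_upto P r CARD('n) d)"
      unfolding LS_upto_eq by (rule subspace_lattice_sum)
    ultimately show "splines_upto P r d \<subseteq> LS_upto P r CARD('n) d"
      using B(3) by (metis Un_empty_left tuple_space.span_eq_iff)
  qed
  then show ?thesis unfolding eventually_sequentially by blast
qed

lemma lattice_supported_basis:
  assumes eq: "LS_upto P r k d = splines_upto P r d"
  shows "\<exists>B. B \<subseteq> (\<Union>W\<in>cone_lattice_upto P k. CW_upto P r W d) \<and>
    \<not> tuple_space.dependent B \<and> tuple_space.span B = splines_upto P r d"
proof -
  let ?U = "\<Union>W\<in>cone_lattice_upto P k. CW_upto P r W d"
  obtain B where B: "B \<subseteq> ?U" "tuple_space.independent B" "?U \<subseteq> tuple_space.span B"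
    using tuple_space.maximal_independent_subset by blast
  have "LS_upto P r k d \<subseteq> tuple_space.span B"
    unfolding LS_upto_def
    by (rule set_sum_least[OF finite_cone_lattice_upto _ tuple_space.subspace_span]) (use B(3) in blast)
  moreover have "B \<subseteq> splines_upto P r d" using B(1) by (auto simp: CW_upto_def)
  then have "tuple_space.span B \<subseteq> splines_upto P r d"
    using tuple_space.span_minimal tuple_space.subspace_inter[OF subspace_splines subspace_with_keys]
    unfolding splines_upto_eq by blast
  ultimately show ?thesis using B(1,2) eq by blast
qed

end

theorem theorem4p7:
  fixes P :: "(real ^ 'n::finite) set set" and r :: nat
  assumes "polytopal_complex P" and "pure_full_dim P" and "hereditary P"
  shows
    "(central_at 0 P \<longrightarrow>
        (\<forall>k \<le> CARD('n) - 1. \<forall>j \<le> k.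
           coeff (hilbert_poly P (splines P r)) (CARD('n) - 1 - j) =
           coeff (hilbert_poly P (LS P r k)) (CARD('n) - 1 - j)) \<and>
        (\<forall>\<^sub>F d in sequentially.
           graded_part P (LS P r (CARD('n) - 1)) d = graded_part P (splines P r) d)) \<and>
     (\<forall>\<^sub>F d in sequentially. LS_upto P r CARD('n) d = splines_upto P r d) \<and>
     (\<forall>\<^sub>F d in sequentially.
        \<exists>B. B \<subseteq> (\<Union>W\<in>cone_lattice_upto P CARD('n). CW_upto P r W d) \<and>
            \<not> tuple_space.dependent B \<and> tuple_space.span B = splines_upto P r d)"
proof -
  interpret pure_complex P r by unfold_locales (fact assms)+
  have "coeff (hilbert_poly P (splines P r)) (CARD('n) - 1 - j) = coeff (hilbert_poly P (LS P r k)) (CARD('n) - 1 - j)"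
    if "central_at 0 P" "j \<le> k" for k j
    using that by (intro hilbert_poly_coeffs_agree) auto
  moreover have "\<forall>\<^sub>F d in sequentially.
        \<exists>B. B \<subseteq> (\<Union>W\<in>cone_lattice_upto P CARD('n). CW_upto P r W d) \<and>
            \<not> tuple_space.dependent B \<and> tuple_space.span B = splines_upto P r d"
    using LS_upto_eventually_all by (rule eventually_mono) (rule lattice_supported_basis)
  ultimately show ?thesis using graded_LS_eventually_all LS_upto_eventually_all by blast
qed

end
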